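(* Let $R$ be a commutative ring for which every regular ideal is a sum of invertible ideals. The following are equivalent. (1) $R$ is an SP-ring, i.e. every regular ideal of $R$ is a product of radical ideals. (2) Each regular ideal is a product of unique proper radical ideals $J_1\subseteq\cdots\subseteq J_n$ (i.e. each regular ideal can be written uniquely as a product of proper radical ideals forming such a chain, with $R$ the empty product). (3) Every regular prime ideal is maximal and every invertible ideal of $R$ is a product of radical ideals of $R$. (4) Each regular prime ideal is maximal and contains an invertible radical ideal. (5) The radical of each regular finitely generated ideal is invertible. (6) The multiplicative lattice consisting of the regular ideals and the zero ideal is isomorphic, as a multiplicative lattice, to $U_b(\mathrm{Max}^{-1}_{\rm reg}(R))$. (7) $R$ is a Prüfer ring for which the radical of each finitely generated regular ideal is finitely generated.
   Context: All rings are commutative with $1\neq 0$. An ideal is regular if it contains a nonzerodivisor. An ideal $I$ of $R$ is invertible if $IJ=R$ for some $R$-submodule $J$ of the total quotient ring $Q(R)$. $R$ is a Prüfer ring if every finitely generated regular ideal is invertible. The regular ideals together with the zero ideal, ordered by inclusion and with ideal multiplication, form a multiplicative lattice: arbitrary joins are sums, and the meet of a family is its intersection if that is regular and $0$ otherwise. An isomorphism of multiplicative lattices is an order isomorphism that is also a monoid isomorphism. $\mathrm{Max}^{-1}_{\rm reg}(R)$ is the set of regular maximal ideals of $R$ with the inverse topology, which has as a basis of open sets the sets $\{M\mid I\subseteq M\}$ with $I$ a finitely generated regular ideal; this is a Hausdorff space. For a Hausdorff space $X$, $U(X)$ is the monoid, under pointwise addition, of functions $f:X\to\mathbb{N}_0$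 such that $f^{-1}([k,\infty))$ is compact for all $k\geq 1$ (the compactly supported upper semicontinuous functions), ordered by $f\leq_d g$ iff $f(x)\geq g(x)$ for all $x\in X$. $U_b(X)=U(X)\cup\{b\}$, where $b$ is an adjoined bottom element (thought of as the constant function $\infty$; it is a new element even if $X=\emptyset$) with $b+f=f+b=b$ for all $f$. The monoid operation of $U_b(X)$ as a multiplicative lattice is $+$ and its top element is the zero function. *)

theory Defs
  imports
    "HOL-Algebra.Ideal_Product"
    "HOL-Algebra.Module"
    "HOL-Analysis.Abstract_Topology"
begin

section \<open>Regular ideals and the total quotient ring\<close>

definition nonzerodivisors :: "('a, 'm) ring_scheme \<Rightarrow> 'a set" where
  "nonzerodivisors R =
    {s \<in> carrier R. \<forall>x \<in> carrier R. s \<otimes>\<^bsub>R\<^esub> x = \<zero>\<^bsub>R\<^esub> \<longrightarrow> x = \<zero>\<^bsub>R\<^esub>}"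

definition regular_ideal :: "('a, 'm) ring_scheme \<Rightarrow> 'a set \<Rightarrow> bool" where
  "regular_ideal R I \<longleftrightarrow> ideal I R \<and> I \<inter> nonzerodivisors R \<noteq> {}"

definition fg_ideal :: "('a, 'm) ring_scheme \<Rightarrow> 'a set \<Rightarrow> bool" where
  "fg_ideal R I \<longleftrightarrow> (\<exists>A \<subseteq> carrier R. finite A \<and> I = Idl\<^bsub>R\<^esub> A)"

text \<open>Elements of the total quotient ring are equivalence classes of pairs \<open>(a, s)\<close>,
  read as fractions \<open>a / s\<close> with \<open>s\<close> a nonzerodivisor.  No correction factor is needed in
  the equivalence because the denominators are nonzerodivisors.\<close>

definition frac_rel :: "('a, 'm) ring_scheme \<Rightarrow> (('a \<times> 'a) \<times> ('a \<times> 'a)) set" where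
  "frac_rel R = {((a, s), (b, t)).
     a \<in> carrier R \<and> s \<in> nonzerodivisors R \<and> b \<in> carrier R \<and> t \<in> nonzerodivisors R \<and>
     a \<otimes>\<^bsub>R\<^esub> t = b \<otimes>\<^bsub>R\<^esub> s}"

definition fraction :: "('a, 'm) ring_scheme \<Rightarrow> 'a \<Rightarrow> 'a \<Rightarrow> ('a \<times> 'a) set" where
  "fraction R a s = frac_rel R `` {(a, s)}"

definition total_quotient_ring ::
    "('a, 'm) ring_scheme \<Rightarrow> ('a, ('a \<times> 'a) set) module" where
  "total_quotient_ring R =
    \<lparr> carrier = (carrier R \<times> nonzerodivisors R) // frac_rel R,
      mult = (\<lambda>X Y. \<Union>(a, s) \<in> X. \<Union>(b, t) \<in> Y. fraction R (a \<otimes>\<^bsub>R\<^esub> b) (s \<otimes>\<^bsub>R\<^esub> t)),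
      one = fraction R \<one>\<^bsub>R\<^esub> \<one>\<^bsub>R\<^esub>,
      zero = fraction R \<zero>\<^bsub>R\<^esub> \<one>\<^bsub>R\<^esub>,
      add = (\<lambda>X Y. \<Union>(a, s) \<in> X. \<Union>(b, t) \<in> Y.
               fraction R (a \<otimes>\<^bsub>R\<^esub> t \<oplus>\<^bsub>R\<^esub> b \<otimes>\<^bsub>R\<^esub> s) (s \<otimes>\<^bsub>R\<^esub> t)),
      smult = (\<lambda>r X. \<Union>(a, s) \<in> X. fraction R (r \<otimes>\<^bsub>R\<^esub> a) s) \<rparr>"

definition to_total_quotient :: "('a, 'm) ring_scheme \<Rightarrow> 'a \<Rightarrow> ('a \<times> 'a) set" where
  "to_total_quotient R a = fraction R a \<one>\<^bsub>R\<^esub>"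

text \<open>\<open>I J = R\<close> is an equation inside the total quotient ring, so \<open>I\<close> and \<open>R\<close> are replaced
  by their images there.  By its definition \<^const>\<open>ideal_prod\<close> consists of the finite sums
  of products \<open>i \<otimes> j\<close>; it is used here for submodules of the total quotient ring.\<close>

definition invertible_ideal :: "('a, 'm) ring_scheme \<Rightarrow> 'a set \<Rightarrow> bool" where
  "invertible_ideal R I \<longleftrightarrow> ideal I R \<and>
    (\<exists>J. submodule J R (total_quotient_ring R) \<and>
      ideal_prod (total_quotient_ring R) (to_total_quotient R ` I) J
        = to_total_quotient R ` carrier R)"

definition pruefer_ring :: "('a, 'm) ring_scheme \<Rightarrow> bool" where
  "pruefer_ring R \<longleftrightarrow> (\<forall>I. regular_ideal R I \<and> fg_ideal R I \<longrightarrow> invertible_ideal R I)"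

section \<open>Sums, products and radicals of ideals\<close>

text \<open>The sum of a possibly infinite family of ideals is the ideal generated by its union.\<close>

definition sum_of_ideals :: "('a, 'm) ring_scheme \<Rightarrow> 'a set set \<Rightarrow> 'a set" where
  "sum_of_ideals R \<F> = Idl\<^bsub>R\<^esub> (\<Union>\<F>)"

definition product_of_ideals :: "('a, 'm) ring_scheme \<Rightarrow> 'a set list \<Rightarrow> 'a set" where
  "product_of_ideals R Js = foldr (ideal_prod R) Js (carrier R)"

definition radical :: "('a, 'm) ring_scheme \<Rightarrow> 'a set \<Rightarrow> 'a set" where
  "radical R I = {x \<in> carrier R. \<exists>n::nat. n \<ge> 1 \<and> x [^]\<^bsub>R\<^esub> n \<in> I}"

definition radical_ideal :: "('a, 'm) ring_scheme \<Rightarrow> 'a set \<Rightarrow> bool" where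
  "radical_ideal R J \<longleftrightarrow> ideal J R \<and> radical R J = J"

definition product_of_radical_ideals :: "('a, 'm) ring_scheme \<Rightarrow> 'a set \<Rightarrow> bool" where
  "product_of_radical_ideals R I \<longleftrightarrow>
    (\<exists>Js. (\<forall>J \<in> set Js. radical_ideal R J) \<and> I = product_of_ideals R Js)"

definition sp_ring :: "('a, 'm) ring_scheme \<Rightarrow> bool" where
  "sp_ring R \<longleftrightarrow> (\<forall>I. regular_ideal R I \<longrightarrow> product_of_radical_ideals R I)"

section \<open>Multiplicative lattices\<close>

text \<open>Arbitrary joins and meets are determined by the order, so only the monoid structure and
  the order relation are recorded.\<close>

record 'a mult_lattice = "'a monoid" +
  leq :: "'a \<Rightarrow> 'a \<Rightarrow> bool"

definition mult_lattice_iso ::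
    "('a, 'm) mult_lattice_scheme \<Rightarrow> ('b, 'n) mult_lattice_scheme \<Rightarrow> ('a \<Rightarrow> 'b) set" where
  "mult_lattice_iso L K =
    {h \<in> iso L K. h \<one>\<^bsub>L\<^esub> = \<one>\<^bsub>K\<^esub> \<and>
       (\<forall>x \<in> carrier L. \<forall>y \<in> carrier L. leq L x y \<longleftrightarrow> leq K (h x) (h y))}"

definition regular_ideal_lattice :: "('a, 'm) ring_scheme \<Rightarrow> 'a set mult_lattice" where
  "regular_ideal_lattice R =
    \<lparr> carrier = {I. regular_ideal R I} \<union> {{\<zero>\<^bsub>R\<^esub>}},
      mult = ideal_prod R,
      one = carrier R,
      leq = (\<subseteq>) \<rparr>"

text \<open>Functions on the space are represented by functions that are \<^const>\<open>undefined\<close>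
  outside it, so that equality is equality of functions on the space.\<close>

definition compact_usc :: "'x topology \<Rightarrow> ('x \<Rightarrow> nat) set" where
  "compact_usc X =
    {f \<in> extensional (topspace X).
       \<forall>k \<ge> 1. compactin X {x \<in> topspace X. f x \<ge> k}}"

text \<open>\<^const>\<open>None\<close> is the adjoined bottom element.  The order on functions is the reverse of
  the pointwise order.\<close>

definition compact_usc_lattice :: "'x topology \<Rightarrow> ('x \<Rightarrow> nat) option mult_lattice" where
  "compact_usc_lattice X =
    \<lparr> carrier = insert None (Some ` compact_usc X),
      mult = (\<lambda>u v. case (u, v) of
                (Some f, Some g) \<Rightarrow> Some (\<lambda>x \<in> topspace X. f x + g x)
              | _ \<Rightarrow> None),
      one = Some (\<lambda>x \<in> topspace X. 0),
      leq = (\<lambda>u v. case (u, v) of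
                (None, _) \<Rightarrow> True
              | (Some f, None) \<Rightarrow> False
              | (Some f, Some g) \<Rightarrow> (\<forall>x \<in> topspace X. f x \<ge> g x)) \<rparr>"

section \<open>The inverse topology on the regular maximal ideals\<close>

definition max_reg :: "('a, 'm) ring_scheme \<Rightarrow> 'a set set" where
  "max_reg R = {M. maximalideal M R \<and> regular_ideal R M}"

text \<open>The generating sets cover \<open>max_reg R\<close> and are closed under binary intersection,
  the sets of \<open>I\<close> and \<open>J\<close> intersecting in that of \<open>I + J\<close>; so they form a basis of the
  topology they generate.\<close>

definition inverse_topology_max_reg :: "('a, 'm) ring_scheme \<Rightarrow> 'a set topology" where
  "inverse_topology_max_reg R =
    topology_generated_by
      {{M \<in> max_reg R. I \<subseteq> M} | I. regular_ideal R I \<and> fg_ideal R I}"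

end

theory Submission
  imports Defs "HOL-Analysis.T1_Spaces"
begin

no_notation Sum_Type.Plus (infixr \<open><+>\<close> 65)

text \<open>Invertible ideals can be cancelled and divided by, so localizations and fractions are avoided:
  \<open>I\<close> is invertible iff \<open>I K = sR\<close> for an ideal \<open>K\<close> and a nonzerodivisor \<open>s\<close>, and a statement about
  the localization at a prime \<open>M\<close> is phrased with multipliers \<open>u \<notin> M\<close>.

  The centre of the argument is (4).  If \<open>J\<close> is an invertible radical ideal inside a regular maximal
  ideal \<open>M\<close>, then \<open>J\<close> agrees with \<open>M\<close> locally at \<open>M\<close>, and every finitely generated regular \<open>A\<close>
  satisfies \<open>u A = J\<^sup>n B\<close> with \<open>u \<notin> M\<close> and \<open>B \<not>\<subseteq> M\<close>.  This yields (7) and an additive order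
  \<open>ord\<^sub>M I\<close>, the largest \<open>k\<close> with \<open>I \<subseteq> M\<^sup>k\<close>; the orders at all regular maximal ideals determine a
  regular ideal.  The radical ideals \<open>J\<^sub>k = \<Inter>{M. k \<le> ord\<^sub>M I}\<close> then form the unique chain with product
  \<open>I\<close>, which gives (2), and \<open>I \<mapsto> (M \<mapsto> ord\<^sub>M I)\<close> is the isomorphism of (6).  Conversely (6) gives (1)
  because an upper semicontinuous function is the sum of the characteristic functions of its level
  sets, and (1) and (5) each force regular primes to be maximal.\<close>

section \<open>Ideals of a commutative ring\<close>

text \<open>The ring need not be Noetherian, so multipliers found for the single elements of an
  ideal combine into one multiplier for the whole ideal only under finite generation. This is why
  factorizations are stated for finitely generated ideals, and an arbitrary regular ideal is
  approached through finitely generated regular ideals inside it that contain a chosen element. The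
  passages from local to global share one form: the multipliers for which a claim holds make up an
  ideal \<open>T\<close>, a nonzerodivisor lies in \<open>T\<close>, and no regular maximal ideal
  contains \<open>T\<close>, so \<open>T\<close> is the unit ideal. Regularity of \<open>T\<close>
  matters because uniformizers are available at regular maximal ideals only. The hypothesis on sums
  serves to find, in a regular ideal that is not contained in a given ideal, an invertible ideal
  with the same property; such ideals are what a non-maximal regular prime is contradicted
  with.\<close>

context cring
begin

lemmas ideal_carrier = ideal.Icarr
lemmas ideal_add_closed = additive_subgroup.a_closed[OF ideal.axioms(1)]
lemmas ideal_zero_closed = additive_subgroup.zero_closed[OF ideal.axioms(1)]
lemmas ideal_mult_closed = ideal.I_l_closed

lemma ideal_subset_carrier: "ideal I R \<Longrightarrow> I \<subseteq> carrier R"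
  by (auto intro: ideal_carrier)

lemma ideal_uminus_closed: "ideal I R \<Longrightarrow> x \<in> I \<Longrightarrow> \<ominus> x \<in> I"
  by (simp add: additive_subgroup.a_inv_closed ideal.axioms(1))

lemma ideal_criterion:
  assumes "I \<subseteq> carrier R" "\<zero> \<in> I"
    and "\<And>x y. x \<in> I \<Longrightarrow> y \<in> I \<Longrightarrow> x \<oplus> y \<in> I"
    and "\<And>r x. r \<in> carrier R \<Longrightarrow> x \<in> I \<Longrightarrow> r \<otimes> x \<in> I"
  shows "ideal I R"
proof (rule idealI[OF ring_axioms])
  have uminus: "\<ominus> x \<in> I" if "x \<in> I" for x
  proof -
    have "\<ominus> x = (\<ominus> \<one>) \<otimes> x" using that assms(1) by (simp add: l_minus subset_iff)
    then show ?thesis using assms(4)[OF _ that, of "\<ominus> \<one>"] by simp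
  qed
  show "subgroup I (add_monoid R)"
    by (rule add.subgroupI)
       (use assms uminus in \<open>auto simp flip: a_inv_def\<close>)
  show "r \<otimes> x \<in> I" if "x \<in> I" "r \<in> carrier R" for x r using assms(4) that by blast
  show "x \<otimes> r \<in> I" if "x \<in> I" "r \<in> carrier R" for x r
    using assms(1,4) that m_comm by (metis subsetD)
qed

lemma ideal_eq_carrier_iff: "ideal I R \<Longrightarrow> I = carrier R \<longleftrightarrow> \<one> \<in> I"
  using ideal.one_imp_carrier by blast

lemma ideal_Union_chain:
  assumes "C \<noteq> {}" "\<And>I. I \<in> C \<Longrightarrow> ideal I R"
    and "\<And>I J. I \<in> C \<Longrightarrow> J \<in> C \<Longrightarrow> I \<subseteq> J \<or> J \<subseteq> I"
  shows "ideal (\<Union>C) R"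
proof (rule ideal_criterion)
  show "\<Union>C \<subseteq> carrier R" using assms(2) ideal_subset_carrier by blast
  show "\<zero> \<in> \<Union>C" using assms(1,2) ideal_zero_closed by blast
  fix x y assume "x \<in> \<Union>C" "y \<in> \<Union>C"
  then obtain I J where "I \<in> C" "J \<in> C" "x \<in> I" "y \<in> J" by blast
  then show "x \<oplus> y \<in> \<Union>C"
    using assms(3)[of I J] ideal_add_closed[OF assms(2)] by blast
next
  fix r x assume "r \<in> carrier R" "x \<in> \<Union>C"
  then show "r \<otimes> x \<in> \<Union>C" using ideal_mult_closed[OF assms(2)] by blast
qed

text \<open>Inserting the carrier admits the empty family, whose intersection is then the unit
  ideal; radicals and level ideals can fall into this case.\<close>

lemma ideal_carrier_Int_Inter:
  assumes "\<And>I. I \<in> C \<Longrightarrow> ideal I R"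
  shows "ideal (carrier R \<inter> \<Inter>C) R"
  using i_Intersect[of "insert (carrier R) C"] assms oneideal by auto

lemma ideal_colon:
  assumes "ideal I R" "A \<subseteq> carrier R"
  shows "ideal {r \<in> carrier R. \<forall>x\<in>A. r \<otimes> x \<in> I} R"
proof (rule ideal_criterion)
  fix r s assume "r \<in> {r \<in> carrier R. \<forall>x\<in>A. r \<otimes> x \<in> I}" "s \<in> {r \<in> carrier R. \<forall>x\<in>A. r \<otimes> x \<in> I}"
  then show "r \<oplus> s \<in> {r \<in> carrier R. \<forall>x\<in>A. r \<otimes> x \<in> I}"
    using assms by (auto simp: l_distr subset_iff intro: ideal_add_closed)
next
  fix r s assume "r \<in> carrier R" "s \<in> {r \<in> carrier R. \<forall>x\<in>A. r \<otimes> x \<in> I}"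
  then show "r \<otimes> s \<in> {r \<in> carrier R. \<forall>x\<in>A. r \<otimes> x \<in> I}"
    using assms by (auto simp: m_assoc subset_iff intro: ideal_mult_closed)
qed (use assms in \<open>auto simp: ideal_zero_closed subset_iff\<close>)

lemma mem_PIdl_iff: "x \<in> PIdl a \<longleftrightarrow> (\<exists>r\<in>carrier R. x = r \<otimes> a)"
  by (auto simp: cgenideal_def)

lemma PIdl_subset_iff: "ideal I R \<Longrightarrow> a \<in> carrier R \<Longrightarrow> PIdl a \<subseteq> I \<longleftrightarrow> a \<in> I"
  using cgenideal_minimal cgenideal_self by blast

lemma ideal_prod_subset_iff:
  assumes "ideal K R"
  shows "I \<cdot> J \<subseteq> K \<longleftrightarrow> (\<forall>i\<in>I. \<forall>j\<in>J. i \<otimes> j \<in> K)"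
proof
  show "I \<cdot> J \<subseteq> K \<Longrightarrow> \<forall>i\<in>I. \<forall>j\<in>J. i \<otimes> j \<in> K"
    using ideal_prod.prod[of _ I _ J R] by blast
  assume *: "\<forall>i\<in>I. \<forall>j\<in>J. i \<otimes> j \<in> K"
  show "I \<cdot> J \<subseteq> K"
  proof
    fix x assume "x \<in> I \<cdot> J"
    then show "x \<in> K"
      by induction (use * in \<open>auto intro: ideal_add_closed[OF assms]\<close>)
  qed
qed

lemma ideal_prod_mono:
  assumes "I \<subseteq> I'" "J \<subseteq> J'"
  shows "I \<cdot> J \<subseteq> I' \<cdot> J'"
proof
  fix x assume "x \<in> I \<cdot> J"
  then show "x \<in> I' \<cdot> J'"
    by induction (use assms in \<open>auto intro: ideal_prod.intros\<close>)
qed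

lemma ideal_prod_lcomm:
  "ideal I R \<Longrightarrow> ideal J R \<Longrightarrow> ideal K R \<Longrightarrow> I \<cdot> (J \<cdot> K) = J \<cdot> (I \<cdot> K)"
  by (metis ideal_prod_assoc ideal_prod_commute)

lemmas ideal_prod_ac = ideal_prod_assoc ideal_prod_commute ideal_prod_lcomm

lemma ideal_prod_carrier: "ideal I R \<Longrightarrow> carrier R \<cdot> I = I"
  using ideal_prod_commute ideal_prod_one oneideal by force

lemma ideal_prod_subset_left: "ideal I R \<Longrightarrow> ideal J R \<Longrightarrow> I \<cdot> J \<subseteq> I"
  and ideal_prod_subset_right: "ideal I R \<Longrightarrow> ideal J R \<Longrightarrow> I \<cdot> J \<subseteq> J"
  using ideal_prod_inter by auto

lemma PIdl_prod_subset_iff: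
  assumes "ideal I R" "ideal K R" "a \<in> carrier R"
  shows "(PIdl a) \<cdot> I \<subseteq> K \<longleftrightarrow> (\<forall>x\<in>I. a \<otimes> x \<in> K)"
proof -
  have "\<forall>x\<in>I. a \<otimes> x \<in> K" if "(PIdl a) \<cdot> I \<subseteq> K"
    using that cgenideal_self[OF assms(3)] ideal_prod.prod[of a "PIdl a" _ I R] by blast
  moreover have "(PIdl a) \<cdot> I \<subseteq> K" if *: "\<forall>x\<in>I. a \<otimes> x \<in> K"
  proof -
    have "(r \<otimes> a) \<otimes> x \<in> K" if "r \<in> carrier R" "x \<in> I" for r x
      using that * assms m_assoc[of r a x] ideal_carrier[OF assms(1)] ideal_mult_closed[OF assms(2)]
      by auto
    then show ?thesis
      unfolding ideal_prod_subset_iff[OF assms(2)] by (auto simp: mem_PIdl_iff)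
  qed
  ultimately show ?thesis by blast
qed

text \<open>The multiples of \<open>a\<close> by members of \<open>I\<close> are already closed
  under sums, so the finite sums in the definition of the product collapse to one term.\<close>

lemma mem_PIdl_prod_iff:
  assumes "ideal I R" "a \<in> carrier R"
  shows "z \<in> (PIdl a) \<cdot> I \<longleftrightarrow> (\<exists>x\<in>I. z = a \<otimes> x)"
proof -
  have "ideal {a \<otimes> x |x. x \<in> I} R"
  proof (rule ideal_criterion)
    fix x y assume "x \<in> {a \<otimes> x |x. x \<in> I}" "y \<in> {a \<otimes> x |x. x \<in> I}"
    then obtain u v where "x = a \<otimes> u" "y = a \<otimes> v" "u \<in> I" "v \<in> I" by blast
    moreover have "a \<otimes> u \<oplus> a \<otimes> v = a \<otimes> (u \<oplus> v)"
      using calculation assms by (simp add: r_distr ideal_carrier[of I])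
    ultimately show "x \<oplus> y \<in> {a \<otimes> x |x. x \<in> I}"
      using ideal_add_closed[OF assms(1)] by auto
  next
    fix r x assume "r \<in> carrier R" "x \<in> {a \<otimes> x |x. x \<in> I}"
    then obtain u where "x = a \<otimes> u" "u \<in> I" "r \<in> carrier R" by blast
    moreover have "r \<otimes> (a \<otimes> u) = a \<otimes> (r \<otimes> u)"
      using calculation assms by (simp add: m_lcomm ideal_carrier[of I])
    ultimately show "r \<otimes> x \<in> {a \<otimes> x |x. x \<in> I}"
      using ideal_mult_closed[OF assms(1)] by auto
  next
    have "a \<otimes> \<zero> \<in> {a \<otimes> x |x. x \<in> I}" using ideal_zero_closed[OF assms(1)] by blast
    then show "\<zero> \<in> {a \<otimes> x |x. x \<in> I}" using assms by simp
  qed (use assms ideal_carrier[OF assms(1)] in auto)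
  then have "(PIdl a) \<cdot> I \<subseteq> {a \<otimes> x |x. x \<in> I}"
    using assms PIdl_prod_subset_iff by blast
  moreover have "a \<otimes> x \<in> (PIdl a) \<cdot> I" if "x \<in> I" for x
    using that cgenideal_self[OF assms(2)] by (rule ideal_prod.prod[rotated])
  ultimately show ?thesis by auto
qed

lemma PIdl_prod:
  assumes "a \<in> carrier R" "b \<in> carrier R"
  shows "(PIdl a) \<cdot> (PIdl b) = PIdl (a \<otimes> b)"
proof -
  have "a \<otimes> (r \<otimes> b) = r \<otimes> (a \<otimes> b)" if "r \<in> carrier R" for r
    by (rule m_lcomm[OF assms(1) that assms(2)])
  then have "(\<lambda>x. a \<otimes> x) ` {r \<otimes> b |r. r \<in> carrier R} = {r \<otimes> (a \<otimes> b) |r. r \<in> carrier R}"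
    unfolding image_Collect by force
  moreover have "(PIdl a) \<cdot> (PIdl b) = (\<lambda>x. a \<otimes> x) ` (PIdl b)"
    using mem_PIdl_prod_iff[OF cgenideal_ideal[OF assms(2)] assms(1)] by blast
  ultimately show ?thesis by (simp only: cgenideal_def)
qed

lemma set_add_subset_iff:
  assumes "ideal I R" "ideal J R" "ideal K R"
  shows "I <+> J \<subseteq> K \<longleftrightarrow> I \<subseteq> K \<and> J \<subseteq> K"
  using Idl_subset_ideal[OF assms(3), of "I \<union> J"] assms ideal_subset_carrier
  by (simp add: union_genideal)

lemma subset_set_add_left: "ideal I R \<Longrightarrow> ideal J R \<Longrightarrow> I \<subseteq> I <+> J"
  and subset_set_add_right: "ideal I R \<Longrightarrow> ideal J R \<Longrightarrow> J \<subseteq> I <+> J"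
  using set_add_subset_iff add_ideals by blast+

lemma mem_set_add_iff: "z \<in> I <+> J \<longleftrightarrow> (\<exists>x\<in>I. \<exists>y\<in>J. z = x \<oplus> y)"
  by (auto simp: set_add_def')

lemma set_add_mono: "I \<subseteq> I' \<Longrightarrow> J \<subseteq> J' \<Longrightarrow> I <+> J \<subseteq> I' <+> J'"
  unfolding set_add_def' by blast

subsection \<open>Finitely generated ideals\<close>

lemma fg_ideal_ideal: "fg_ideal R I \<Longrightarrow> ideal I R"
  by (auto simp: fg_ideal_def genideal_ideal)

lemma Idl_Un:
  assumes "A \<subseteq> carrier R" "B \<subseteq> carrier R"
  shows "Idl (A \<union> B) = Idl A <+> Idl B"
proof
  have i: "ideal (Idl A) R" "ideal (Idl B) R" "ideal (Idl (A \<union> B)) R"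
    using assms genideal_ideal by auto
  then have "A \<union> B \<subseteq> Idl A <+> Idl B"
    using genideal_self[OF assms(1)] genideal_self[OF assms(2)]
      subset_set_add_left[OF i(1,2)] subset_set_add_right[OF i(1,2)] by blast
  then show "Idl (A \<union> B) \<subseteq> Idl A <+> Idl B"
    using i add_ideals genideal_minimal by blast
  show "Idl A <+> Idl B \<subseteq> Idl (A \<union> B)"
    using i assms subset_Idl_subset[of "A \<union> B"] by (simp add: set_add_subset_iff)
qed

lemma fg_ideal_set_add:
  assumes "fg_ideal R I" "fg_ideal R J"
  shows "fg_ideal R (I <+> J)"
proof -
  obtain A B where "A \<subseteq> carrier R" "finite A" "I = Idl A" "B \<subseteq> carrier R" "finite B" "J = Idl B"
    using assms by (auto simp: fg_ideal_def)
  then show ?thesis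
    unfolding fg_ideal_def by (intro exI[of _ "A \<union> B"]) (simp add: Idl_Un)
qed

lemma fg_ideal_PIdl: "a \<in> carrier R \<Longrightarrow> fg_ideal R (PIdl a)"
  unfolding fg_ideal_def by (intro exI[of _ "{a}"]) (simp add: cgenideal_eq_genideal)

lemma Idl_empty: "Idl {} = {\<zero>}"
  using genideal_minimal[OF zeroideal, of "{}"] ideal_zero_closed[OF genideal_ideal[of "{}"]] by auto

lemma fg_ideal_zero: "fg_ideal R {\<zero>}"
  unfolding fg_ideal_def using Idl_empty by (intro exI[of _ "{}"]) auto

lemma fg_ideal_induct [consumes 1, case_names zero add]:
  assumes "fg_ideal R I" "P {\<zero>}"
    and "\<And>x I. x \<in> carrier R \<Longrightarrow> fg_ideal R I \<Longrightarrow> P I \<Longrightarrow> P (PIdl x <+> I)"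
  shows "P I"
proof -
  obtain A where A: "finite A" "A \<subseteq> carrier R" "I = Idl A" using assms(1) by (auto simp: fg_ideal_def)
  from A(1,2) have "P (Idl A)"
  proof induction
    case empty
    then show ?case using assms(2) Idl_empty by simp
  next
    case (insert x A)
    then have "Idl (insert x A) = PIdl x <+> Idl A"
      using Idl_Un[of "{x}" A] by (simp add: cgenideal_eq_genideal)
    moreover have "fg_ideal R (Idl A)"
      using insert unfolding fg_ideal_def by blast
    ultimately show ?case using assms(3) insert by simp
  qed
  then show ?thesis using A by simp
qed

lemma fg_ideal_prod:
  assumes "fg_ideal R I" "fg_ideal R J"
  shows "fg_ideal R (I \<cdot> J)"
proof -
  have PIdl_case: "fg_ideal R ((PIdl a) \<cdot> J)" if "a \<in> carrier R" for a
    using assms(2)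
  proof (induction rule: fg_ideal_induct)
    case zero
    then show ?case using that by (simp add: cgenideal_ideal ideal_prod_zero fg_ideal_zero)
  next
    case (add x K)
    then show ?case
      using that
      by (simp add: ideal_prod_distr cgenideal_ideal fg_ideal_ideal PIdl_prod fg_ideal_set_add fg_ideal_PIdl)
  qed
  have J: "ideal J R" using assms(2) fg_ideal_ideal by blast
  show ?thesis
    using assms(1)
  proof (induction rule: fg_ideal_induct)
    case zero
    then show ?case using J ideal_prod_zero ideal_prod_commute zeroideal fg_ideal_zero by metis
  next
    case (add x K)
    then show ?case
      using J PIdl_case
      by (simp add: ideal_prod_distr cgenideal_ideal fg_ideal_ideal fg_ideal_set_add)
  qed
qed

lemma fg_ideal_carrier: "fg_ideal R (carrier R)"
  using fg_ideal_PIdl[of \<one>] by (simp add: cgenideal_eq_genideal genideal_one)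

text \<open>A member of the product is a finite sum, so it involves only finitely many elements of
  \<open>I\<close>. This is what makes invertible ideals finitely generated.\<close>

lemma mem_prod_fg_left:
  assumes "ideal I R" "x \<in> I \<cdot> J" "ideal J R"
  shows "\<exists>F\<subseteq>I. fg_ideal R F \<and> x \<in> F \<cdot> J"
  using assms(2)
proof induction
  case (prod i j)
  then have "i \<in> carrier R" using ideal_carrier[OF assms(1)] by blast
  then have "PIdl i \<subseteq> I" "fg_ideal R (PIdl i)" "i \<otimes> j \<in> (PIdl i) \<cdot> J"
    using prod assms by (simp_all add: PIdl_subset_iff fg_ideal_PIdl cgenideal_self ideal_prod.prod)
  then show ?case by blast
next
  case (sum x y)
  then obtain F G where FG: "F \<subseteq> I" "fg_ideal R F" "x \<in> F \<cdot> J" "G \<subseteq> I" "fg_ideal R G" "y \<in> G \<cdot> J"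
    by blast
  then have i: "ideal F R" "ideal G R" by (simp_all add: fg_ideal_ideal)
  then have "x \<in> (F <+> G) \<cdot> J" "y \<in> (F <+> G) \<cdot> J"
    using FG(3,6) ideal_prod_mono[OF subset_set_add_left, of F G J J]
      ideal_prod_mono[OF subset_set_add_right, of F G J J] by auto
  then have "x \<oplus> y \<in> (F <+> G) \<cdot> J" by (rule ideal_prod.sum)
  moreover have "F <+> G \<subseteq> I" using i FG assms by (simp add: set_add_subset_iff)
  ultimately show ?case using FG fg_ideal_set_add by blast
qed

end

section \<open>Invertible ideals without fractions\<close>

context cring
begin

lemma nonzerodivisors_closed: "s \<in> nonzerodivisors R \<Longrightarrow> s \<in> carrier R"
  by (simp add: nonzerodivisors_def)

lemma nonzerodivisors_one: "\<one> \<in> nonzerodivisors R"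
  by (simp add: nonzerodivisors_def)

lemma nonzerodivisors_mult:
  assumes "s \<in> nonzerodivisors R" "t \<in> nonzerodivisors R"
  shows "s \<otimes> t \<in> nonzerodivisors R"
proof -
  have cl: "s \<in> carrier R" "t \<in> carrier R" using assms by (auto intro: nonzerodivisors_closed)
  have "x = \<zero>" if "x \<in> carrier R" "(s \<otimes> t) \<otimes> x = \<zero>" for x
  proof -
    have "s \<otimes> (t \<otimes> x) = \<zero>" using that cl m_assoc by metis
    then have "t \<otimes> x = \<zero>" using assms(1) cl that(1) unfolding nonzerodivisors_def by blast
    then show "x = \<zero>" using assms(2) that(1) unfolding nonzerodivisors_def by blast
  qed
  then show ?thesis using cl unfolding nonzerodivisors_def by blast
qed

lemma nonzerodivisors_cancel:
  assumes "s \<in> nonzerodivisors R" "x \<in> carrier R" "y \<in> carrier R" "s \<otimes> x = s \<otimes> y"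
  shows "x = y"
proof -
  have s: "s \<in> carrier R" using assms(1) by (rule nonzerodivisors_closed)
  have "s \<otimes> (x \<ominus> y) = s \<otimes> x \<ominus> s \<otimes> y"
    using s assms(2,3) by (simp add: a_minus_def r_distr r_minus)
  also have "\<dots> = \<zero>" using s assms(2-4) by (simp add: a_minus_def r_neg)
  finally have "s \<otimes> (x \<ominus> y) = \<zero>" .
  then have "x \<oplus> \<ominus> y = \<zero>"
    using assms(1-3) unfolding nonzerodivisors_def a_minus_def by blast
  then show ?thesis
    using sum_zero_eq_neg[of x "\<ominus> y"] assms(2,3) by simp
qed

section \<open>Arithmetic of fractions in the total quotient ring\<close>

lemma frac_rel_iff:
  "((a, s), (b, t)) \<in> frac_rel R \<longleftrightarrow> a \<in> carrier R \<and> s \<in> nonzerodivisors R \<and>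
     b \<in> carrier R \<and> t \<in> nonzerodivisors R \<and> a \<otimes> t = b \<otimes> s"
  by (simp add: frac_rel_def)

lemma equiv_frac_rel: "equiv (carrier R \<times> nonzerodivisors R) (frac_rel R)"
proof (rule equivI)
  show "frac_rel R \<subseteq> (carrier R \<times> nonzerodivisors R) \<times> (carrier R \<times> nonzerodivisors R)"
    by (auto simp: frac_rel_def)
  show "refl_on (carrier R \<times> nonzerodivisors R) (frac_rel R)"
    by (auto simp: refl_on_def frac_rel_def)
  show "sym (frac_rel R)"
    by (auto simp: sym_def frac_rel_def)
  \<comment> \<open>Both sides agree after multiplication by the middle denominator
    \<open>t\<close>, which cancels because it is a nonzerodivisor.\<close>
  have "a \<otimes> u = c \<otimes> s"
    if *: "a \<in> carrier R" "s \<in> nonzerodivisors R" "b \<in> carrier R" "t \<in> nonzerodivisors R"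
      "a \<otimes> t = b \<otimes> s" "c \<in> carrier R" "u \<in> nonzerodivisors R" "b \<otimes> u = c \<otimes> t" for a b c s t u
  proof (rule nonzerodivisors_cancel[OF *(4)])
    have cl: "s \<in> carrier R" "t \<in> carrier R" "u \<in> carrier R"
      using * by (simp_all add: nonzerodivisors_closed)
    have "t \<otimes> (a \<otimes> u) = (a \<otimes> t) \<otimes> u" using *(1) cl by (simp add: m_ac)
    also have "\<dots> = (b \<otimes> u) \<otimes> s" unfolding *(5) using *(3) cl by (simp add: m_ac)
    also have "\<dots> = t \<otimes> (c \<otimes> s)" unfolding *(8) using *(6) cl by (simp add: m_ac)
    finally show "t \<otimes> (a \<otimes> u) = t \<otimes> (c \<otimes> s)" .
  qed (use * in \<open>simp_all add: nonzerodivisors_closed\<close>)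
  then show "trans (frac_rel R)"
    unfolding trans_def split_paired_All frac_rel_iff by blast
qed

lemma fraction_eq_iff:
  assumes "a \<in> carrier R" "s \<in> nonzerodivisors R" "b \<in> carrier R" "t \<in> nonzerodivisors R"
  shows "fraction R a s = fraction R b t \<longleftrightarrow> a \<otimes> t = b \<otimes> s"
  unfolding fraction_def
  using eq_equiv_class_iff[OF equiv_frac_rel, of "(a, s)" "(b, t)"] assms by (simp add: frac_rel_iff)

lemma mem_fraction_iff:
  "(b, t) \<in> fraction R a s \<longleftrightarrow> a \<in> carrier R \<and> s \<in> nonzerodivisors R \<and>
     b \<in> carrier R \<and> t \<in> nonzerodivisors R \<and> b \<otimes> s = a \<otimes> t"
  by (auto simp: fraction_def frac_rel_iff)

lemma fraction_self:
  "a \<in> carrier R \<Longrightarrow> s \<in> nonzerodivisors R \<Longrightarrow> (a, s) \<in> fraction R a s"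
  by (simp add: mem_fraction_iff)

text \<open>The operations of \<open>total_quotient_ring\<close> are unions over all
  representatives; once the result does not depend on the representative, the union is a single
  class.\<close>

lemma UN_fraction_eq_const:
  assumes "a \<in> carrier R" "s \<in> nonzerodivisors R"
    and "\<And>b t. (b, t) \<in> fraction R a s \<Longrightarrow> F b t = C"
  shows "(\<Union>(b, t) \<in> fraction R a s. F b t) = C"
  using fraction_self[OF assms(1,2)] assms(3) by (intro SUP_eq_const) auto

abbreviation frac_ring where "frac_ring \<equiv> total_quotient_ring R"

lemma carrier_total_quotient:
  "carrier frac_ring = {fraction R a s |a s. a \<in> carrier R \<and> s \<in> nonzerodivisors R}"
  by (auto simp: total_quotient_ring_def fraction_def quotient_def)

lemma total_quotient_mult:
  assumes "a \<in> carrier R" "s \<in> nonzerodivisors R" "b \<in> carrier R" "t \<in> nonzerodivisors R"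
  shows "fraction R a s \<otimes>\<^bsub>frac_ring\<^esub> fraction R b t = fraction R (a \<otimes> b) (s \<otimes> t)"
proof -
  have "fraction R (a' \<otimes> b') (s' \<otimes> t') = fraction R (a \<otimes> b) (s \<otimes> t)"
    if *: "(a', s') \<in> fraction R a s" "(b', t') \<in> fraction R b t" for a' s' b' t'
  proof -
    have c: "a' \<in> carrier R" "s' \<in> nonzerodivisors R" "b' \<in> carrier R" "t' \<in> nonzerodivisors R"
      "a' \<otimes> s = a \<otimes> s'" "b' \<otimes> t = b \<otimes> t'"
      using * by (simp_all add: mem_fraction_iff)
    have cl: "s \<in> carrier R" "t \<in> carrier R" "s' \<in> carrier R" "t' \<in> carrier R"
      using assms c by (simp_all add: nonzerodivisors_closed)
    have "(a' \<otimes> b') \<otimes> (s \<otimes> t) = (a' \<otimes> s) \<otimes> (b' \<otimes> t)"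
      using assms c(1-4) cl by (simp add: m_ac)
    also have "\<dots> = (a \<otimes> b) \<otimes> (s' \<otimes> t')"
      unfolding c(5,6) using assms c(1-4) cl by (simp add: m_ac)
    finally show ?thesis
      using assms c by (simp add: fraction_eq_iff nonzerodivisors_mult)
  qed
  then show ?thesis
    unfolding total_quotient_ring_def
    by (simp, intro UN_fraction_eq_const) (use assms in auto)
qed

lemma total_quotient_add:
  assumes "a \<in> carrier R" "s \<in> nonzerodivisors R" "b \<in> carrier R" "t \<in> nonzerodivisors R"
  shows "fraction R a s \<oplus>\<^bsub>frac_ring\<^esub> fraction R b t = fraction R (a \<otimes> t \<oplus> b \<otimes> s) (s \<otimes> t)"
proof -
  have "fraction R (a' \<otimes> t' \<oplus> b' \<otimes> s') (s' \<otimes> t') = fraction R (a \<otimes> t \<oplus> b \<otimes> s) (s \<otimes> t)"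
    if *: "(a', s') \<in> fraction R a s" "(b', t') \<in> fraction R b t" for a' s' b' t'
  proof -
    have c: "a' \<in> carrier R" "s' \<in> nonzerodivisors R" "b' \<in> carrier R" "t' \<in> nonzerodivisors R"
      "a' \<otimes> s = a \<otimes> s'" "b' \<otimes> t = b \<otimes> t'"
      using * by (simp_all add: mem_fraction_iff)
    have cl: "s \<in> carrier R" "t \<in> carrier R" "s' \<in> carrier R" "t' \<in> carrier R"
      using assms c by (simp_all add: nonzerodivisors_closed)
    have "(a' \<otimes> t' \<oplus> b' \<otimes> s') \<otimes> (s \<otimes> t) = (a' \<otimes> s) \<otimes> (t' \<otimes> t) \<oplus> (b' \<otimes> t) \<otimes> (s' \<otimes> s)"
      using assms(1,3) c(1,3) cl by (simp add: l_distr r_distr m_ac)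
    also have "\<dots> = (a \<otimes> t \<oplus> b \<otimes> s) \<otimes> (s' \<otimes> t')"
      unfolding c(5,6) using assms(1,3) c(1,3) cl by (simp add: l_distr r_distr m_ac)
    finally show ?thesis
      using assms c cl by (simp add: fraction_eq_iff nonzerodivisors_mult)
  qed
  then show ?thesis
    unfolding total_quotient_ring_def
    by (simp, intro UN_fraction_eq_const) (use assms in auto)
qed

lemma total_quotient_smult:
  assumes "r \<in> carrier R" "a \<in> carrier R" "s \<in> nonzerodivisors R"
  shows "r \<odot>\<^bsub>frac_ring\<^esub> fraction R a s = fraction R (r \<otimes> a) s"
proof -
  have "fraction R (r \<otimes> a') s' = fraction R (r \<otimes> a) s" if *: "(a', s') \<in> fraction R a s" for a' s'
  proof -
    have c: "a' \<in> carrier R" "s' \<in> nonzerodivisors R" "a' \<otimes> s = a \<otimes> s'"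
      using * by (simp_all add: mem_fraction_iff)
    then show ?thesis
      using assms by (simp add: fraction_eq_iff nonzerodivisors_closed m_assoc)
  qed
  then show ?thesis
    unfolding total_quotient_ring_def
    by (simp, intro UN_fraction_eq_const) (use assms in auto)
qed

lemma total_quotient_zero: "s \<in> nonzerodivisors R \<Longrightarrow> \<zero>\<^bsub>frac_ring\<^esub> = fraction R \<zero> s"
  by (simp add: total_quotient_ring_def fraction_eq_iff nonzerodivisors_one nonzerodivisors_closed)

lemma total_quotient_add_same:
  assumes "a \<in> carrier R" "b \<in> carrier R" "s \<in> nonzerodivisors R"
  shows "fraction R a s \<oplus>\<^bsub>frac_ring\<^esub> fraction R b s = fraction R (a \<oplus> b) s"
proof -
  have "(a \<otimes> s \<oplus> b \<otimes> s) \<otimes> s = (a \<oplus> b) \<otimes> (s \<otimes> s)"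
    using assms nonzerodivisors_closed[OF assms(3)] by (simp add: l_distr m_assoc)
  then show ?thesis
    using assms by (simp add: total_quotient_add fraction_eq_iff nonzerodivisors_mult nonzerodivisors_closed)
qed

text \<open>Submodules must be closed under this inverse. No group laws have been established for
  \<open>frac_ring\<close>, so the definite description behind \<open>m_inv\<close> is evaluated
  directly, uniqueness included.\<close>

lemma total_quotient_uminus:
  assumes "a \<in> carrier R" "s \<in> nonzerodivisors R"
  shows "inv\<^bsub>add_monoid frac_ring\<^esub> (fraction R a s) = fraction R (\<ominus> a) s"
  unfolding m_inv_def
proof (rule the_equality)
  have "fraction R a s \<oplus>\<^bsub>frac_ring\<^esub> fraction R (\<ominus> a) s = \<zero>\<^bsub>frac_ring\<^esub>"
    "fraction R (\<ominus> a) s \<oplus>\<^bsub>frac_ring\<^esub> fraction R a s = \<zero>\<^bsub>frac_ring\<^esub>"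
    using assms by (simp_all add: total_quotient_add_same r_neg l_neg total_quotient_zero[OF assms(2)])
  then show "fraction R (\<ominus> a) s \<in> carrier (add_monoid frac_ring) \<and>
      fraction R a s \<otimes>\<^bsub>add_monoid frac_ring\<^esub> fraction R (\<ominus> a) s = \<one>\<^bsub>add_monoid frac_ring\<^esub> \<and>
      fraction R (\<ominus> a) s \<otimes>\<^bsub>add_monoid frac_ring\<^esub> fraction R a s = \<one>\<^bsub>add_monoid frac_ring\<^esub>"
    using assms by (auto simp: carrier_total_quotient)
next
  fix y assume "y \<in> carrier (add_monoid frac_ring) \<and> fraction R a s \<otimes>\<^bsub>add_monoid frac_ring\<^esub> y = \<one>\<^bsub>add_monoid frac_ring\<^esub> \<and>
      y \<otimes>\<^bsub>add_monoid frac_ring\<^esub> fraction R a s = \<one>\<^bsub>add_monoid frac_ring\<^esub>"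
  then obtain b t where y: "b \<in> carrier R" "t \<in> nonzerodivisors R" "y = fraction R b t"
    and "fraction R a s \<oplus>\<^bsub>frac_ring\<^esub> fraction R b t = \<zero>\<^bsub>frac_ring\<^esub>"
    by (auto simp: carrier_total_quotient)
  moreover have cl: "s \<in> carrier R" "t \<in> carrier R"
    using assms y by (simp_all add: nonzerodivisors_closed)
  ultimately have "(a \<otimes> t \<oplus> b \<otimes> s) \<otimes> \<one> = \<zero> \<otimes> (s \<otimes> t)"
    using assms by (simp only: total_quotient_add total_quotient_zero[OF nonzerodivisors_one])
      (subst (asm) fraction_eq_iff; simp add: nonzerodivisors_mult nonzerodivisors_one)
  then have "b \<otimes> s \<oplus> a \<otimes> t = \<zero>" using assms y cl by (simp add: a_comm)
  then have "b \<otimes> s = (\<ominus> a) \<otimes> t" using assms y cl by (simp add: sum_zero_eq_neg l_minus)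
  then show "y = fraction R (\<ominus> a) s" using assms y by (simp add: fraction_eq_iff)
qed

lemma to_total_quotient_mult_fraction:
  assumes "a \<in> carrier R" "b \<in> carrier R" "s \<in> nonzerodivisors R"
  shows "to_total_quotient R a \<otimes>\<^bsub>frac_ring\<^esub> fraction R b s = fraction R (a \<otimes> b) s"
  using assms by (simp add: to_total_quotient_def total_quotient_mult nonzerodivisors_one nonzerodivisors_closed)

lemma fraction_mult_cancel:
  assumes "r \<in> carrier R" "s \<in> nonzerodivisors R"
  shows "fraction R (r \<otimes> s) s = to_total_quotient R r"
  using assms
  by (simp add: to_total_quotient_def fraction_eq_iff nonzerodivisors_one nonzerodivisors_closed)

text \<open>The inverse is the fractional ideal \<open>K / s\<close>, called \<open>J\<close> below:
  dividing \<open>I \<cdot> K = sR\<close> by \<open>s\<close> leaves the unit ideal.\<close>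

lemma invertible_ideal_if_prod_principal:
  assumes I: "ideal I R" and K: "ideal K R" and s: "s \<in> nonzerodivisors R" and IK: "I \<cdot> K = PIdl s"
  shows "invertible_ideal R I"
proof -
  define J where "J = {fraction R k s |k. k \<in> K}"
  have Kc: "k \<in> carrier R" if "k \<in> K" for k using that by (rule ideal_carrier[OF K])
  have "subgroup J (add_monoid frac_ring)"
  proof (rule subgroup.intro)
    show "J \<subseteq> carrier (add_monoid frac_ring)"
      using Kc s by (auto simp: J_def carrier_total_quotient)
    fix x y assume "x \<in> J" "y \<in> J"
    then obtain k l where "k \<in> K" "l \<in> K" "x = fraction R k s" "y = fraction R l s"
      by (auto simp: J_def)
    then show "x \<otimes>\<^bsub>add_monoid frac_ring\<^esub> y \<in> J"
      using Kc s ideal_add_closed[OF K] by (auto simp: J_def total_quotient_add_same)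
  next
    show "\<one>\<^bsub>add_monoid frac_ring\<^esub> \<in> J"
      using ideal_zero_closed[OF K] total_quotient_zero[OF s] by (auto simp: J_def)
    fix x assume "x \<in> J"
    then obtain k where "k \<in> K" "x = fraction R k s" by (auto simp: J_def)
    then show "inv\<^bsub>add_monoid frac_ring\<^esub> x \<in> J"
      using Kc s ideal_uminus_closed[OF K] by (auto simp: J_def total_quotient_uminus)
  qed
  moreover have "r \<odot>\<^bsub>frac_ring\<^esub> x \<in> J" if "r \<in> carrier R" "x \<in> J" for r x
    using that Kc s ideal_mult_closed[OF K] by (auto simp: J_def total_quotient_smult)
  ultimately have "submodule J R frac_ring"
    by (simp add: submodule_def submodule_axioms_def)
  moreover have "ideal_prod frac_ring (to_total_quotient R ` I) J = to_total_quotient R ` carrier R"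
  proof
    show "ideal_prod frac_ring (to_total_quotient R ` I) J \<subseteq> to_total_quotient R ` carrier R"
    proof
      fix z assume "z \<in> ideal_prod frac_ring (to_total_quotient R ` I) J"
      then show "z \<in> to_total_quotient R ` carrier R"
      proof induction
        case (prod x y)
        then obtain i k where ik: "i \<in> I" "x = to_total_quotient R i" "k \<in> K" "y = fraction R k s"
          by (auto simp: J_def)
        then have "i \<otimes> k \<in> PIdl s" unfolding IK[symmetric] by (intro ideal_prod.prod)
        then obtain r where "r \<in> carrier R" "i \<otimes> k = r \<otimes> s" by (auto simp: mem_PIdl_iff)
        then show ?case
          using ik Kc s ideal_carrier[OF I]
          by (simp add: to_total_quotient_mult_fraction fraction_mult_cancel)
      next
        case (sum x y)
        then obtain a b where "a \<in> carrier R" "b \<in> carrier R"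
          "x = to_total_quotient R a" "y = to_total_quotient R b" by blast
        then show ?case
          using total_quotient_add_same[OF _ _ nonzerodivisors_one, of a b]
          by (auto simp: to_total_quotient_def)
      qed
    qed
    have *: "fraction R x s \<in> ideal_prod frac_ring (to_total_quotient R ` I) J" if "x \<in> I \<cdot> K" for x
      using that
    proof induction
      case (prod i k)
      then have "to_total_quotient R i \<otimes>\<^bsub>frac_ring\<^esub> fraction R k s \<in> ideal_prod frac_ring (to_total_quotient R ` I) J"
        by (intro ideal_prod.prod) (auto simp: J_def)
      then show ?case
        using prod Kc s ideal_carrier[OF I] by (simp add: to_total_quotient_mult_fraction)
    next
      case (sum x y)
      moreover have "x \<in> carrier R" "y \<in> carrier R"
        using sum ideal_prod_in_carrier[OF I K] by auto
      ultimately show ?case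
        using ideal_prod.sum[OF sum(3,4)] s by (simp add: total_quotient_add_same)
    qed
    show "to_total_quotient R ` carrier R \<subseteq> ideal_prod frac_ring (to_total_quotient R ` I) J"
    proof clarify
      fix r assume r: "r \<in> carrier R"
      then have "r \<otimes> s \<in> I \<cdot> K" unfolding IK by (auto simp: mem_PIdl_iff)
      then show "to_total_quotient R r \<in> ideal_prod frac_ring (to_total_quotient R ` I) J"
        using * r s by (simp flip: fraction_mult_cancel[OF r s])
    qed
  qed
  ultimately show ?thesis using I by (auto simp: invertible_ideal_def)
qed

text \<open>A representation of 1 in \<open>I J\<close> involves finitely many fractions. Over a
  common denominator \<open>s\<close> it reads \<open>1 = x / s\<close> with \<open>x\<close> in
  \<open>I \<cdot> K\<close>, where \<open>K\<close> holds the numerators over \<open>s\<close> of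
  members of \<open>J\<close>; hence \<open>x = s\<close>.\<close>

lemma prod_principal_if_invertible_ideal:
  assumes "invertible_ideal R I"
  shows "\<exists>K s. ideal K R \<and> s \<in> nonzerodivisors R \<and> I \<cdot> K = PIdl s"
proof -
  obtain J where I: "ideal I R" and J: "submodule J R frac_ring"
    and IJ: "ideal_prod frac_ring (to_total_quotient R ` I) J = to_total_quotient R ` carrier R"
    using assms by (auto simp: invertible_ideal_def)
  have sub: "subgroup J (add_monoid frac_ring)" using J by (simp add: submodule_def)
  have J_carrier: "J \<subseteq> carrier frac_ring"
    and J_add: "\<And>x y. x \<in> J \<Longrightarrow> y \<in> J \<Longrightarrow> x \<oplus>\<^bsub>frac_ring\<^esub> y \<in> J"
    and J_zero: "\<zero>\<^bsub>frac_ring\<^esub> \<in> J"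
    using subgroup.subset[OF sub] subgroup.m_closed[OF sub] subgroup.one_closed[OF sub] by auto
  have J_smult: "r \<odot>\<^bsub>frac_ring\<^esub> x \<in> J" if "r \<in> carrier R" "x \<in> J" for r x
    using submodule.smult_closed[OF J] that by blast
  define K where "K t = {k \<in> carrier R. fraction R k t \<in> J}" for t
  have K_ideal: "ideal (K t) R" if t: "t \<in> nonzerodivisors R" for t
  proof (rule ideal_criterion)
    show "\<zero> \<in> K t" using J_zero t by (simp add: K_def total_quotient_zero)
    show "x \<oplus> y \<in> K t" if "x \<in> K t" "y \<in> K t" for x y
      using that J_add t by (auto simp: K_def simp flip: total_quotient_add_same)
    show "r \<otimes> x \<in> K t" if "r \<in> carrier R" "x \<in> K t" for r x
      using that J_smult t by (auto simp: K_def simp flip: total_quotient_smult)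
  qed (auto simp: K_def)
  \<comment> \<open>Enlarging the denominator from \<open>t\<close> to \<open>t \<otimes> u\<close>
    multiplies numerators by \<open>u\<close>; this lets two fractions be added in
    \<open>common\<close>.\<close>
  have scale: "x \<otimes> u \<in> I \<cdot> K (t \<otimes> u)"
    if "x \<in> I \<cdot> K t" and t: "t \<in> nonzerodivisors R" and u: "u \<in> nonzerodivisors R" for x t u
    using that(1)
  proof induction
    case (prod i k)
    have cl: "i \<in> carrier R" "k \<in> carrier R" "u \<in> carrier R" "t \<in> carrier R"
      using prod I u t by (auto simp: K_def nonzerodivisors_closed ideal_carrier)
    have "fraction R (k \<otimes> u) (t \<otimes> u) = fraction R k t"
      using cl t u by (simp add: fraction_eq_iff nonzerodivisors_mult m_ac)
    then have "k \<otimes> u \<in> K (t \<otimes> u)" using prod cl by (simp add: K_def)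
    then have "i \<otimes> (k \<otimes> u) \<in> I \<cdot> K (t \<otimes> u)" using prod by (intro ideal_prod.prod)
    then show ?case using cl by (simp add: m_assoc)
  next
    case (sum x y)
    moreover have "x \<in> carrier R" "y \<in> carrier R" "u \<in> carrier R"
      using sum ideal_prod_in_carrier[OF I K_ideal[OF t]] u by (auto simp: nonzerodivisors_closed)
    ultimately show ?case using ideal_prod.sum[OF sum(3,4)] by (simp add: l_distr)
  qed
  have common: "\<exists>x t. t \<in> nonzerodivisors R \<and> x \<in> I \<cdot> K t \<and> z = fraction R x t"
    if "z \<in> ideal_prod frac_ring (to_total_quotient R ` I) J" for z
    using that
  proof induction
    case (prod x y)
    obtain i where i: "i \<in> I" "x = to_total_quotient R i" using prod by blast
    have "y \<in> carrier frac_ring" using prod J_carrier by blast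
    then obtain k t where k: "k \<in> carrier R" "t \<in> nonzerodivisors R" "y = fraction R k t"
      by (auto simp: carrier_total_quotient)
    have "i \<otimes> k \<in> I \<cdot> K t" using i k prod by (intro ideal_prod.prod) (auto simp: K_def)
    then show ?case
      using i k ideal_carrier[OF I] by (auto simp: to_total_quotient_mult_fraction)
  next
    case (sum z w)
    obtain x t where x: "t \<in> nonzerodivisors R" "x \<in> I \<cdot> K t" "z = fraction R x t"
      using sum by blast
    obtain y u where y: "u \<in> nonzerodivisors R" "y \<in> I \<cdot> K u" "w = fraction R y u"
      using sum by blast
    have "x \<in> carrier R" "y \<in> carrier R"
      using x y ideal_prod_in_carrier[OF I K_ideal] by blast+
    then have "z \<oplus>\<^bsub>frac_ring\<^esub> w = fraction R (x \<otimes> u \<oplus> y \<otimes> t) (t \<otimes> u)"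
      using x y by (simp add: total_quotient_add)
    moreover have "x \<otimes> u \<in> I \<cdot> K (t \<otimes> u)" using scale x y by blast
    moreover have "y \<otimes> t \<in> I \<cdot> K (t \<otimes> u)"
      using scale[OF y(2,1) x(1)] x y m_comm[of u t] by (simp add: nonzerodivisors_closed)
    ultimately show ?case using x y nonzerodivisors_mult ideal_prod.sum by metis
  qed
  have "to_total_quotient R \<one> \<in> ideal_prod frac_ring (to_total_quotient R ` I) J" using IJ by blast
  then obtain x s where s: "s \<in> nonzerodivisors R" "x \<in> I \<cdot> K s" "to_total_quotient R \<one> = fraction R x s"
    using common by blast
  have "x \<in> carrier R" using s ideal_prod_in_carrier[OF I K_ideal] by blast
  then have "x = s"
    using s by (simp add: to_total_quotient_def fraction_eq_iff nonzerodivisors_one nonzerodivisors_closed)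
  have "i \<otimes> k \<in> PIdl s" if ik: "i \<in> I" "k \<in> K s" for i k
  proof -
    have cl: "i \<in> carrier R" "k \<in> carrier R" using ik I by (auto simp: K_def ideal_carrier)
    have "to_total_quotient R i \<otimes>\<^bsub>frac_ring\<^esub> fraction R k s \<in> to_total_quotient R ` carrier R"
      unfolding IJ[symmetric] using ik by (intro ideal_prod.prod) (auto simp: K_def)
    then obtain r where "r \<in> carrier R" "fraction R (i \<otimes> k) s = fraction R (r \<otimes> s) s"
      using cl s(1) by (auto simp: to_total_quotient_mult_fraction fraction_mult_cancel)
    then have "r \<in> carrier R" "s \<otimes> (i \<otimes> k) = s \<otimes> (r \<otimes> s)"
      using cl s by (auto simp: fraction_eq_iff nonzerodivisors_closed m_comm)
    then have "i \<otimes> k = r \<otimes> s"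
      using nonzerodivisors_cancel[OF s(1)] cl s nonzerodivisors_closed by simp
    then show ?thesis using \<open>r \<in> carrier R\<close> by (auto simp: mem_PIdl_iff)
  qed
  then have "I \<cdot> K s \<subseteq> PIdl s"
    using ideal_prod_subset_iff cgenideal_ideal nonzerodivisors_closed s by metis
  moreover have "PIdl s \<subseteq> I \<cdot> K s"
    using s \<open>x = s\<close> PIdl_subset_iff ideal_prod_is_ideal[OF I K_ideal] nonzerodivisors_closed by blast
  ultimately show ?thesis using K_ideal s by blast
qed

lemma invertible_ideal_iff:
  "invertible_ideal R I \<longleftrightarrow>
     ideal I R \<and> (\<exists>K s. ideal K R \<and> s \<in> nonzerodivisors R \<and> I \<cdot> K = PIdl s)"
  using invertible_ideal_if_prod_principal prod_principal_if_invertible_ideal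
  unfolding invertible_ideal_def by metis

section \<open>Cancellation, divisibility and finite generation of invertible ideals\<close>

lemma ideal_linear_combination:
  "ideal A R \<Longrightarrow> r \<in> carrier R \<Longrightarrow> s \<in> carrier R \<Longrightarrow> x \<in> A \<Longrightarrow> y \<in> A \<Longrightarrow> r \<otimes> x \<oplus> s \<otimes> y \<in> A"
  by (simp add: ideal_add_closed ideal_mult_closed)

lemma invertible_ideal_ideal: "invertible_ideal R I \<Longrightarrow> ideal I R"
  by (simp add: invertible_ideal_iff)

lemma invertible_ideal_PIdl:
  assumes "s \<in> nonzerodivisors R"
  shows "invertible_ideal R (PIdl s)"
proof -
  have "ideal (PIdl s) R" using assms by (simp add: cgenideal_ideal nonzerodivisors_closed)
  moreover from this have "(PIdl s) \<cdot> carrier R = PIdl s" by (rule ideal_prod_one)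
  ultimately show ?thesis using assms oneideal invertible_ideal_iff by blast
qed

lemma invertible_ideal_cancel_PIdl:
  assumes "s \<in> nonzerodivisors R" "ideal A R" "ideal B R" "(PIdl s) \<cdot> A \<subseteq> (PIdl s) \<cdot> B"
  shows "A \<subseteq> B"
proof
  fix x assume x: "x \<in> A"
  have s: "s \<in> carrier R" using assms(1) by (rule nonzerodivisors_closed)
  have "s \<otimes> x \<in> (PIdl s) \<cdot> A" using mem_PIdl_prod_iff[OF assms(2) s] x by blast
  then obtain y where y: "y \<in> B" "s \<otimes> x = s \<otimes> y"
    using mem_PIdl_prod_iff[OF assms(3) s] assms(4) by blast
  then have "x = y"
    using nonzerodivisors_cancel[OF assms(1)] ideal_carrier[OF assms(2) x] ideal_carrier[OF assms(3)]
    by blast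
  then show "x \<in> B" using y by simp
qed

lemma invertible_ideal_cancel:
  assumes "invertible_ideal R I" "ideal A R" "ideal B R" "I \<cdot> A \<subseteq> I \<cdot> B"
  shows "A \<subseteq> B"
proof -
  obtain K s where K: "ideal I R" "ideal K R" "s \<in> nonzerodivisors R" "I \<cdot> K = PIdl s"
    using assms(1) by (auto simp: invertible_ideal_iff)
  have "K \<cdot> (I \<cdot> C) = (PIdl s) \<cdot> C" if "ideal C R" for C
    using that K ideal_prod_assoc ideal_prod_commute by metis
  then have "(PIdl s) \<cdot> A \<subseteq> (PIdl s) \<cdot> B"
    using ideal_prod_mono[OF subset_refl assms(4), of K] assms by simp
  then show ?thesis using invertible_ideal_cancel_PIdl K assms by blast
qed

lemma invertible_ideal_cancel_eq:
  assumes "invertible_ideal R I" "ideal A R" "ideal B R" "I \<cdot> A = I \<cdot> B"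
  shows "A = B"
  using invertible_ideal_cancel[OF assms(1-3)] invertible_ideal_cancel[OF assms(1,3,2)] assms(4)
  by blast

text \<open>The quotient of \<open>A\<close> by \<open>I\<close> is \<open>A K / s\<close>. Since
  \<open>A \<cdot> K\<close> lies in \<open>sR\<close>, division by \<open>s\<close> stays inside
  the ring, and \<open>B\<close> is the conductor of \<open>s\<close> into
  \<open>A \<cdot> K\<close>.\<close>

lemma invertible_ideal_dvd:
  assumes "invertible_ideal R I" "ideal A R" "A \<subseteq> I"
  shows "\<exists>B. ideal B R \<and> A = I \<cdot> B"
proof -
  obtain K s where K: "ideal I R" "ideal K R" "s \<in> nonzerodivisors R" "I \<cdot> K = PIdl s"
    using assms(1) by (auto simp: invertible_ideal_iff)
  have s: "s \<in> carrier R" and PI: "ideal (PIdl s) R"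
    using K(3) nonzerodivisors_closed cgenideal_ideal by auto
  have AK: "ideal (A \<cdot> K) R" using assms K by (simp add: ideal_prod_is_ideal)
  define B where "B = {b \<in> carrier R. \<forall>x\<in>{s}. b \<otimes> x \<in> A \<cdot> K}"
  have B: "ideal B R" unfolding B_def using AK s by (intro ideal_colon) auto
  have "(PIdl s) \<cdot> B = A \<cdot> K"
  proof
    show "(PIdl s) \<cdot> B \<subseteq> A \<cdot> K"
      unfolding PIdl_prod_subset_iff[OF B AK s] using s by (auto simp: B_def m_comm)
    show "A \<cdot> K \<subseteq> (PIdl s) \<cdot> B"
    proof
      fix z assume z: "z \<in> A \<cdot> K"
      then have "z \<in> PIdl s" using ideal_prod_mono[OF assms(3) subset_refl, of K] K by auto
      then obtain r where "r \<in> carrier R" "z = r \<otimes> s" by (auto simp: mem_PIdl_iff)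
      then show "z \<in> (PIdl s) \<cdot> B"
        unfolding mem_PIdl_prod_iff[OF B s] using z s
        by (intro bexI[of _ r]) (auto simp: B_def m_comm)
    qed
  qed
  then have "(PIdl s) \<cdot> (I \<cdot> B) = I \<cdot> (A \<cdot> K)"
    using ideal_prod_lcomm[OF PI K(1) B] by simp
  also have "\<dots> = (PIdl s) \<cdot> A"
    using K(1,2) assms(2) PI ideal_prod_lcomm[of I A K] ideal_prod_commute[of A "PIdl s"]
    by (simp add: K(4))
  finally have "I \<cdot> B = A"
    using invertible_ideal_cancel_eq[OF invertible_ideal_PIdl[OF K(3)]] B K assms
    by (simp add: ideal_prod_is_ideal)
  then show ?thesis using B by blast
qed

lemma invertible_ideal_prod:
  assumes "invertible_ideal R I" "invertible_ideal R J"
  shows "invertible_ideal R (I \<cdot> J)"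
proof -
  obtain K s where K: "ideal I R" "ideal K R" "s \<in> nonzerodivisors R" "I \<cdot> K = PIdl s"
    using assms(1) by (auto simp: invertible_ideal_iff)
  obtain L t where L: "ideal J R" "ideal L R" "t \<in> nonzerodivisors R" "J \<cdot> L = PIdl t"
    using assms(2) by (auto simp: invertible_ideal_iff)
  have "(I \<cdot> J) \<cdot> (K \<cdot> L) = (I \<cdot> K) \<cdot> (J \<cdot> L)"
    using K(1,2) L(1,2) by (simp add: ideal_prod_ac ideal_prod_is_ideal)
  also have "\<dots> = PIdl (s \<otimes> t)"
    using K L by (simp add: PIdl_prod nonzerodivisors_closed)
  finally show ?thesis
    unfolding invertible_ideal_iff
    using ideal_prod_is_ideal[OF K(1) L(1)] ideal_prod_is_ideal[OF K(2) L(2)]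
      nonzerodivisors_mult[OF K(3) L(3)] by blast
qed

lemma invertible_ideal_factor:
  assumes "invertible_ideal R (I \<cdot> J)" "ideal I R" "ideal J R"
  shows "invertible_ideal R I" "invertible_ideal R J"
proof -
  obtain K s where K: "ideal K R" "s \<in> nonzerodivisors R" "(I \<cdot> J) \<cdot> K = PIdl s"
    using assms(1) by (auto simp: invertible_ideal_iff)
  have "I \<cdot> (J \<cdot> K) = PIdl s" "J \<cdot> (I \<cdot> K) = PIdl s"
    using K assms by (simp_all add: ideal_prod_ac ideal_prod_is_ideal)
  then show "invertible_ideal R I" "invertible_ideal R J"
    using K assms ideal_prod_is_ideal invertible_ideal_iff by blast+
qed

lemma invertible_ideal_carrier: "invertible_ideal R (carrier R)"
  using invertible_ideal_PIdl[OF nonzerodivisors_one] by (simp add: cgenideal_eq_genideal genideal_one)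

text \<open>Only finitely many elements of \<open>I\<close> occur in an expression of
  \<open>s\<close> in \<open>I \<cdot> K\<close>. They lie in a finitely generated
  \<open>F \<subseteq> I\<close> with \<open>K \<cdot> I \<subseteq> K \<cdot> F\<close>, and
  \<open>K\<close>, being invertible as well, cancels.\<close>

lemma invertible_ideal_fg:
  assumes "invertible_ideal R I"
  shows "fg_ideal R I"
proof -
  obtain K s where K: "ideal I R" "ideal K R" "s \<in> nonzerodivisors R" "I \<cdot> K = PIdl s"
    using assms(1) by (auto simp: invertible_ideal_iff)
  have "s \<in> I \<cdot> K" using K cgenideal_self nonzerodivisors_closed by simp
  then obtain F where F: "F \<subseteq> I" "fg_ideal R F" "s \<in> F \<cdot> K" using mem_prod_fg_left[OF K(1) _ K(2)] by blast
  have Fi: "ideal F R" using F fg_ideal_ideal by blast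
  have "K \<cdot> I \<subseteq> K \<cdot> F"
    using F(3) K Fi PIdl_subset_iff[of "F \<cdot> K" s] ideal_prod_is_ideal nonzerodivisors_closed
      ideal_prod_commute by metis
  moreover have "invertible_ideal R K"
    using K ideal_prod_commute invertible_ideal_iff by metis
  ultimately have "I = F" using invertible_ideal_cancel[of K I F] K Fi F(1) by blast
  then show ?thesis using F by simp
qed

lemma invertible_ideal_regular: "invertible_ideal R I \<Longrightarrow> regular_ideal R I"
proof -
  assume "invertible_ideal R I"
  then obtain K s where K: "ideal I R" "ideal K R" "s \<in> nonzerodivisors R" "I \<cdot> K = PIdl s"
    by (auto simp: invertible_ideal_iff)
  have "s \<in> I"
    using K ideal_prod_subset_left[OF K(1,2)] cgenideal_self nonzerodivisors_closed by blast
  then show ?thesis using K by (auto simp: regular_ideal_def)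
qed

text \<open>Multiplying by the finitely generated \<open>K\<close> turns \<open>I \<cdot> B\<close>
  into \<open>s B\<close>. Its generators have the form \<open>s \<otimes> y\<close> with
  \<open>y \<in> B\<close>, and these \<open>y\<close> generate \<open>B\<close> because
  \<open>s\<close> cancels.\<close>

lemma fg_ideal_invertible_factor:
  assumes "invertible_ideal R I" "ideal B R" "fg_ideal R (I \<cdot> B)"
  shows "fg_ideal R B"
proof -
  obtain K s where K: "ideal I R" "ideal K R" "s \<in> nonzerodivisors R" "I \<cdot> K = PIdl s"
    using assms(1) by (auto simp: invertible_ideal_iff)
  then have "fg_ideal R K"
    using invertible_ideal_fg ideal_prod_commute invertible_ideal_iff by metis
  then have "fg_ideal R (K \<cdot> (I \<cdot> B))" using assms fg_ideal_prod by blast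
  moreover have "K \<cdot> (I \<cdot> B) = (PIdl s) \<cdot> B"
    using K assms(2) ideal_prod_assoc ideal_prod_commute by metis
  ultimately obtain A where A: "A \<subseteq> carrier R" "finite A" "(PIdl s) \<cdot> B = Idl A"
    by (auto simp: fg_ideal_def)
  have s: "s \<in> carrier R" using K nonzerodivisors_closed by blast
  have "A \<subseteq> (\<lambda>y. s \<otimes> y) ` B"
    using genideal_self[OF A(1)] mem_PIdl_prod_iff[OF assms(2) s] unfolding A(3)[symmetric] by blast
  then obtain Y where Y: "Y \<subseteq> B" "finite Y" "A = (\<lambda>y. s \<otimes> y) ` Y"
    using finite_subset_image[OF A(2)] by metis
  have Yc: "Y \<subseteq> carrier R" using Y ideal_subset_carrier[OF assms(2)] by blast
  then have IY: "ideal (Idl Y) R" "Y \<subseteq> Idl Y" by (auto simp: genideal_ideal genideal_self)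
  have "A \<subseteq> (PIdl s) \<cdot> (Idl Y)"
    using IY(2) mem_PIdl_prod_iff[OF IY(1) s] unfolding Y(3) by blast
  then have "(PIdl s) \<cdot> B \<subseteq> (PIdl s) \<cdot> (Idl Y)"
    unfolding A(3) using IY s by (intro genideal_minimal ideal_prod_is_ideal cgenideal_ideal)
  then have "B \<subseteq> Idl Y" using invertible_ideal_cancel_PIdl K(3) IY assms(2) by blast
  moreover have "Idl Y \<subseteq> B" using Y(1) assms(2) genideal_minimal by blast
  ultimately have "B = Idl Y" by blast
  then show ?thesis using Y Yc by (auto simp: fg_ideal_def)
qed

subsection \<open>Regular ideals\<close>

lemma regular_ideal_ideal: "regular_ideal R I \<Longrightarrow> ideal I R"
  by (simp add: regular_ideal_def)

lemma zero_ideal_not_regular: "\<one> \<noteq> \<zero> \<Longrightarrow> \<not> regular_ideal R {\<zero>}"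
  by (auto simp: regular_ideal_def nonzerodivisors_def)

lemma regular_ideal_mono: "regular_ideal R I \<Longrightarrow> ideal J R \<Longrightarrow> I \<subseteq> J \<Longrightarrow> regular_ideal R J"
  by (auto simp: regular_ideal_def)

lemma regular_ideal_prod:
  assumes "regular_ideal R I" "regular_ideal R J"
  shows "regular_ideal R (I \<cdot> J)"
proof -
  obtain s t where "s \<in> I" "s \<in> nonzerodivisors R" "t \<in> J" "t \<in> nonzerodivisors R"
    using assms by (auto simp: regular_ideal_def)
  then have "s \<otimes> t \<in> I \<cdot> J" "s \<otimes> t \<in> nonzerodivisors R"
    by (auto intro: ideal_prod.prod nonzerodivisors_mult)
  then show ?thesis
    using assms ideal_prod_is_ideal unfolding regular_ideal_def by blast
qed

lemma regular_ideal_factor: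
  assumes "regular_ideal R (I \<cdot> J)" "ideal I R" "ideal J R"
  shows "regular_ideal R I" "regular_ideal R J"
  using regular_ideal_mono[OF assms(1)] ideal_prod_subset_left ideal_prod_subset_right assms by auto

lemma regular_ideal_obtains_nonzerodivisor:
  assumes "regular_ideal R I"
  obtains s where "s \<in> I" "s \<in> nonzerodivisors R" "s \<in> carrier R"
    "PIdl s \<subseteq> I" "regular_ideal R (PIdl s)" "fg_ideal R (PIdl s)" "invertible_ideal R (PIdl s)"
proof -
  obtain s where s: "s \<in> I" "s \<in> nonzerodivisors R" using assms by (auto simp: regular_ideal_def)
  then have "s \<in> carrier R" by (simp add: nonzerodivisors_closed)
  then show ?thesis
    using that s assms invertible_ideal_PIdl invertible_ideal_regular fg_ideal_PIdl
      PIdl_subset_iff regular_ideal_ideal by blast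
qed

lemma regular_ideal_carrier: "regular_ideal R (carrier R)"
  using invertible_ideal_carrier by (rule invertible_ideal_regular)

text \<open>A nonzerodivisor of \<open>I\<close> is adjoined to \<open>x\<close>. Questions about
  single elements of a regular ideal are thereby moved to finitely generated regular ideals.\<close>

lemma regular_ideal_obtains_fg:
  assumes "regular_ideal R I" "x \<in> I"
  obtains A where "regular_ideal R A" "fg_ideal R A" "x \<in> A" "A \<subseteq> I"
proof -
  obtain s where s: "s \<in> I" "regular_ideal R (PIdl s)" "fg_ideal R (PIdl s)" "PIdl s \<subseteq> I"
    using assms(1) by (rule regular_ideal_obtains_nonzerodivisor)
  have I: "ideal I R" using assms(1) by (rule regular_ideal_ideal)
  have x: "x \<in> carrier R" using assms(2) by (rule ideal_carrier[OF I])
  have i: "ideal (PIdl s) R" "ideal (PIdl x) R"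
    using s x regular_ideal_ideal cgenideal_ideal by blast+
  have "regular_ideal R (PIdl s <+> PIdl x)"
    using regular_ideal_mono[OF s(2)] add_ideals[OF i] subset_set_add_left[OF i] by blast
  moreover have "fg_ideal R (PIdl s <+> PIdl x)" using s x fg_ideal_set_add fg_ideal_PIdl by blast
  moreover have "x \<in> PIdl s <+> PIdl x" using subset_set_add_right[OF i] cgenideal_self[OF x] by blast
  moreover have "PIdl s <+> PIdl x \<subseteq> I" using s assms x I i by (simp add: set_add_subset_iff PIdl_subset_iff)
  ultimately show ?thesis using that by blast
qed

section \<open>Prime ideals and radicals\<close>

lemma submonoid_power: "submonoid S R \<Longrightarrow> x \<in> S \<Longrightarrow> x [^] (n::nat) \<in> S"
  by (induction n) (auto simp: submonoid.m_closed submonoid.one_closed)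

text \<open>One application of Zorn's lemma with two uses: a multiplicative \<open>S\<close> leads
  to prime ideals, \<open>S = {\<one>}\<close> to maximal ideals.\<close>

lemma exists_maximal_disjoint_ideal:
  assumes "ideal A R" "A \<inter> S = {}" 
  shows "\<exists>P. ideal P R \<and> A \<subseteq> P \<and> P \<inter> S = {} \<and> (\<forall>I. ideal I R \<longrightarrow> P \<subseteq> I \<longrightarrow> I \<inter> S = {} \<longrightarrow> I = P)"
proof -
  let ?\<A> = "{I. ideal I R \<and> A \<subseteq> I \<and> I \<inter> S = {}}"
  have "\<exists>P\<in>?\<A>. \<forall>X\<in>?\<A>. P \<subseteq> X \<longrightarrow> X = P"
  proof (rule subset_Zorn_nonempty)
    show "?\<A> \<noteq> {}" using assms by blast
    fix C assume C: "C \<noteq> {}" "subset.chain ?\<A> C"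
    then have "ideal (\<Union>C) R"
      by (intro ideal_Union_chain) (auto simp: subset_chain_def)
    then show "\<Union>C \<in> ?\<A>" using C by (auto simp: subset_chain_def)
  qed
  then obtain P where "P \<in> ?\<A>" and max: "\<And>X. X \<in> ?\<A> \<Longrightarrow> P \<subseteq> X \<Longrightarrow> X = P"
    by (elim bexE) simp
  moreover from this have "I = P" if "ideal I R" "P \<subseteq> I" "I \<inter> S = {}" for I
    using that by (intro max) auto
  ultimately show ?thesis by (intro exI[of _ P]) auto
qed

lemma exists_prime_disjoint:
  assumes A: "ideal A R" "A \<inter> S = {}" and S: "submonoid S R"
  shows "\<exists>P. primeideal P R \<and> A \<subseteq> P \<and> P \<inter> S = {}"
proof -
  obtain P where P: "ideal P R" "A \<subseteq> P" "P \<inter> S = {}"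
    and max: "\<And>I. ideal I R \<Longrightarrow> P \<subseteq> I \<Longrightarrow> I \<inter> S = {} \<Longrightarrow> I = P"
    using exists_maximal_disjoint_ideal[OF A] by blast
  have meet: "\<exists>p\<in>P. \<exists>r\<in>carrier R. p \<oplus> r \<otimes> a \<in> S" if a: "a \<in> carrier R" "a \<notin> P" for a
  proof -
    have i: "ideal (PIdl a) R" using a cgenideal_ideal by blast
    have "P <+> PIdl a \<noteq> P" using subset_set_add_right[OF P(1) i] cgenideal_self[OF a(1)] a(2) by blast
    then have "(P <+> PIdl a) \<inter> S \<noteq> {}"
      using max[OF add_ideals[OF P(1) i] subset_set_add_left[OF P(1) i]] by blast
    then show ?thesis by (auto simp: mem_set_add_iff mem_PIdl_iff)
  qed
  have "primeideal P R"
  proof (rule primeidealI[OF P(1) is_cring])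
    show "carrier R \<noteq> P" using P(3) submonoid.one_closed[OF S] by auto
    fix a b assume ab: "a \<in> carrier R" "b \<in> carrier R" "a \<otimes> b \<in> P"
    show "a \<in> P \<or> b \<in> P"
    proof (rule ccontr)
      assume "\<not> (a \<in> P \<or> b \<in> P)"
      then obtain p r q t where *: "p \<in> P" "r \<in> carrier R" "p \<oplus> r \<otimes> a \<in> S"
        "q \<in> P" "t \<in> carrier R" "q \<oplus> t \<otimes> b \<in> S"
        using meet ab by metis
      have cl: "p \<in> carrier R" "q \<in> carrier R" using * ideal_carrier[OF P(1)] by auto
      \<comment> \<open>Every summand of the expansion contains \<open>p\<close>, \<open>q\<close>
        or \<open>a \<otimes> b\<close>, so a product of two members of \<open>S\<close> would lie
        in \<open>P\<close>.\<close>
      have "(p \<oplus> r \<otimes> a) \<otimes> (q \<oplus> t \<otimes> b) = (q \<oplus> t \<otimes> b) \<otimes> p \<oplus> ((r \<otimes> a) \<otimes> q \<oplus> (r \<otimes> t) \<otimes> (a \<otimes> b))"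
        using cl * ab by (simp add: l_distr r_distr m_ac a_ac)
      also have "\<dots> \<in> P"
        using ideal_mult_closed[OF P(1) *(1), of "q \<oplus> t \<otimes> b"] ideal_mult_closed[OF P(1) *(4), of "r \<otimes> a"]
          ideal_mult_closed[OF P(1) ab(3), of "r \<otimes> t"] * ab cl
        by (simp add: ideal_add_closed[OF P(1)])
      finally show False using submonoid.m_closed[OF S *(3,6)] P(3) by blast
    qed
  qed
  then show ?thesis using P by blast
qed

lemma exists_maximalideal:
  assumes "ideal A R" "A \<noteq> carrier R"
  shows "\<exists>M. maximalideal M R \<and> A \<subseteq> M"
proof -
  have "A \<inter> {\<one>} = {}" using assms ideal_eq_carrier_iff by blast
  then obtain P where P: "ideal P R" "A \<subseteq> P" "P \<inter> {\<one>} = {}"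
    and max: "\<And>I. ideal I R \<Longrightarrow> P \<subseteq> I \<Longrightarrow> I \<inter> {\<one>} = {} \<Longrightarrow> I = P"
    using exists_maximal_disjoint_ideal[OF assms(1)] by blast
  have "maximalideal P R"
  proof (rule maximalidealI[OF P(1)])
    show "carrier R \<noteq> P" using P(3) by auto
    show "I = P \<or> I = carrier R" if "ideal I R" "P \<subseteq> I" for I
      using that max ideal_eq_carrier_iff by blast
  qed
  then show ?thesis using P by blast
qed

lemma exists_max_reg:
  assumes "regular_ideal R A" "A \<noteq> carrier R"
  shows "\<exists>M\<in>max_reg R. A \<subseteq> M"
  using exists_maximalideal[OF regular_ideal_ideal[OF assms(1)] assms(2)] assms(1)
  by (auto simp: max_reg_def maximalideal_def intro: regular_ideal_mono)

lemma exists_minimal_prime: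
  assumes "primeideal P R" "A \<subseteq> P"
  shows "\<exists>Q. primeideal Q R \<and> A \<subseteq> Q \<and> Q \<subseteq> P \<and>
    (\<forall>Q'. primeideal Q' R \<longrightarrow> A \<subseteq> Q' \<longrightarrow> Q' \<subseteq> Q \<longrightarrow> Q' = Q)"
proof -
  let ?\<P> = "{Q. primeideal Q R \<and> A \<subseteq> Q \<and> Q \<subseteq> P}"
  \<comment> \<open>Complements turn the minimal prime into a maximal set, and the union of a chain
    into the intersection of the primes.\<close>
  let ?\<A> = "(\<lambda>Q. carrier R - Q) ` ?\<P>"
  have "\<exists>M\<in>?\<A>. \<forall>X\<in>?\<A>. M \<subseteq> X \<longrightarrow> X = M"
  proof (rule subset_Zorn_nonempty)
    show "?\<A> \<noteq> {}" using assms by blast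
    fix C assume C: "C \<noteq> {}" "subset.chain ?\<A> C"
    have "C \<subseteq> ?\<A>" using C(2) by (simp add: subset_chain_def)
    then obtain D where D_sub: "D \<subseteq> ?\<P>" and C_eq: "C = (\<lambda>Q. carrier R - Q) ` D"
      by (rule subset_imageE)
    then have D: "D \<noteq> {}" "\<Union>C = carrier R - \<Inter>D" using C(1) by auto
    have chain: "Q \<subseteq> Q' \<or> Q' \<subseteq> Q" if "Q \<in> D" "Q' \<in> D" for Q Q'
    proof -
      have "carrier R - Q \<subseteq> carrier R - Q' \<or> carrier R - Q' \<subseteq> carrier R - Q"
        using C(2) imageI[OF that(1)] imageI[OF that(2)] unfolding C_eq subset_chain_def by meson
      moreover have "Q \<subseteq> carrier R" "Q' \<subseteq> carrier R"
        using that D_sub by (auto simp: primeideal_def dest!: ideal_subset_carrier)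
      ultimately show ?thesis by blast
    qed
    have "ideal (\<Inter>D) R"
      using D(1) D_sub by (intro i_Intersect) (auto simp: primeideal_def)
    then have "primeideal (\<Inter>D) R"
    proof (rule primeidealI[OF _ is_cring])
      show "carrier R \<noteq> \<Inter>D"
      proof -
        obtain Q where Q: "Q \<in> D" "primeideal Q R" using D(1) D_sub by blast
        then have "Q \<noteq> carrier R" "Q \<subseteq> carrier R"
          using primeideal.I_notcarr[OF Q(2)] ideal_subset_carrier by (auto simp: primeideal_def)
        then show ?thesis using Q(1) by blast
      qed
      fix a b assume ab: "a \<in> carrier R" "b \<in> carrier R" "a \<otimes> b \<in> \<Inter>D"
      show "a \<in> \<Inter>D \<or> b \<in> \<Inter>D"
      proof (rule ccontr)
        assume "\<not> (a \<in> \<Inter>D \<or> b \<in> \<Inter>D)"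
        then obtain Q Q' where Q: "Q \<in> D" "a \<notin> Q" "Q' \<in> D" "b \<notin> Q'" by blast
        then obtain Q0 where "Q0 \<in> D" "a \<notin> Q0" "b \<notin> Q0" using chain[of Q Q'] by blast
        then show False using ab primeideal.I_prime[of Q0 R a b] D_sub by blast
      qed
    qed
    then have "\<Inter>D \<in> ?\<P>" using D(1) D_sub by blast
    then show "\<Union>C \<in> ?\<A>" using D(2) by blast
  qed
  then obtain X where X: "X \<in> ?\<A>" and max: "\<forall>Y\<in>?\<A>. X \<subseteq> Y \<longrightarrow> Y = X"
    by (rule bexE)
  then obtain Q where Q: "primeideal Q R" "A \<subseteq> Q" "Q \<subseteq> P" "X = carrier R - Q" by auto
  have "Q' = Q" if "primeideal Q' R" "A \<subseteq> Q'" "Q' \<subseteq> Q" for Q'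
  proof -
    have "carrier R - Q' = X"
      using that Q(3,4) by (intro max[rule_format] imageI) auto
    moreover have "Q \<subseteq> carrier R" using Q(1) ideal_subset_carrier by (simp add: primeideal_def)
    ultimately show ?thesis using that(3) Q(4) by blast
  qed
  then show ?thesis using Q(1-3) by (intro exI[of _ Q]) auto
qed

lemma primeideal_ideal: "primeideal P R \<Longrightarrow> ideal P R"
  by (simp add: primeideal_def)

lemma primeideal_one_notin: "primeideal P R \<Longrightarrow> \<one> \<notin> P"
  using primeideal.I_notcarr primeideal_ideal ideal_eq_carrier_iff by blast

lemma submonoid_complement:
  assumes "primeideal P R"
  shows "submonoid (carrier R - P) R"
  using assms primeideal_one_notin primeideal.I_prime[OF assms] by (auto intro!: submonoid.intro)

lemma primeideal_mult_notin:
  assumes "primeideal P R" "a \<in> carrier R" "b \<in> carrier R" "a \<notin> P" "b \<notin> P"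
  shows "a \<otimes> b \<notin> P"
  using primeideal.I_prime[OF assms(1-3)] assms(4,5) by blast

lemma primeideal_prod:
  assumes "primeideal P R" "ideal I R" "ideal J R" "I \<cdot> J \<subseteq> P"
  shows "I \<subseteq> P \<or> J \<subseteq> P"
proof (rule ccontr)
  assume "\<not> ?thesis"
  then obtain i j where ij: "i \<in> I" "j \<in> J" "i \<notin> P" "j \<notin> P" by blast
  then have "i \<otimes> j \<in> P" using assms(4) ideal_prod.prod[of i I j J R] by blast
  then show False
    using primeideal_mult_notin[OF assms(1) ideal_carrier[OF assms(2) ij(1)]
        ideal_carrier[OF assms(3) ij(2)] ij(3,4)] by blast
qed

lemma maximalideal_obtains_inverse:
  assumes "maximalideal M R" "u \<in> carrier R" "u \<notin> M"
  obtains r m where "r \<in> carrier R" "m \<in> M" "m \<oplus> r \<otimes> u = \<one>"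
proof -
  have i: "ideal M R" "ideal (PIdl u) R" using assms by (auto simp: maximalideal_def cgenideal_ideal)
  have "M <+> PIdl u \<noteq> M" using subset_set_add_right[OF i] cgenideal_self assms by blast
  then have "M <+> PIdl u = carrier R"
    using maximalideal.I_maximal[OF assms(1) add_ideals[OF i] subset_set_add_left[OF i]]
      ideal_subset_carrier[OF add_ideals[OF i]] by blast
  then have "\<one> \<in> M <+> PIdl u" by simp
  then show ?thesis using that by (auto simp: mem_set_add_iff mem_PIdl_iff)
qed

section \<open>Radicals and radical ideals\<close>

lemma radical_ideal_ideal: "radical_ideal R J \<Longrightarrow> ideal J R"
  by (simp add: radical_ideal_def)

lemma radical_idealD:
  "radical_ideal R J \<Longrightarrow> x \<in> carrier R \<Longrightarrow> n \<ge> 1 \<Longrightarrow> x [^] (n::nat) \<in> J \<Longrightarrow> x \<in> J"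
  by (auto simp: radical_ideal_def radical_def)

lemma subset_radical: "ideal I R \<Longrightarrow> I \<subseteq> radical R I"
proof
  fix x assume "ideal I R" "x \<in> I"
  moreover from this have "x \<in> carrier R" by (rule ideal_carrier)
  ultimately show "x \<in> radical R I" by (auto simp: radical_def intro!: exI[of _ "Suc 0"])
qed

lemma radical_idealI:
  assumes "ideal J R" "\<And>x n. x \<in> carrier R \<Longrightarrow> n \<ge> (1::nat) \<Longrightarrow> x [^] n \<in> J \<Longrightarrow> x \<in> J"
  shows "radical_ideal R J"
  unfolding radical_ideal_def using assms subset_radical[OF assms(1)] by (auto simp: radical_def)

lemma primeideal_power_mem:
  assumes "primeideal P R" "x \<in> carrier R" "x [^] (n::nat) \<in> P"
  shows "x \<in> P"
  using submonoid_power[OF submonoid_complement[OF assms(1)], of x n] assms by blast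

lemma radical_subset_prime:
  "primeideal P R \<Longrightarrow> I \<subseteq> P \<Longrightarrow> radical R I \<subseteq> P"
  using primeideal_power_mem by (auto simp: radical_def)

text \<open>If no positive power of \<open>x\<close> lies in \<open>I\<close>, the powers of
  \<open>x\<close> form a multiplicative set disjoint from \<open>I\<close>, and a prime over
  \<open>I\<close> avoiding this set misses \<open>x\<close>.\<close>

lemma radical_eq_Inter_primes:
  assumes "ideal I R"
  shows "radical R I = carrier R \<inter> \<Inter>{P. primeideal P R \<and> I \<subseteq> P}"
proof
  show "radical R I \<subseteq> carrier R \<inter> \<Inter>{P. primeideal P R \<and> I \<subseteq> P}"
    using radical_subset_prime by (auto simp: radical_def)
  show "carrier R \<inter> \<Inter>{P. primeideal P R \<and> I \<subseteq> P} \<subseteq> radical R I"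
  proof (rule subsetI, rule ccontr)
    fix x assume x: "x \<in> carrier R \<inter> \<Inter>{P. primeideal P R \<and> I \<subseteq> P}" "x \<notin> radical R I"
    define S where "S = {x [^] n |n::nat. True}"
    have S: "submonoid S R"
    proof (rule submonoid.intro)
      show "S \<subseteq> carrier R" using x by (auto simp: S_def)
      show "\<one> \<in> S" unfolding S_def by (auto intro!: exI[of _ "0::nat"])
      show "a \<otimes> b \<in> S" if "a \<in> S" "b \<in> S" for a b
        using that x nat_pow_mult unfolding S_def by fastforce
    qed
    have "x [^] (n::nat) \<notin> I" for n
    proof (cases n)
      \<comment> \<open>\<open>radical\<close> speaks of positive exponents only; exponent 0 is
        excluded because \<open>\<one> \<in> I\<close> would put \<open>x\<close> itself in
        \<open>I\<close>.\<close>
      case 0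
      have "x [^] (1::nat) \<notin> I" using x by (auto simp: radical_def)
      then have "\<one> \<notin> I" using x ideal_mult_closed[OF assms, of \<one> x] by auto
      then show ?thesis using 0 by simp
    next
      case (Suc m)
      then show ?thesis using x by (auto simp: radical_def)
    qed
    then have "I \<inter> S = {}" by (auto simp: S_def)
    then obtain P where "primeideal P R" "I \<subseteq> P" "P \<inter> S = {}"
      using exists_prime_disjoint[OF assms _ S] by blast
    moreover have "x \<in> S" using x unfolding S_def by (auto intro!: exI[of _ "1::nat"])
    ultimately show False using x by blast
  qed
qed

lemma ideal_radical: "ideal I R \<Longrightarrow> ideal (radical R I) R"
  unfolding radical_eq_Inter_primes using primeideal_ideal by (intro ideal_carrier_Int_Inter) auto

lemma radical_ideal_Inter_primes:
  assumes "\<And>P. P \<in> C \<Longrightarrow> primeideal P R"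
  shows "radical_ideal R (carrier R \<inter> \<Inter>C)"
  using assms primeideal_power_mem primeideal_ideal
  by (intro radical_idealI ideal_carrier_Int_Inter) auto

lemma radical_ideal_radical:
  assumes "ideal I R"
  shows "radical_ideal R (radical R I)"
  unfolding radical_eq_Inter_primes[OF assms] by (rule radical_ideal_Inter_primes) simp

lemma radical_mono: "I \<subseteq> J \<Longrightarrow> radical R I \<subseteq> radical R J"
  by (auto simp: radical_def)

lemma radical_ideal_square:
  assumes "radical_ideal R J" "ideal K R" "K \<cdot> K \<subseteq> J"
  shows "K \<subseteq> J"
proof
  fix x assume x: "x \<in> K"
  then have "x \<otimes> x \<in> J" using assms(3) ideal_prod.prod[OF x x, of R] by blast
  moreover have "x \<in> carrier R" using x by (rule ideal_carrier[OF assms(2)])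
  ultimately show "x \<in> J"
    using radical_idealD[OF assms(1), of x 2] by (simp add: numeral_2_eq_2)
qed

subsection \<open>Powers of ideals\<close>

lemma product_of_ideals_Nil [simp]: "product_of_ideals R [] = carrier R"
  and product_of_ideals_Cons [simp]: "product_of_ideals R (J # Js) = J \<cdot> product_of_ideals R Js"
  by (simp_all add: product_of_ideals_def)

lemma ideal_product_of_ideals:
  "(\<And>J. J \<in> set Js \<Longrightarrow> ideal J R) \<Longrightarrow> ideal (product_of_ideals R Js) R"
  by (induction Js) (auto simp: oneideal ideal_prod_is_ideal)

lemma product_of_ideals_append:
  assumes "\<And>J. J \<in> set Js \<Longrightarrow> ideal J R" "\<And>J. J \<in> set Ks \<Longrightarrow> ideal J R"
  shows "product_of_ideals R (Js @ Ks) = product_of_ideals R Js \<cdot> product_of_ideals R Ks"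
  using assms
  by (induction Js) (auto simp: ideal_prod_carrier ideal_product_of_ideals ideal_prod_assoc)

lemma product_of_ideals_subset:
  assumes "\<And>J. J \<in> set Js \<Longrightarrow> ideal J R" "J \<in> set Js"
  shows "product_of_ideals R Js \<subseteq> J"
  using assms
proof (induction Js)
  case (Cons K Js)
  have i: "ideal K R" "ideal (product_of_ideals R Js) R"
    using Cons.prems by (auto intro: ideal_product_of_ideals)
  then show ?case
    using Cons ideal_prod_subset_left[OF i] ideal_prod_subset_right[OF i] by auto
qed simp

text \<open>As products of constant lists, powers inherit the lemmas on
  \<open>product_of_ideals\<close>; exponent 0 gives the unit ideal.\<close>

abbreviation ideal_pow where "ideal_pow I n \<equiv> product_of_ideals R (replicate n I)"

lemma ideal_ideal_pow: "ideal I R \<Longrightarrow> ideal (ideal_pow I n) R"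
  by (rule ideal_product_of_ideals) simp

lemma ideal_pow_add: "ideal I R \<Longrightarrow> ideal_pow I (m + n) = ideal_pow I m \<cdot> ideal_pow I n"
  unfolding replicate_add by (rule product_of_ideals_append) auto

lemma ideal_pow_1: "ideal I R \<Longrightarrow> ideal_pow I (Suc 0) = I"
  by (simp add: ideal_prod_one)

lemma ideal_pow_antimono:
  assumes "ideal I R" "m \<le> n"
  shows "ideal_pow I n \<subseteq> ideal_pow I m"
  using ideal_pow_add[OF assms(1), of m "n - m"] assms ideal_prod_subset_left ideal_ideal_pow by simp

lemma ideal_pow_mono: "I \<subseteq> J \<Longrightarrow> ideal_pow I n \<subseteq> ideal_pow J n"
  by (induction n) (auto intro: ideal_prod_mono[THEN subsetD])

lemma ideal_pow_subset: "ideal I R \<Longrightarrow> n \<ge> 1 \<Longrightarrow> ideal_pow I n \<subseteq> I"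
  using ideal_pow_antimono[of I 1 n] by (simp add: ideal_prod_one)

lemma power_mem_ideal_pow: "ideal I R \<Longrightarrow> x \<in> I \<Longrightarrow> x [^] (n::nat) \<in> ideal_pow I n"
proof (induction n)
  case (Suc n)
  then have "x \<otimes> x [^] n \<in> I \<cdot> ideal_pow I n" by (intro ideal_prod.prod) auto
  then show ?case using Suc.prems ideal_carrier[of I R x] by (simp add: m_comm[of x "x [^] n"])
qed simp

lemma ideal_pow_PIdl: "x \<in> carrier R \<Longrightarrow> ideal_pow (PIdl x) n = PIdl (x [^] n)"
proof (induction n)
  case 0
  then show ?case by (simp add: cgenideal_eq_genideal genideal_one)
next
  case (Suc n)
  then show ?case by (simp add: PIdl_prod m_comm)
qed

lemma fg_ideal_pow: "fg_ideal R I \<Longrightarrow> fg_ideal R (ideal_pow I n)"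
  by (induction n) (auto simp: fg_ideal_carrier fg_ideal_prod)

lemma invertible_ideal_pow: "invertible_ideal R I \<Longrightarrow> invertible_ideal R (ideal_pow I n)"
  by (induction n) (auto simp: invertible_ideal_carrier invertible_ideal_prod)

text \<open>Pigeonhole: among \<open>m + n\<close> factors, each from \<open>I\<close> or from
  \<open>K\<close>, there are \<open>m\<close> from \<open>I\<close> or \<open>n\<close> from
  \<open>K\<close>. The induction splits off one factor, which lowers \<open>m\<close> or
  \<open>n\<close> by one.\<close>

lemma ideal_pow_set_add:
  assumes I: "ideal I R" and K: "ideal K R"
  shows "ideal_pow (I <+> K) (m + n) \<subseteq> ideal_pow I m <+> ideal_pow K n"
proof (induction "m + n" arbitrary: m n)
  case 0
  then show ?case using subset_set_add_left[OF oneideal oneideal] by simp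
next
  case (Suc k)
  note i = ideal_ideal_pow[OF I] ideal_ideal_pow[OF K] ideal_ideal_pow[OF add_ideals[OF I K]]
  consider "m = 0" | "n = 0" | m' n' where "m = Suc m'" "n = Suc n'"
    by (metis not0_implies_Suc)
  then show ?case
  proof cases
    case 1
    then show ?thesis
      using subset_set_add_left[OF oneideal i(2)] ideal_subset_carrier[OF i(3)] by simp blast
  next
    case 2
    then show ?thesis
      using subset_set_add_right[OF i(1) oneideal] ideal_subset_carrier[OF i(3)] by simp blast
  next
    case 3
    define T where "T = ideal_pow I m <+> ideal_pow K n"
    have T: "ideal T R" unfolding T_def by (intro add_ideals i)
    have sub: "ideal_pow I m \<subseteq> T" "ideal_pow K n \<subseteq> T"
      unfolding T_def using subset_set_add_left subset_set_add_right i by auto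
    have 1: "I \<cdot> ideal_pow (I <+> K) k \<subseteq> T"
    proof -
      have "I \<cdot> ideal_pow (I <+> K) k \<subseteq> I \<cdot> (ideal_pow I m' <+> ideal_pow K n)"
        using Suc(1)[of m' n] Suc(2) 3 by (intro ideal_prod_mono) auto
      also have "\<dots> = ideal_pow I m <+> I \<cdot> ideal_pow K n"
        using 3(1) ideal_prod_distr(1)[OF I ideal_ideal_pow[OF I] i(2)] by simp
      also have "\<dots> \<subseteq> T"
        unfolding T_def using ideal_prod_subset_right[OF I i(2)] by (intro set_add_mono) auto
      finally show ?thesis .
    qed
    have 2: "K \<cdot> ideal_pow (I <+> K) k \<subseteq> T"
    proof -
      have "K \<cdot> ideal_pow (I <+> K) k \<subseteq> K \<cdot> (ideal_pow I m <+> ideal_pow K n')"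
        using Suc(1)[of m n'] Suc(2) 3 by (intro ideal_prod_mono) auto
      also have "\<dots> = K \<cdot> ideal_pow I m <+> ideal_pow K n"
        using 3(2) ideal_prod_distr(1)[OF K i(1) ideal_ideal_pow[OF K]] by simp
      also have "\<dots> \<subseteq> T"
        unfolding T_def using ideal_prod_subset_right[OF K i(1)] by (intro set_add_mono) auto
      finally show ?thesis .
    qed
    have "ideal_pow (I <+> K) (m + n) = (I \<cdot> ideal_pow (I <+> K) k) <+> (K \<cdot> ideal_pow (I <+> K) k)"
      unfolding Suc(2)[symmetric] using I K i by (simp add: ideal_prod_distr)
    then show ?thesis
      using 1 2 I K i T set_add_subset_iff[OF _ _ T] unfolding T_def[symmetric]
      by (simp add: ideal_prod_is_ideal)
  qed
qed

subsection \<open>Clearing denominators uniformly\<close>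

text \<open>The denominators of the generators are multiplied together, which is possible because
  there are finitely many.\<close>

lemma fg_ideal_uniform_denominator:
  assumes "fg_ideal R K" "submonoid S R" "ideal A R" "\<forall>x\<in>K. \<exists>u\<in>S. u \<otimes> x \<in> A"
  shows "\<exists>u\<in>S. \<forall>x\<in>K. u \<otimes> x \<in> A"
  using assms(1,4)
proof (induction rule: fg_ideal_induct)
  case zero
  then show ?case by blast
next
  case (add x I)
  have i: "ideal (PIdl x) R" "ideal I R" using add by (auto simp: cgenideal_ideal fg_ideal_ideal)
  have "x \<in> PIdl x <+> I" using subset_set_add_left[OF i] cgenideal_self add(1) by blast
  then obtain u where u: "u \<in> S" "u \<otimes> x \<in> A" using add.prems by blast
  obtain v where v: "v \<in> S" "\<forall>y\<in>I. v \<otimes> y \<in> A" using add subset_set_add_right[OF i] by blast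
  have cl: "u \<in> carrier R" "v \<in> carrier R" using u v submonoid.subset[OF assms(2)] by auto
  have "(u \<otimes> v) \<otimes> z \<in> A" if z: "z \<in> PIdl x <+> I" for z
  proof -
    obtain r y where z: "r \<in> carrier R" "y \<in> I" "z = r \<otimes> x \<oplus> y"
      using z by (auto simp: mem_set_add_iff mem_PIdl_iff)
    have "(u \<otimes> v) \<otimes> z = (v \<otimes> r) \<otimes> (u \<otimes> x) \<oplus> u \<otimes> (v \<otimes> y)"
      using z cl add(1) ideal_carrier[OF i(2)] by (simp add: r_distr m_ac)
    also have "\<dots> \<in> A"
      using u v z cl by (intro ideal_linear_combination[OF assms(3)]) auto
    finally show ?thesis .
  qed
  then show ?case using submonoid.m_closed[OF assms(2) u(1) v(1)] by blast
qed

lemma fg_ideal_uniform_power: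
  assumes "fg_ideal R K" "submonoid S R" "ideal A R" "\<forall>x\<in>K. \<exists>u\<in>S. \<exists>n::nat. u \<otimes> x [^] n \<in> A"
  shows "\<exists>u\<in>S. \<exists>n. \<forall>x\<in>ideal_pow K n. u \<otimes> x \<in> A"
  using assms(1,4)
proof (induction rule: fg_ideal_induct)
  case zero
  \<comment> \<open>The zero ideal takes exponent 1, since its power 0 is the whole ring.\<close>
  have "\<one> \<otimes> x \<in> A" if "x \<in> ideal_pow {\<zero>} 1" for x
    using that ideal_zero_closed[OF assms(3)] by (simp add: ideal_pow_1[OF zeroideal, simplified])
  then show ?case using submonoid.one_closed[OF assms(2)] by blast
next
  case (add x I)
  have i: "ideal (PIdl x) R" "ideal I R" using add by (auto simp: cgenideal_ideal fg_ideal_ideal)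
  have "x \<in> PIdl x <+> I" using subset_set_add_left[OF i] cgenideal_self add(1) by blast
  then obtain u and m :: nat where u: "u \<in> S" "u \<otimes> x [^] m \<in> A" using add.prems by blast
  obtain v n where v: "v \<in> S" "\<forall>y\<in>ideal_pow I n. v \<otimes> y \<in> A"
    using add subset_set_add_right[OF i] by blast
  have cl: "u \<in> carrier R" "v \<in> carrier R" using u v submonoid.subset[OF assms(2)] by auto
  have "(u \<otimes> v) \<otimes> z \<in> A" if "z \<in> ideal_pow (PIdl x <+> I) (m + n)" for z
  proof -
    have "z \<in> PIdl (x [^] m) <+> ideal_pow I n"
      using that ideal_pow_set_add[OF i, of m n] ideal_pow_PIdl[OF add(1)] by auto
    then obtain r y where z: "r \<in> carrier R" "y \<in> ideal_pow I n" "z = r \<otimes> x [^] m \<oplus> y"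
      by (auto simp: mem_set_add_iff mem_PIdl_iff)
    have "(u \<otimes> v) \<otimes> z = (v \<otimes> r) \<otimes> (u \<otimes> x [^] m) \<oplus> u \<otimes> (v \<otimes> y)"
      using z cl add(1) ideal_carrier[OF ideal_ideal_pow[OF i(2)]] by (simp add: r_distr m_ac)
    also have "\<dots> \<in> A"
      using u v z cl by (intro ideal_linear_combination[OF assms(3)]) auto
    finally show ?thesis .
  qed
  then show ?case using submonoid.m_closed[OF assms(2) u(1) v(1)] by blast
qed

text \<open>Nakayama's lemma for \<open>K\<close> modulo \<open>A\<close> in the localization at
  \<open>P\<close>, by removing one generator at a time. From
  \<open>c \<otimes> x = t \<oplus> p \<otimes> x\<close> the generator \<open>x\<close> is
  expressed through the rest up to the factor \<open>c \<ominus> p\<close>, which is outside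
  \<open>P\<close>, and the remaining ideal satisfies the same hypothesis with a new
  multiplier.\<close>

lemma nakayama_localized:
  assumes "fg_ideal R K" and A: "ideal A R" and P: "primeideal P R"
    and "c \<in> carrier R" "c \<notin> P" "\<forall>x\<in>K. c \<otimes> x \<in> A <+> P \<cdot> K"
  shows "\<exists>d\<in>carrier R. d \<notin> P \<and> (\<forall>x\<in>K. d \<otimes> x \<in> A)"
  using assms(1,4-6)
proof (induction arbitrary: c rule: fg_ideal_induct)
  case zero
  then show ?case using P primeideal_one_notin ideal_zero_closed[OF A] by (intro bexI[of _ \<one>]) auto
next
  case (add x I)
  have Pi: "ideal P R" using P primeideal_ideal by blast
  have i: "ideal (PIdl x) R" "ideal I R" using add by (auto simp: cgenideal_ideal fg_ideal_ideal)
  have PI: "ideal (P \<cdot> I) R" using Pi i ideal_prod_is_ideal by blast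
  define T where "T = A <+> P \<cdot> I"
  have T: "ideal T R" "A \<subseteq> T" "P \<cdot> I \<subseteq> T"
    unfolding T_def using add_ideals subset_set_add_left subset_set_add_right A PI by auto
  have decompose: "\<exists>t\<in>T. \<exists>p\<in>P. c \<otimes> z = t \<oplus> p \<otimes> x" if z: "z \<in> PIdl x <+> I" for z
  proof -
    have "c \<otimes> z \<in> A <+> P \<cdot> (PIdl x <+> I)" using add.prems z by blast
    also have "P \<cdot> (PIdl x <+> I) = (PIdl x) \<cdot> P <+> P \<cdot> I"
      using Pi i by (simp add: ideal_prod_distr ideal_prod_commute[of P "PIdl x"])
    finally obtain a p q where *: "a \<in> A" "p \<in> P" "q \<in> P \<cdot> I" "c \<otimes> z = a \<oplus> (x \<otimes> p \<oplus> q)"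
      using mem_PIdl_prod_iff[OF Pi add(1)] by (auto simp: mem_set_add_iff)
    have cl: "a \<in> carrier R" "p \<in> carrier R" "q \<in> carrier R"
      using * ideal_carrier[OF A] ideal_carrier[OF Pi] ideal_carrier[OF PI] by auto
    have "a \<oplus> q \<in> T" using * T ideal_add_closed[OF T(1)] by blast
    moreover have "c \<otimes> z = (a \<oplus> q) \<oplus> p \<otimes> x" using * cl add(1) by (simp add: a_ac m_ac)
    ultimately show ?thesis using * by blast
  qed
  have "x \<in> PIdl x <+> I" using subset_set_add_left[OF i] cgenideal_self add(1) by blast
  then obtain t p where tp: "t \<in> T" "p \<in> P" "c \<otimes> x = t \<oplus> p \<otimes> x" using decompose by blast
  have pc: "p \<in> carrier R" "t \<in> carrier R" using tp ideal_carrier[OF Pi] ideal_carrier[OF T(1)] by auto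
  define e where "e = c \<ominus> p"
  have e: "e \<in> carrier R" using add pc by (simp add: e_def)
  have "c = e \<oplus> p" using add pc by (simp add: e_def a_minus_def a_assoc l_neg)
  then have "e \<notin> P" using tp add.prems ideal_add_closed[OF Pi] by blast
  have ex: "e \<otimes> x = t"
  proof -
    have "e \<otimes> x = c \<otimes> x \<ominus> p \<otimes> x" using add pc by (simp add: e_def a_minus_def l_distr l_minus)
    also have "\<dots> = t" using tp pc add(1) by (simp add: a_minus_def a_assoc r_neg)
    finally show ?thesis .
  qed
  \<comment> \<open>The multiplier \<open>e\<close> clears the coefficient of \<open>x\<close>,
    because \<open>e \<otimes> x = t\<close> lies in \<open>T\<close>; so \<open>x\<close> has
    disappeared from the hypothesis on \<open>I\<close>.\<close>
  have "(e \<otimes> c) \<otimes> y \<in> T" if y: "y \<in> I" for y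
  proof -
    obtain t' p' where t': "t' \<in> T" "p' \<in> P" "c \<otimes> y = t' \<oplus> p' \<otimes> x"
      using decompose subset_set_add_right[OF i] y by blast
    have cl: "t' \<in> carrier R" "p' \<in> carrier R" "y \<in> carrier R"
      using t' y ideal_carrier[OF Pi] ideal_carrier[OF T(1)] ideal_carrier[OF i(2)] by auto
    have "(e \<otimes> c) \<otimes> y = e \<otimes> (c \<otimes> y)" using e cl add.prems by (simp add: m_assoc)
    also have "\<dots> = e \<otimes> t' \<oplus> p' \<otimes> (e \<otimes> x)" unfolding t' using cl e add(1) by (simp add: r_distr m_ac)
    also have "\<dots> \<in> T"
      unfolding ex using cl e t' tp by (intro ideal_linear_combination[OF T(1)]) auto
    finally show ?thesis .
  qed
  moreover have "e \<otimes> c \<notin> P" using primeideal_mult_notin[OF P] e \<open>e \<notin> P\<close> add.prems by blast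
  ultimately obtain d where d: "d \<in> carrier R" "d \<notin> P" "\<forall>y\<in>I. d \<otimes> y \<in> A"
    using add.IH[of "e \<otimes> c"] e add.prems unfolding T_def by auto
  have dT: "d \<otimes> z \<in> A" if z: "z \<in> T" for z
  proof -
    obtain a q where z: "a \<in> A" "q \<in> P \<cdot> I" "z = a \<oplus> q" using z by (auto simp: T_def mem_set_add_iff)
    have "q \<in> I" using z ideal_prod_subset_right[OF Pi i(2)] by blast
    then have "d \<otimes> a \<oplus> d \<otimes> q \<in> A"
      using z d ideal_add_closed[OF A] ideal_mult_closed[OF A] by blast
    then show ?thesis using z d ideal_carrier[OF A] ideal_carrier[OF PI] by (simp add: r_distr)
  qed
  have "(d \<otimes> e) \<otimes> z \<in> A" if z: "z \<in> PIdl x <+> I" for z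
  proof -
    obtain r y where z: "r \<in> carrier R" "y \<in> I" "z = r \<otimes> x \<oplus> y"
      using z by (auto simp: mem_set_add_iff mem_PIdl_iff)
    have "(d \<otimes> e) \<otimes> z = r \<otimes> (d \<otimes> (e \<otimes> x)) \<oplus> e \<otimes> (d \<otimes> y)"
      using z d e add(1) ideal_carrier[OF i(2)] by (simp add: r_distr m_ac)
    also have "\<dots> \<in> A"
      using z d e ex dT tp
      by (intro ideal_linear_combination[OF A]) auto
    finally show ?thesis .
  qed
  moreover have "d \<otimes> e \<notin> P" using primeideal_mult_notin[OF P] d e \<open>e \<notin> P\<close> by blast
  ultimately show ?case using d e by blast
qed

text \<open>A prime over \<open>A\<close> avoiding all \<open>u \<otimes> x [^] n\<close> with
  \<open>u \<notin> Q\<close> lies in \<open>Q\<close> (take \<open>n = 0\<close>) and misses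
  \<open>x\<close> (take \<open>u = \<one>\<close>, \<open>n = 1\<close>). It is used
  contrapositively: if \<open>Q\<close> is minimal over \<open>A\<close>, then locally at
  \<open>Q\<close> every element of \<open>Q\<close> has a power in \<open>A\<close>.\<close>

lemma exists_smaller_prime:
  assumes Q: "primeideal Q R" and A: "ideal A R" and x: "x \<in> Q"
    and avoid: "\<And>u n. u \<in> carrier R \<Longrightarrow> u \<notin> Q \<Longrightarrow> u \<otimes> x [^] (n::nat) \<notin> A"
  shows "\<exists>Q'. primeideal Q' R \<and> A \<subseteq> Q' \<and> Q' \<subseteq> Q \<and> x \<notin> Q'"
proof -
  have xc: "x \<in> carrier R" using x by (rule ideal_carrier[OF primeideal_ideal[OF Q]])
  define S where "S = {u \<otimes> x [^] n |u (n::nat). u \<in> carrier R \<and> u \<notin> Q}"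
  have S: "submonoid S R"
  proof (rule submonoid.intro)
    show "S \<subseteq> carrier R" using xc by (auto simp: S_def)
    have "\<one> \<otimes> x [^] (0::nat) \<in> S" unfolding S_def using primeideal_one_notin[OF Q] by blast
    then show "\<one> \<in> S" by simp
    fix a b assume "a \<in> S" "b \<in> S"
    then obtain u v and m n :: nat where *: "u \<in> carrier R" "u \<notin> Q" "v \<in> carrier R" "v \<notin> Q"
      "a = u \<otimes> x [^] m" "b = v \<otimes> x [^] n" unfolding S_def by blast
    then have "a \<otimes> b = (u \<otimes> v) \<otimes> x [^] (m + n)" using xc by (simp add: m_ac flip: nat_pow_mult)
    moreover have "u \<otimes> v \<notin> Q" using primeideal_mult_notin[OF Q] * by blast
    ultimately show "a \<otimes> b \<in> S" unfolding S_def using * by blast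
  qed
  have "A \<inter> S = {}" unfolding S_def using avoid by blast
  then obtain Q' where Q': "primeideal Q' R" "A \<subseteq> Q'" "Q' \<inter> S = {}"
    using exists_prime_disjoint[OF A _ S] by blast
  have "Q' \<subseteq> Q"
  proof (rule ccontr)
    assume "\<not> Q' \<subseteq> Q"
    then obtain u where u: "u \<in> Q'" "u \<notin> Q" by blast
    then have uc: "u \<in> carrier R" using ideal_carrier[OF primeideal_ideal[OF Q'(1)]] by blast
    then have "u \<otimes> x [^] (0::nat) \<in> S" unfolding S_def using u(2) by blast
    then show False using u(1) uc Q'(3) by auto
  qed
  moreover have "\<one> \<otimes> x [^] (1::nat) \<in> S" unfolding S_def using primeideal_one_notin[OF Q] by blast
  then have "x \<in> S" using xc by simp
  ultimately show ?thesis using Q' by blast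
qed

text \<open>Power \<open>n + 1\<close> of \<open>u \<otimes> x\<close> is a multiple of
  \<open>u \<otimes> x [^] n\<close>; taking \<open>n + 1\<close> also covers
  \<open>n = 0\<close>.\<close>

lemma radical_ideal_mult_power:
  assumes J: "radical_ideal R J" and u: "u \<in> carrier R" "x \<in> carrier R" "u \<otimes> x [^] (n::nat) \<in> J"
  shows "u \<otimes> x \<in> J"
proof -
  have "(u \<otimes> x) [^] Suc n = (u [^] n \<otimes> x) \<otimes> (u \<otimes> x [^] n)"
    using u(1,2) by (simp add: nat_pow_distrib m_ac)
  also have "\<dots> \<in> J" using u by (intro ideal_mult_closed[OF radical_ideal_ideal[OF J] u(3)]) auto
  finally show ?thesis using radical_idealD[OF J, of "u \<otimes> x" "Suc n"] u(1,2) by simp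
qed

lemma ideal_prod_denominator:
  assumes S: "submonoid S R"
    and I: "ideal I R" "ideal I' R" "\<And>x. x \<in> I \<Longrightarrow> \<exists>u\<in>S. u \<otimes> x \<in> I'"
    and J: "ideal J R" "ideal J' R" "\<And>x. x \<in> J \<Longrightarrow> \<exists>u\<in>S. u \<otimes> x \<in> J'"
    and z: "z \<in> I \<cdot> J"
  shows "\<exists>u\<in>S. u \<otimes> z \<in> I' \<cdot> J'"
  using z
proof induction
  case (prod i j)
  obtain u v where uv: "u \<in> S" "u \<otimes> i \<in> I'" "v \<in> S" "v \<otimes> j \<in> J'"
    using I(3)[OF prod(1)] J(3)[OF prod(2)] by blast
  have "u \<in> carrier R" "v \<in> carrier R" using uv submonoid.subset[OF S] by auto
  then have "(u \<otimes> v) \<otimes> (i \<otimes> j) = (u \<otimes> i) \<otimes> (v \<otimes> j)"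
    using ideal_carrier[OF I(1) prod(1)] ideal_carrier[OF J(1) prod(2)] by (simp add: m_ac)
  also have "\<dots> \<in> I' \<cdot> J'" using uv by (intro ideal_prod.prod)
  finally show ?case using submonoid.m_closed[OF S uv(1,3)] by blast
next
  case (sum y z)
  obtain u v where uv: "u \<in> S" "u \<otimes> y \<in> I' \<cdot> J'" "v \<in> S" "v \<otimes> z \<in> I' \<cdot> J'"
    using sum by blast
  have cl: "u \<in> carrier R" "v \<in> carrier R" using uv submonoid.subset[OF S] by auto
  have yz: "y \<in> carrier R" "z \<in> carrier R" using sum ideal_prod_in_carrier[OF I(1) J(1)] by auto
  have "(u \<otimes> v) \<otimes> (y \<oplus> z) = v \<otimes> (u \<otimes> y) \<oplus> u \<otimes> (v \<otimes> z)"
    using cl yz by (simp add: r_distr m_ac)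
  also have "\<dots> \<in> I' \<cdot> J'"
    using uv cl by (intro ideal_linear_combination[OF ideal_prod_is_ideal[OF I(2) J(2)]]) auto
  finally show ?case using submonoid.m_closed[OF S uv(1,3)] by blast
qed

section \<open>Regular primes are maximal\<close>

text \<open>If every invertible summand of \<open>I\<close> were contained in \<open>B\<close>, so
  would be the sum.\<close>

lemma exists_invertible_not_subset:
  assumes "\<And>I. regular_ideal R I \<Longrightarrow>
      \<exists>\<F>. (\<forall>J \<in> \<F>. invertible_ideal R J) \<and> I = sum_of_ideals R \<F>"
    and "regular_ideal R I" "ideal B R" "\<not> I \<subseteq> B"
  shows "\<exists>T. invertible_ideal R T \<and> T \<subseteq> I \<and> \<not> T \<subseteq> B"
proof -
  obtain \<F> where F: "\<forall>J \<in> \<F>. invertible_ideal R J" "I = Idl (\<Union>\<F>)"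
    using assms(1,2) by (auto simp: sum_of_ideals_def)
  have "\<Union>\<F> \<subseteq> carrier R"
    using F(1) invertible_ideal_ideal ideal_subset_carrier by blast
  then have "\<Union>\<F> \<subseteq> I" using F(2) genideal_self by simp
  moreover have "\<not> \<Union>\<F> \<subseteq> B" using genideal_minimal[OF assms(3)] F(2) assms(4) by blast
  ultimately show ?thesis using F(1) by blast
qed

text \<open>If \<open>P\<close> is a regular prime properly contained in a maximal ideal, take an invertible radical
  \<open>J \<subseteq> P\<close>.  Enlarging \<open>J\<close> by an invertible ideal outside \<open>P\<close> and passing to the radical
  twice yields \<open>J = H H' J''\<close> with \<open>H \<subseteq> H' \<noteq> R\<close>, and then \<open>(H J'')\<^sup>2 \<subseteq> J\<close> forces \<open>H' = R\<close>.\<close>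

lemma maximalideal_if_radicals_invertible:
  assumes avoid: "\<And>I B. regular_ideal R I \<Longrightarrow> ideal B R \<Longrightarrow> \<not> I \<subseteq> B \<Longrightarrow>
      \<exists>T. invertible_ideal R T \<and> T \<subseteq> I \<and> \<not> T \<subseteq> B"
    and rad: "\<And>I. regular_ideal R I \<Longrightarrow> fg_ideal R I \<Longrightarrow> invertible_ideal R (radical R I)"
    and P: "primeideal P R" "regular_ideal R P"
  shows "maximalideal P R"
proof (rule ccontr)
  assume notmax: "\<not> maximalideal P R"
  have Pi: "ideal P R" using P(1) primeideal_ideal by blast
  obtain M where M: "maximalideal M R" "P \<subseteq> M"
    using exists_maximalideal[OF Pi] primeideal.I_notcarr[OF P(1)] by blast
  have Mp: "primeideal M R" using M(1) by (rule maximalideal_prime)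
  then have Mi: "ideal M R" by (rule primeideal_ideal)
  have "\<not> M \<subseteq> P" using M notmax subset_antisym by metis
  then obtain I where I: "invertible_ideal R I" "I \<subseteq> M" "\<not> I \<subseteq> P"
    using avoid[OF regular_ideal_mono[OF P(2) Mi M(2)] Pi] by blast
  obtain s where s: "PIdl s \<subseteq> P" "regular_ideal R (PIdl s)" "fg_ideal R (PIdl s)"
    using P(2) by (rule regular_ideal_obtains_nonzerodivisor)
  define J where "J = radical R (PIdl s)"
  have J: "invertible_ideal R J" unfolding J_def using s by (intro rad)
  have Jr: "radical_ideal R J" unfolding J_def using s regular_ideal_ideal by (intro radical_ideal_radical) blast
  have JP: "J \<subseteq> P" unfolding J_def using s P(1) by (intro radical_subset_prime)
  have Ji: "ideal J R" and Ii: "ideal I R" using J I invertible_ideal_ideal by auto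
  \<comment> \<open>\<open>K <+> I\<close> is again finitely generated and regular, so its radical
    \<open>H\<close> is invertible by \<open>rad\<close> and, containing \<open>K\<close>, divides
    it.\<close>
  have enlarge: "\<exists>H B. invertible_ideal R H \<and> ideal B R \<and> K = H \<cdot> B \<and> K \<subseteq> H \<and> I \<subseteq> H \<and> H \<subseteq> M \<and>
      H = radical R (K <+> I)" if K: "invertible_ideal R K" "K \<subseteq> P" for K
  proof -
    have Ki: "ideal K R" using K invertible_ideal_ideal by blast
    have KI: "ideal (K <+> I) R" "K \<subseteq> K <+> I" "I \<subseteq> K <+> I"
      using add_ideals subset_set_add_left subset_set_add_right Ki Ii by auto
    have "regular_ideal R (K <+> I)"
      using regular_ideal_mono[OF invertible_ideal_regular[OF K(1)] KI(1,2)] .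
    moreover have "fg_ideal R (K <+> I)"
      using K I fg_ideal_set_add invertible_ideal_fg by blast
    ultimately have inv: "invertible_ideal R (radical R (K <+> I))" by (rule rad)
    have "K <+> I \<subseteq> M" using K I M Ki Ii Mi by (auto simp: set_add_subset_iff)
    then have sub: "radical R (K <+> I) \<subseteq> M" using Mp by (intro radical_subset_prime)
    have "K <+> I \<subseteq> radical R (K <+> I)" using KI(1) by (rule subset_radical)
    then show ?thesis using inv sub KI invertible_ideal_dvd[OF inv Ki] by blast
  qed
  obtain H B where H: "invertible_ideal R H" "ideal B R" "J = H \<cdot> B" "I \<subseteq> H" "H = radical R (J <+> I)"
    using enlarge[OF J JP] by blast
  have Hi: "ideal H R" using H invertible_ideal_ideal by blast
  \<comment> \<open>\<open>P\<close> is prime and does not contain \<open>H\<close>, so the cofactor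
    \<open>B\<close> lies in \<open>P\<close> and can be enlarged in turn.\<close>
  have "\<not> H \<subseteq> P" using H(4) I(3) by blast
  then have BP: "B \<subseteq> P" using primeideal_prod[OF P(1) Hi H(2)] JP H(3) by blast
  have Binv: "invertible_ideal R B" using J Hi H(2) unfolding H(3) by (rule invertible_ideal_factor(2))
  obtain H' C where H': "invertible_ideal R H'" "ideal C R" "B = H' \<cdot> C" "H' \<subseteq> M"
      "H' = radical R (B <+> I)"
    using enlarge[OF Binv BP] by blast
  have H'i: "ideal H' R" using H' invertible_ideal_ideal by blast
  have "J \<subseteq> B" unfolding H(3) using Hi H(2) by (rule ideal_prod_subset_right)
  then have HH': "H \<subseteq> H'" unfolding H(5) H'(5) by (intro radical_mono set_add_mono) auto
  have HC: "ideal (H \<cdot> C) R" using Hi H'(2) ideal_prod_is_ideal by blast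
  have "(H \<cdot> C) \<cdot> (H \<cdot> C) = H \<cdot> ((H \<cdot> C) \<cdot> C)"
    using Hi H'(2) by (simp add: ideal_prod_ac ideal_prod_is_ideal)
  also have "\<dots> \<subseteq> H \<cdot> ((H' \<cdot> C) \<cdot> carrier R)"
    using HH' ideal_subset_carrier[OF H'(2)] by (intro ideal_prod_mono) auto
  also have "\<dots> = J" using H(3) H'(3) H(2) by (simp add: ideal_prod_one)
  finally have "H \<cdot> C \<subseteq> J" using radical_ideal_square[OF Jr HC] by blast
  \<comment> \<open>Since \<open>J\<close> is the product of \<open>H \<cdot> C\<close> and
    \<open>H'\<close>, the inclusion \<open>H \<cdot> C \<subseteq> J\<close> compares
    \<open>H \<cdot> C\<close> with its own multiple by \<open>H'\<close>, and cancelling it makes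
    \<open>H'\<close> the unit ideal.\<close>
  then have "(H \<cdot> C) \<cdot> carrier R \<subseteq> (H \<cdot> C) \<cdot> H'"
    using Hi H'(2) H'i HC unfolding H(3) H'(3) by (simp add: ideal_prod_one ideal_prod_ac ideal_prod_is_ideal)
  moreover have "invertible_ideal R (H \<cdot> C)"
    using invertible_ideal_prod[OF H(1)] invertible_ideal_factor(2)[OF _ H'i H'(2)] Binv
    unfolding H'(3) by blast
  ultimately have "carrier R \<subseteq> H'"
    using invertible_ideal_cancel oneideal H'i by blast
  then have "\<one> \<in> M" using H'(4) by blast
  then show False using primeideal_one_notin[OF Mp] by blast
qed

text \<open>A prime containing the product contains a factor, and factors of an invertible ideal are
  invertible.\<close>

lemma exists_invertible_radical_factor:
  assumes P: "primeideal P R" and I: "invertible_ideal R I" "product_of_radical_ideals R I" "I \<subseteq> P"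
  shows "\<exists>J. invertible_ideal R J \<and> radical_ideal R J \<and> J \<subseteq> P"
proof -
  obtain Ks where Ks: "\<And>K. K \<in> set Ks \<Longrightarrow> radical_ideal R K" "I = product_of_ideals R Ks"
    using I(2) unfolding product_of_radical_ideals_def by blast
  have "invertible_ideal R (product_of_ideals R Ks) \<Longrightarrow> product_of_ideals R Ks \<subseteq> P \<Longrightarrow>
      \<exists>K\<in>set Ks. invertible_ideal R K \<and> K \<subseteq> P"
    using Ks(1)
  proof (induction Ks)
    case Nil
    then show ?case using primeideal_one_notin[OF P] by auto
  next
    case (Cons K Ks)
    have i: "ideal K R" "ideal (product_of_ideals R Ks) R"
      using Cons.prems(3) radical_ideal_ideal by (auto intro!: ideal_product_of_ideals)
    then show ?case
      using Cons primeideal_prod[OF P i] invertible_ideal_factor[OF _ i] by auto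
  qed
  then show ?thesis using Ks I by auto
qed

text \<open>If two factors lie in \<open>Q\<close>, the product lies in \<open>Q \<cdot> Q\<close>.
  Otherwise all factors but one contribute elements outside \<open>Q\<close>, and a product
  \<open>c\<close> of these carries the remaining factor into the full product: the two agree
  locally at \<open>Q\<close>.\<close>

lemma product_of_ideals_at_prime:
  assumes Q: "primeideal Q R" and Js: "\<And>J. J \<in> set Js \<Longrightarrow> ideal J R"
    and "product_of_ideals R Js \<subseteq> Q"
  shows "(\<exists>J\<in>set Js. \<exists>c\<in>carrier R. c \<notin> Q \<and> (\<forall>x\<in>J. c \<otimes> x \<in> product_of_ideals R Js)) \<or>
    product_of_ideals R Js \<subseteq> Q \<cdot> Q"
  using assms(2,3)
proof (induction Js)
  case Nil
  then show ?case using primeideal_one_notin[OF Q] by auto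
next
  case (Cons J Js)
  define p where "p = product_of_ideals R Js"
  have J: "ideal J R" and p: "ideal p R" and Qi: "ideal Q R"
    using Cons.prems primeideal_ideal[OF Q] by (auto simp: p_def intro: ideal_product_of_ideals)
  have Jp: "J \<cdot> p \<subseteq> Q" using Cons.prems by (simp add: p_def)
  consider "J \<subseteq> Q" "p \<subseteq> Q" | "\<not> p \<subseteq> Q" | "\<not> J \<subseteq> Q" "p \<subseteq> Q" by blast
  then show ?case
  proof cases
    case 1
    then show ?thesis using ideal_prod_mono by (auto simp: p_def)
  next
    case 2
    then obtain c where c: "c \<in> p" "c \<notin> Q" by blast
    then have cl: "c \<in> carrier R" using ideal_carrier[OF p] by blast
    have "c \<otimes> x \<in> J \<cdot> p" if "x \<in> J" for x
      using ideal_prod.prod[of x J c p R] that c m_comm[OF cl ideal_carrier[OF J that]] by simp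
    then show ?thesis using c cl by (auto simp: p_def)
  next
    case 3
    then obtain d where d: "d \<in> J" "d \<notin> Q" by blast
    then have dc: "d \<in> carrier R" using ideal_carrier[OF J] by blast
    have "(\<exists>K\<in>set Js. \<exists>c\<in>carrier R. c \<notin> Q \<and> (\<forall>x\<in>K. c \<otimes> x \<in> p)) \<or> p \<subseteq> Q \<cdot> Q"
      using Cons.IH Cons.prems 3 by (simp add: p_def)
    then show ?thesis
    proof
      assume "\<exists>K\<in>set Js. \<exists>c\<in>carrier R. c \<notin> Q \<and> (\<forall>x\<in>K. c \<otimes> x \<in> p)"
      then obtain K c where K: "K \<in> set Js" "c \<in> carrier R" "c \<notin> Q" "\<And>x. x \<in> K \<Longrightarrow> c \<otimes> x \<in> p"
        by blast
      have "(d \<otimes> c) \<otimes> x \<in> J \<cdot> p" if "x \<in> K" for x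
      proof -
        have "ideal K R" using K(1) Cons.prems by simp
        then have "x \<in> carrier R" using that by (rule ideal_carrier)
        then have "(d \<otimes> c) \<otimes> x = d \<otimes> (c \<otimes> x)" using dc K by (simp add: m_assoc)
        then show ?thesis using ideal_prod.prod[OF d(1) K(4)[OF that], of R] by simp
      qed
      moreover have "d \<otimes> c \<notin> Q" using primeideal_mult_notin[OF Q dc] K d by blast
      ultimately show ?thesis using K dc by (auto simp: p_def intro!: bexI[of _ "d \<otimes> c"])
    next
      assume "p \<subseteq> Q \<cdot> Q"
      then show ?thesis using ideal_prod_subset_right[OF J p] by (auto simp: p_def)
    qed
  qed
qed

text \<open>This is the second symbolic power of \<open>Q\<close>: the elements that land in the
  square of the maximal ideal of the localization at \<open>Q\<close>.\<close>

lemma ideal_saturated_square: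
  assumes Q: "primeideal Q R"
  shows "ideal {x \<in> carrier R. \<exists>u\<in>carrier R. u \<notin> Q \<and> u \<otimes> x \<in> Q \<cdot> Q} R" (is "ideal ?S R")
proof -
  have QQ: "ideal (Q \<cdot> Q) R" using primeideal_ideal[OF Q] ideal_prod_is_ideal by blast
  show ?thesis
  proof (rule ideal_criterion)
    have "\<one> \<otimes> \<zero> \<in> Q \<cdot> Q" using ideal_zero_closed[OF QQ] by simp
    then show "\<zero> \<in> ?S" using primeideal_one_notin[OF Q] by blast
  next
    fix x y assume "x \<in> ?S" "y \<in> ?S"
    then obtain u v where uv: "x \<in> carrier R" "y \<in> carrier R" "u \<in> carrier R" "v \<in> carrier R"
      "u \<notin> Q" "v \<notin> Q" "u \<otimes> x \<in> Q \<cdot> Q" "v \<otimes> y \<in> Q \<cdot> Q" by blast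
    then have "v \<otimes> (u \<otimes> x) \<oplus> u \<otimes> (v \<otimes> y) \<in> Q \<cdot> Q" by (intro ideal_linear_combination[OF QQ])
    then have "(u \<otimes> v) \<otimes> (x \<oplus> y) \<in> Q \<cdot> Q" using uv(1-4) by (simp add: r_distr m_ac)
    then show "x \<oplus> y \<in> ?S" using uv primeideal_mult_notin[OF Q uv(3,4)] by blast
  next
    fix r x assume r: "r \<in> carrier R" and "x \<in> ?S"
    then obtain u where u: "x \<in> carrier R" "u \<in> carrier R" "u \<notin> Q" "u \<otimes> x \<in> Q \<cdot> Q" by blast
    then have "r \<otimes> (u \<otimes> x) \<in> Q \<cdot> Q" using ideal_mult_closed[OF QQ] r by blast
    then have "u \<otimes> (r \<otimes> x) \<in> Q \<cdot> Q" using r u(1,2) by (simp add: m_ac)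
    then show "r \<otimes> x \<in> ?S" using r u by blast
  qed auto
qed

text \<open>Suppose \<open>P\<close> is a regular prime that is not maximal, let \<open>I\<close> be invertible with
  \<open>P + I \<noteq> R\<close>, \<open>I \<not>\<subseteq> P\<close>, and let \<open>Q\<close> be a prime minimal over \<open>P + I\<close>.  Factoring \<open>P + I\<^sup>2\<close> shows that
  \<open>P \<subseteq> Q\<^sup>2\<close> and that \<open>Q\<close> is not locally idempotent; so there is an invertible \<open>T \<subseteq> Q\<close> not locally in
  \<open>Q\<^sup>2\<close>.  Factoring \<open>K\<^sup>2 + T\<close> shows that finitely generated \<open>K \<subseteq> P\<close> are locally divisible by
  \<open>T\<close>.  Doing this twice to an invertible radical \<open>J \<subseteq> P\<close> contradicts radicality of \<open>J\<close>.\<close>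

lemma sp_ring_regular_prime_maximal:
  assumes avoid: "\<And>I B. regular_ideal R I \<Longrightarrow> ideal B R \<Longrightarrow> \<not> I \<subseteq> B \<Longrightarrow>
      \<exists>T. invertible_ideal R T \<and> T \<subseteq> I \<and> \<not> T \<subseteq> B"
    and sp: "sp_ring R"
    and P: "primeideal P R" "regular_ideal R P"
  shows "maximalideal P R"
proof (rule ccontr)
  assume notmax: "\<not> maximalideal P R"
  have Pi: "ideal P R" using P(1) primeideal_ideal by blast
  obtain M where M: "maximalideal M R" "P \<subseteq> M"
    using exists_maximalideal[OF Pi] primeideal.I_notcarr[OF P(1)] by blast
  have Mp: "primeideal M R" using M(1) by (rule maximalideal_prime)
  then have Mi: "ideal M R" by (rule primeideal_ideal)
  have "\<not> M \<subseteq> P" using M notmax subset_antisym by metis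
  then obtain I where I: "invertible_ideal R I" "I \<subseteq> M" "\<not> I \<subseteq> P"
    using avoid[OF regular_ideal_mono[OF P(2) Mi M(2)] Pi] by blast
  have Ii: "ideal I R" using I invertible_ideal_ideal by blast
  obtain Q where Q: "primeideal Q R" "P \<union> I \<subseteq> Q"
    and min: "\<And>Q'. primeideal Q' R \<Longrightarrow> P \<union> I \<subseteq> Q' \<Longrightarrow> Q' \<subseteq> Q \<Longrightarrow> Q' = Q"
    using exists_minimal_prime[OF Mp, of "P \<union> I"] I(2) M(2) by blast
  have Qi: "ideal Q R" using Q(1) by (rule primeideal_ideal)
  have QQ: "ideal (Q \<cdot> Q) R" using Qi ideal_prod_is_ideal by blast
  have S: "submonoid (carrier R - Q) R" using Q(1) by (rule submonoid_complement)
  have PI: "ideal (P <+> I) R" "P <+> I \<subseteq> Q"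
    using Pi Ii Qi Q(2) add_ideals by (auto simp: set_add_subset_iff)
  have II: "ideal (I \<cdot> I) R" "I \<cdot> I \<subseteq> I" using Ii ideal_prod_is_ideal ideal_prod_subset_left by auto
  have PII: "ideal (P <+> I \<cdot> I) R" "P \<subseteq> P <+> I \<cdot> I" "I \<cdot> I \<subseteq> P <+> I \<cdot> I" "P <+> I \<cdot> I \<subseteq> P <+> I"
    using add_ideals[OF Pi II(1)] subset_set_add_left[OF Pi II(1)] subset_set_add_right[OF Pi II(1)]
      set_add_mono[OF subset_refl II(2)] by auto
  \<comment> \<open>Otherwise Nakayama's lemma for \<open>I\<close> modulo \<open>P\<close> yields
    \<open>d \<notin> Q\<close> carrying \<open>I\<close> into \<open>P\<close>; but
    \<open>d \<notin> P\<close> as well, while \<open>I\<close> is not contained in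
    \<open>P\<close>.\<close>
  have not_locally: "\<not> (\<forall>x\<in>I. c \<otimes> x \<in> P <+> I \<cdot> I)" if c: "c \<in> carrier R" "c \<notin> Q" for c
  proof
    assume *: "\<forall>x\<in>I. c \<otimes> x \<in> P <+> I \<cdot> I"
    have "P <+> I \<cdot> I \<subseteq> P <+> Q \<cdot> I" using Q(2) by (intro set_add_mono ideal_prod_mono) auto
    then obtain d where d: "d \<in> carrier R" "d \<notin> Q" "\<forall>x\<in>I. d \<otimes> x \<in> P"
      using nakayama_localized[OF invertible_ideal_fg[OF I(1)] Pi Q(1) c] * by blast
    obtain x where x: "x \<in> I" "x \<notin> P" using I(3) by blast
    then show False
      using d Q(2) primeideal_mult_notin[OF P(1) d(1) ideal_carrier[OF Ii x(1)]] by blast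
  qed
  have "regular_ideal R (P <+> I \<cdot> I)" using regular_ideal_mono[OF P(2) PII(1,2)] .
  then obtain Js where Js: "\<And>J. J \<in> set Js \<Longrightarrow> radical_ideal R J" "P <+> I \<cdot> I = product_of_ideals R Js"
    using sp unfolding sp_ring_def product_of_radical_ideals_def by blast
  have Jsi: "ideal J R" if "J \<in> set Js" for J using Js(1)[OF that] by (rule radical_ideal_ideal)
  have Js_PI: "P <+> I \<subseteq> J" if "J \<in> set Js" for J
  proof -
    have "P <+> I \<cdot> I \<subseteq> J" unfolding Js(2) using Jsi that by (rule product_of_ideals_subset)
    then have "P \<subseteq> J" "I \<cdot> I \<subseteq> J" using PII by auto
    then show ?thesis
      using radical_ideal_square[OF Js(1)[OF that] Ii] Pi Ii Jsi[OF that] by (simp add: set_add_subset_iff)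
  qed
  \<comment> \<open>The other alternative at \<open>Q\<close> is a factor carried into
    \<open>P <+> I \<cdot> I\<close> by one multiplier outside \<open>Q\<close>; that factor
    contains \<open>I\<close>, against \<open>not_locally\<close>.\<close>
  have PQQ: "P <+> I \<cdot> I \<subseteq> Q \<cdot> Q"
  proof -
    have "product_of_ideals R Js \<subseteq> Q" using PII PI Js(2) by blast
    then consider "P <+> I \<cdot> I \<subseteq> Q \<cdot> Q"
      | J c where "J \<in> set Js" "c \<in> carrier R" "c \<notin> Q" "\<forall>x\<in>J. c \<otimes> x \<in> P <+> I \<cdot> I"
      using product_of_ideals_at_prime[OF Q(1) Jsi] unfolding Js(2) by blast
    then show ?thesis
    proof cases
      case 2
      then have "\<forall>x\<in>I. c \<otimes> x \<in> P <+> I \<cdot> I"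
        using Js_PI[OF 2(1)] subset_set_add_right[OF Pi Ii] by blast
      then show ?thesis using not_locally 2 by blast
    qed
  qed
  \<comment> \<open>No prime over \<open>P \<union> I\<close> lies strictly inside \<open>Q\<close>,
    so each radical factor agrees with \<open>Q\<close> locally.\<close>
  have local: "\<exists>u\<in>carrier R - Q. u \<otimes> x \<in> J" if J: "J \<in> set Js" and x: "x \<in> Q" for J x
  proof -
    have xc: "x \<in> carrier R" using x by (rule ideal_carrier[OF Qi])
    have "\<exists>u n. u \<in> carrier R \<and> u \<notin> Q \<and> u \<otimes> x [^] (n::nat) \<in> J"
    proof (rule ccontr)
      assume "\<not> ?thesis"
      then obtain Q' where Q': "primeideal Q' R" "J \<subseteq> Q'" "Q' \<subseteq> Q" "x \<notin> Q'"
        using exists_smaller_prime[OF Q(1) Jsi[OF J] x] by blast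
      moreover have "P \<union> I \<subseteq> Q'"
        using Js_PI[OF J] Q'(2) subset_set_add_left[OF Pi Ii] subset_set_add_right[OF Pi Ii] by blast
      ultimately show False using min x by blast
    qed
    then show ?thesis using radical_ideal_mult_power[OF Js(1)[OF J] _ xc] by blast
  qed
  define Q2 where "Q2 = {x \<in> carrier R. \<exists>u\<in>carrier R. u \<notin> Q \<and> u \<otimes> x \<in> Q \<cdot> Q}"
  have Q2: "ideal Q2 R" unfolding Q2_def using Q(1) by (rule ideal_saturated_square)
  have QQ2: "Q \<cdot> Q \<subseteq> Q2"
  proof
    fix x assume x: "x \<in> Q \<cdot> Q"
    then have "x \<in> carrier R" "\<one> \<otimes> x \<in> Q \<cdot> Q" using ideal_carrier[OF QQ] by auto
    then show "x \<in> Q2" unfolding Q2_def using primeideal_one_notin[OF Q(1)] by blast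
  qed
  \<comment> \<open>If \<open>Q\<close> were locally idempotent, the product of all factors would
    locally still contain \<open>Q\<close> and with it \<open>I\<close>, against
    \<open>not_locally\<close>.\<close>
  have "\<not> Q \<subseteq> Q2"
  proof
    assume idem: "Q \<subseteq> Q2"
    have "\<exists>u\<in>carrier R - Q. u \<otimes> x \<in> product_of_ideals R Ks"
      if "set Ks \<subseteq> set Js" "x \<in> Q" for Ks x
      using that
    proof (induction Ks arbitrary: x)
      case Nil
      then have "\<one> \<otimes> x \<in> carrier R" using ideal_carrier[OF Qi] by auto
      then show ?case using submonoid.one_closed[OF S] unfolding product_of_ideals_Nil by blast
    next
      case (Cons J Ks)
      define p where "p = product_of_ideals R Ks"
      have J: "J \<in> set Js" using Cons.prems by simp
      have p: "ideal p R" unfolding p_def using Cons.prems Jsi by (intro ideal_product_of_ideals) auto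
      have p_local: "\<exists>u\<in>carrier R - Q. u \<otimes> y \<in> p" if "y \<in> Q" for y
        using Cons.IH[OF _ that] Cons.prems by (simp add: p_def)
      have *: "\<exists>u\<in>carrier R - Q. u \<otimes> z \<in> J \<cdot> p" if "z \<in> Q \<cdot> Q" for z
        using ideal_prod_denominator[OF S Qi Jsi[OF J] local[OF J] Qi p p_local that] by blast
      obtain u where u: "u \<in> carrier R - Q" "u \<otimes> x \<in> Q \<cdot> Q"
        using idem Cons.prems(2) unfolding Q2_def by blast
      obtain v where v: "v \<in> carrier R - Q" "v \<otimes> (u \<otimes> x) \<in> J \<cdot> p" using *[OF u(2)] by blast
      have "(v \<otimes> u) \<otimes> x \<in> J \<cdot> p"
        using v u(1) ideal_carrier[OF Qi Cons.prems(2)] by (simp add: m_assoc)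
      then show ?case using submonoid.m_closed[OF S v(1) u(1)] by (auto simp: p_def)
    qed
    then have "\<forall>x\<in>I. \<exists>u\<in>carrier R - Q. u \<otimes> x \<in> P <+> I \<cdot> I"
      using Q(2) unfolding Js(2) by blast
    then obtain u where "u \<in> carrier R - Q" "\<forall>x\<in>I. u \<otimes> x \<in> P <+> I \<cdot> I"
      using fg_ideal_uniform_denominator[OF invertible_ideal_fg[OF I(1)] S PII(1)] by blast
    then show False using not_locally by blast
  qed
  moreover have "regular_ideal R Q" using regular_ideal_mono[OF P(2) Qi] Q(2) by blast
  ultimately obtain T where T: "invertible_ideal R T" "T \<subseteq> Q" "\<not> T \<subseteq> Q2"
    using avoid[OF _ Q2] by blast
  have Ti: "ideal T R" using T invertible_ideal_ideal by blast
  have "\<not> T \<subseteq> P" using T(3) PII(2) PQQ QQ2 by blast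
  \<comment> \<open>\<open>T\<close> keeps \<open>T <+> K \<cdot> K\<close> out of
    \<open>Q \<cdot> Q\<close>, so locally this sum is a single radical factor \<open>B\<close>.
    Squares show \<open>K \<subseteq> B\<close>, hence \<open>c\<close> carries \<open>K\<close>
    into \<open>T <+> Q \<cdot> K\<close>, and Nakayama's lemma removes the second term.\<close>
  have divides: "\<exists>d\<in>carrier R. d \<notin> Q \<and> (\<forall>x\<in>K. d \<otimes> x \<in> T)" if K: "fg_ideal R K" "K \<subseteq> P" for K
  proof -
    have Ki: "ideal K R" using K fg_ideal_ideal by blast
    have KK: "ideal (K \<cdot> K) R" using Ki ideal_prod_is_ideal by blast
    have TK: "ideal (T <+> K \<cdot> K) R" "T \<subseteq> T <+> K \<cdot> K" "K \<cdot> K \<subseteq> T <+> K \<cdot> K"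
      using add_ideals[OF Ti KK] subset_set_add_left[OF Ti KK] subset_set_add_right[OF Ti KK] by auto
    have KQ: "K \<subseteq> Q" using K(2) Q(2) by blast
    then have TKQ: "T <+> K \<cdot> K \<subseteq> Q"
      using ideal_prod_subset_left[OF Ki Ki] T(2) Ti KK Qi by (auto simp: set_add_subset_iff)
    have "regular_ideal R (T <+> K \<cdot> K)"
      using regular_ideal_mono[OF invertible_ideal_regular[OF T(1)] TK(1,2)] .
    then obtain Bs where Bs: "\<And>B. B \<in> set Bs \<Longrightarrow> radical_ideal R B" "T <+> K \<cdot> K = product_of_ideals R Bs"
      using sp unfolding sp_ring_def product_of_radical_ideals_def by blast
    have Bsi: "ideal B R" if "B \<in> set Bs" for B using Bs(1)[OF that] by (rule radical_ideal_ideal)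
    have "\<not> T <+> K \<cdot> K \<subseteq> Q \<cdot> Q" using T(3) QQ2 TK(2) by blast
    then obtain B c where B: "B \<in> set Bs" "c \<in> carrier R" "c \<notin> Q" "\<forall>x\<in>B. c \<otimes> x \<in> T <+> K \<cdot> K"
      using product_of_ideals_at_prime[OF Q(1) Bsi] TKQ unfolding Bs(2) by blast
    have "T <+> K \<cdot> K \<subseteq> B" unfolding Bs(2) using Bsi B(1) by (rule product_of_ideals_subset)
    then have "K \<subseteq> B" using radical_ideal_square[OF Bs(1)[OF B(1)] Ki] TK by blast
    moreover have "T <+> K \<cdot> K \<subseteq> T <+> Q \<cdot> K" using KQ by (intro set_add_mono ideal_prod_mono) auto
    ultimately have "\<forall>x\<in>K. c \<otimes> x \<in> T <+> Q \<cdot> K" using B(4) by blast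
    then show ?thesis using nakayama_localized[OF K(1) Ti Q(1) B(2,3)] by blast
  qed
  \<comment> \<open>As \<open>T\<close> is not inside the prime \<open>P\<close>, the quotient
    \<open>K'\<close> lies in \<open>P\<close> again and is finitely generated, so division by
    \<open>T\<close> can be repeated.\<close>
  have divides': "\<exists>d K'. d \<in> carrier R \<and> d \<notin> Q \<and> ideal K' R \<and> fg_ideal R K' \<and> K' \<subseteq> P \<and> (PIdl d) \<cdot> K = T \<cdot> K'"
    if K: "fg_ideal R K" "K \<subseteq> P" for K
  proof -
    have Ki: "ideal K R" using K fg_ideal_ideal by blast
    obtain d where d: "d \<in> carrier R" "d \<notin> Q" "\<forall>x\<in>K. d \<otimes> x \<in> T" using divides[OF K] by blast
    have dK: "ideal ((PIdl d) \<cdot> K) R" using d Ki cgenideal_ideal ideal_prod_is_ideal by blast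
    have "(PIdl d) \<cdot> K \<subseteq> T" using PIdl_prod_subset_iff[OF Ki Ti d(1)] d(3) by blast
    then obtain K' where K': "ideal K' R" "(PIdl d) \<cdot> K = T \<cdot> K'"
      using invertible_ideal_dvd[OF T(1) dK] by blast
    have "fg_ideal R (T \<cdot> K')" unfolding K'(2)[symmetric] using K(1) d fg_ideal_prod fg_ideal_PIdl by blast
    then have "fg_ideal R K'" using fg_ideal_invertible_factor[OF T(1) K'(1)] by blast
    moreover have "T \<cdot> K' \<subseteq> P"
      unfolding K'(2)[symmetric]
      using ideal_prod_subset_right[OF cgenideal_ideal[OF d(1)] Ki] K(2) by blast
    then have "K' \<subseteq> P" using primeideal_prod[OF P(1) Ti K'(1)] \<open>\<not> T \<subseteq> P\<close> by blast
    ultimately show ?thesis using d K' by blast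
  qed
  obtain J where J: "invertible_ideal R J" "radical_ideal R J" "J \<subseteq> P"
  proof -
    obtain s where s: "PIdl s \<subseteq> P" "invertible_ideal R (PIdl s)" "regular_ideal R (PIdl s)"
      using P(2) by (rule regular_ideal_obtains_nonzerodivisor)
    then show ?thesis
      using exists_invertible_radical_factor[OF P(1) s(2)] sp that unfolding sp_ring_def by blast
  qed
  have Ji: "ideal J R" using J radical_ideal_ideal by blast
  obtain d J' where d: "d \<in> carrier R" "d \<notin> Q" "ideal J' R" "fg_ideal R J'" "J' \<subseteq> P" "(PIdl d) \<cdot> J = T \<cdot> J'"
    using divides'[OF invertible_ideal_fg[OF J(1)] J(3)] by blast
  obtain e J'' where e: "e \<in> carrier R" "e \<notin> Q" "ideal J'' R" "(PIdl e) \<cdot> J' = T \<cdot> J''"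
    using divides'[OF d(4,5)] by blast
  have de: "ideal (PIdl d) R" "ideal (PIdl e) R" "ideal ((PIdl e) \<cdot> (PIdl d)) R"
    using d(1) e(1) cgenideal_ideal ideal_prod_is_ideal by auto
  have TJ: "ideal (T \<cdot> J'') R" using Ti e(3) by (rule ideal_prod_is_ideal)
  have "((PIdl e) \<cdot> (PIdl d)) \<cdot> J = (PIdl e) \<cdot> (T \<cdot> J')"
    using ideal_prod_assoc[OF de(2,1) Ji] d(6) by simp
  also have "\<dots> = T \<cdot> (T \<cdot> J'')" using ideal_prod_lcomm[OF de(2) Ti d(3)] e(4) by simp
  finally have eq: "((PIdl e) \<cdot> (PIdl d)) \<cdot> J = T \<cdot> (T \<cdot> J'')" .
  \<comment> \<open>The square lies in a multiple of \<open>J\<close>, so radicality gives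
    \<open>T \<cdot> J'' \<subseteq> J\<close>. One more factor \<open>T\<close> and
    \<open>eq\<close> put the multiple of \<open>J\<close> by \<open>e \<otimes> d\<close> inside
    \<open>J \<cdot> T\<close>; cancelling \<open>J\<close> leaves
    \<open>e \<otimes> d \<in> T \<subseteq> Q\<close>.\<close>
  have "(T \<cdot> J'') \<cdot> (T \<cdot> J'') = J'' \<cdot> (T \<cdot> (T \<cdot> J''))"
    using Ti e(3) by (simp add: ideal_prod_ac ideal_prod_is_ideal)
  also have "\<dots> \<subseteq> T \<cdot> (T \<cdot> J'')" using e(3) Ti TJ by (intro ideal_prod_subset_right ideal_prod_is_ideal)
  also have "\<dots> \<subseteq> J" unfolding eq[symmetric] using de(3) Ji by (rule ideal_prod_subset_right)
  finally have "T \<cdot> J'' \<subseteq> J" using radical_ideal_square[OF J(2) TJ] by blast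
  then have "J \<cdot> ((PIdl e) \<cdot> (PIdl d)) \<subseteq> J \<cdot> T"
    using ideal_prod_mono[OF subset_refl, of "T \<cdot> J''" J T] eq
      ideal_prod_commute[OF Ji de(3)] ideal_prod_commute[OF Ji Ti] by simp
  then have "(PIdl e) \<cdot> (PIdl d) \<subseteq> T" using invertible_ideal_cancel[OF J(1) de(3) Ti] by blast
  then have "e \<otimes> d \<in> Q"
    using T(2) ideal_prod.prod[of e "PIdl e" d "PIdl d" R] cgenideal_self d(1) e(1) by blast
  then show False using primeideal_mult_notin[OF Q(1)] d e by blast
qed

end

section \<open>Orders of regular ideals at regular maximal ideals\<close>

text \<open>A number is the sum of the indicators of its positive levels. This converts products
  over levels into orders.\<close>

lemma sum_list_threshold: "(\<Sum>k\<leftarrow>[1..<Suc N]. if k \<le> n then 1 else 0) = min n (N::nat)"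
  by (induction N) auto

text \<open>The two assumptions are condition (4), so everything proved in this locale is a
  consequence of it.\<close>

locale sp_cring = cring R for R (structure) +
  assumes regular_prime_maximal: "primeideal P R \<Longrightarrow> regular_ideal R P \<Longrightarrow> maximalideal P R"
    and prime_contains_invertible_radical: "primeideal P R \<Longrightarrow> regular_ideal R P \<Longrightarrow>
      \<exists>J. invertible_ideal R J \<and> radical_ideal R J \<and> J \<subseteq> P"

context cring
begin

lemma max_regD:
  assumes "M \<in> max_reg R"
  shows "maximalideal M R" "regular_ideal R M" "primeideal M R" "ideal M R"
  using assms maximalideal_prime by (auto simp: max_reg_def regular_ideal_def)

text \<open>Under the hypotheses of \<open>sp_cring\<close> such a \<open>J\<close> generates the maximal ideal of the
  localization at \<open>M\<close>, so it plays the role of a uniformizer.\<close>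

definition uniformizer :: "'a set \<Rightarrow> 'a set \<Rightarrow> bool" where
  "uniformizer M J \<longleftrightarrow> M \<in> max_reg R \<and> invertible_ideal R J \<and> radical_ideal R J \<and> J \<subseteq> M"

lemma uniformizerD:
  assumes "uniformizer M J"
  shows "M \<in> max_reg R" "invertible_ideal R J" "radical_ideal R J" "J \<subseteq> M" "ideal J R" "fg_ideal R J"
  using assms invertible_ideal_fg by (auto simp: uniformizer_def radical_ideal_def)

text \<open>Modulo \<open>M\<close> the element \<open>u\<close> is invertible:
  \<open>m \<oplus> r \<otimes> u = \<one>\<close>. In
  \<open>x = m \<otimes> x \<oplus> r \<otimes> (u \<otimes> x)\<close> the first term gains one
  power of \<open>M\<close> over what is already known for \<open>x\<close>.\<close>

lemma ideal_pow_maximal_primary: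
  assumes M: "maximalideal M R" and u: "u \<in> carrier R" "u \<notin> M"
    and x: "x \<in> carrier R" "u \<otimes> x \<in> ideal_pow M n"
  shows "x \<in> ideal_pow M n"
  using x(2)
proof (induction n)
  case 0
  then show ?case using x by simp
next
  case (Suc n)
  have Mi: "ideal M R" using maximalideal_prime[OF M] by (rule primeideal_ideal)
  have Mn: "ideal (ideal_pow M k) R" for k using Mi by (rule ideal_ideal_pow)
  obtain r m where rm: "r \<in> carrier R" "m \<in> M" "m \<oplus> r \<otimes> u = \<one>"
    using maximalideal_obtains_inverse[OF M u] by blast
  have m: "m \<in> carrier R" using rm(2) by (rule ideal_carrier[OF Mi])
  have "u \<otimes> x \<in> ideal_pow M n" using Suc.prems ideal_pow_antimono[OF Mi, of n "Suc n"] by auto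
  then have "x \<in> ideal_pow M n" by (rule Suc.IH)
  then have "m \<otimes> x \<in> ideal_pow M (Suc n)" using rm(2) by (simp add: ideal_prod.prod)
  moreover have "r \<otimes> (u \<otimes> x) \<in> ideal_pow M (Suc n)"
    using Suc.prems rm(1) by (rule ideal_mult_closed[OF Mn])
  ultimately have "m \<otimes> x \<oplus> r \<otimes> (u \<otimes> x) \<in> ideal_pow M (Suc n)"
    by (rule ideal_add_closed[OF Mn])
  also have "m \<otimes> x \<oplus> r \<otimes> (u \<otimes> x) = (m \<oplus> r \<otimes> u) \<otimes> x"
    using m rm(1) u x by (simp add: l_distr m_assoc)
  also have "\<dots> = x" using rm(3) x by simp
  finally show ?case .
qed

text \<open>Powers of \<open>M\<close> make the value independent of the choice of a uniformizer.
  The minimum exists for regular ideals in \<open>sp_cring\<close> by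
  \<open>exists_not_subset_pow\<close>; \<open>subset_pow_iff\<close> is the working
  characterization.\<close>

definition ideal_order :: "'a set \<Rightarrow> 'a set \<Rightarrow> nat" where
  "ideal_order I M = (LEAST k. \<not> I \<subseteq> ideal_pow M (Suc k))"

lemma regular_product_of_ideals:
  "(\<And>J. J \<in> set Js \<Longrightarrow> regular_ideal R J) \<Longrightarrow> regular_ideal R (product_of_ideals R Js)"
  by (induction Js) (auto simp: regular_ideal_carrier regular_ideal_prod)

text \<open>Beyond the largest order no \<open>M\<close> remains, and the intersection with the
  carrier makes the level ideal the unit ideal.\<close>

definition level_ideal :: "'a set \<Rightarrow> nat \<Rightarrow> 'a set" where
  "level_ideal I k = carrier R \<inter> \<Inter>{M \<in> max_reg R. k \<le> ideal_order I M}"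

end

context sp_cring
begin

section \<open>Finitely generated regular ideals locally at a regular maximal ideal\<close>

lemma exists_uniformizer: "M \<in> max_reg R \<Longrightarrow> \<exists>J. uniformizer M J"
  using prime_contains_invertible_radical[OF max_regD(3,2)] by (auto simp: uniformizer_def)

text \<open>Every prime over the regular ideal \<open>A\<close> is maximal, so none lies strictly
  inside \<open>M\<close>, which \<open>exists_smaller_prime\<close> would otherwise
  produce.\<close>

lemma power_denominator:
  assumes M: "M \<in> max_reg R" and A: "regular_ideal R A" and x: "x \<in> M"
  shows "\<exists>u\<in>carrier R - M. \<exists>n::nat. u \<otimes> x [^] n \<in> A"
proof (rule ccontr)
  assume "\<not> ?thesis"
  then obtain P where P: "primeideal P R" "A \<subseteq> P" "P \<subseteq> M" "x \<notin> P"
    using exists_smaller_prime[OF max_regD(3)[OF M] regular_ideal_ideal[OF A] x] by blast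
  have "maximalideal P R"
    using regular_prime_maximal[OF P(1) regular_ideal_mono[OF A primeideal_ideal[OF P(1)] P(2)]] .
  then have "M = P \<or> M = carrier R"
    using maximalideal.I_maximal[of P R M] max_regD(4)[OF M] P(3) ideal_subset_carrier by blast
  then show False
    using P(4) x primeideal.I_notcarr[OF max_regD(3)[OF M]] by blast
qed

text \<open>By \<open>power_denominator\<close> every element of \<open>M\<close> has locally a
  power in \<open>J\<close>, and \<open>J\<close> is radical.\<close>

lemma uniformizer_denominator:
  assumes "uniformizer M J" "x \<in> M"
  shows "\<exists>u\<in>carrier R - M. u \<otimes> x \<in> J"
proof -
  note J = uniformizerD[OF assms(1)]
  obtain u and n :: nat where "u \<in> carrier R - M" "u \<otimes> x [^] n \<in> J"
    using power_denominator[OF J(1) invertible_ideal_regular[OF J(2)] assms(2)] by blast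
  then show ?thesis
    using radical_ideal_mult_power[OF J(3), of u x n] ideal_carrier[OF max_regD(4)[OF J(1)] assms(2)]
    by blast
qed

lemma uniformizer_power_denominator:
  assumes J: "uniformizer M J" and x: "x \<in> ideal_pow M n"
  shows "\<exists>u\<in>carrier R - M. u \<otimes> x \<in> ideal_pow J n"
  using x
proof (induction n arbitrary: x)
  case 0
  have "\<one> \<in> carrier R - M" "\<one> \<otimes> x \<in> ideal_pow J 0"
    using 0 primeideal_one_notin max_regD(3) uniformizerD(1)[OF J] by auto
  then show ?case by blast
next
  case (Suc n)
  have M: "primeideal M R" "ideal M R" using max_regD uniformizerD(1)[OF J] by auto
  have "\<exists>u\<in>carrier R - M. u \<otimes> x \<in> J \<cdot> ideal_pow J n"
  proof (rule ideal_prod_denominator[OF submonoid_complement[OF M(1)] M(2) uniformizerD(5)[OF J] _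
        ideal_ideal_pow[OF M(2)] ideal_ideal_pow[OF uniformizerD(5)[OF J]]])
    show "x \<in> M \<cdot> ideal_pow M n" using Suc.prems by simp
  qed (use uniformizer_denominator[OF J] Suc.IH in blast)+
  then show ?case by simp
qed

text \<open>Locally \<open>M\<close> equals \<open>J\<close>, so \<open>j > k\<close> would put
  power \<open>k\<close> of \<open>J\<close> into power \<open>k + 1\<close> up to a multiplier
  outside \<open>M\<close>; cancelling the invertible power puts that multiplier in
  \<open>J \<subseteq> M\<close>. Upper bounds for orders are obtained from this.\<close>

lemma uniformizer_power_bound:
  assumes J: "uniformizer M J" and b: "b \<in> carrier R" "b \<notin> M"
    and sub: "\<And>x. x \<in> ideal_pow J k \<Longrightarrow> b \<otimes> x \<in> ideal_pow M j"
  shows "j \<le> k"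
proof (rule ccontr)
  assume "\<not> j \<le> k"
  note JD = uniformizerD[OF J]
  note MD = max_regD[OF JD(1)]
  have Jk: "ideal (ideal_pow J n) R" for n using JD(5) by (rule ideal_ideal_pow)
  have bi: "ideal (PIdl b) R" using b(1) by (rule cgenideal_ideal)
  define K where "K = (PIdl b) \<cdot> ideal_pow J k"
  have K: "fg_ideal R K" "ideal K R" unfolding K_def
    using b(1) JD(6) bi Jk by (auto intro: fg_ideal_prod fg_ideal_PIdl fg_ideal_pow ideal_prod_is_ideal)
  have "K \<subseteq> ideal_pow M j"
    unfolding K_def using PIdl_prod_subset_iff[OF Jk ideal_ideal_pow[OF MD(4)] b(1)] sub by blast
  also have "\<dots> \<subseteq> ideal_pow M (Suc k)" using \<open>\<not> j \<le> k\<close> by (intro ideal_pow_antimono[OF MD(4)]) simp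
  finally have "\<forall>z\<in>K. \<exists>u\<in>carrier R - M. u \<otimes> z \<in> ideal_pow J (Suc k)"
    using uniformizer_power_denominator[OF J] by blast
  then obtain u where u: "u \<in> carrier R - M" "\<forall>z\<in>K. u \<otimes> z \<in> ideal_pow J (Suc k)"
    using fg_ideal_uniform_denominator[OF K(1) submonoid_complement[OF MD(3)] Jk] by blast
  have ui: "ideal (PIdl u) R" using u(1) cgenideal_ideal by blast
  have "(PIdl u) \<cdot> K \<subseteq> ideal_pow J (Suc k)"
    using PIdl_prod_subset_iff[OF K(2) Jk] u by blast
  moreover have "(PIdl u) \<cdot> K = ideal_pow J k \<cdot> ((PIdl u) \<cdot> (PIdl b))"
    unfolding K_def using ui bi Jk[of k] by (simp add: ideal_prod_ac ideal_prod_is_ideal)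
  moreover have "ideal_pow J (Suc k) = ideal_pow J k \<cdot> J"
    using ideal_prod_commute[OF JD(5) Jk] by simp
  ultimately have "(PIdl u) \<cdot> (PIdl b) \<subseteq> J"
    using invertible_ideal_cancel[OF invertible_ideal_pow[OF JD(2)] ideal_prod_is_ideal[OF ui bi] JD(5)]
    by metis
  then have "u \<otimes> b \<in> M"
    using JD(4) ideal_prod.prod[of u "PIdl u" b "PIdl b" R] cgenideal_self u(1) b(1) by blast
  then show False using primeideal_mult_notin[OF MD(3)] u(1) b by blast
qed

text \<open>As long as \<open>A \<subseteq> M\<close>, a multiple of \<open>A\<close> by some
  \<open>u \<notin> M\<close> is divisible by \<open>J\<close>. Each division lowers the exponent
  \<open>N\<close> of a power of \<open>J\<close> known to lie locally in \<open>A\<close>, so the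
  process stops at a cofactor outside \<open>M\<close>.\<close>

lemma local_factorization_aux:
  assumes J: "uniformizer M J"
  shows "fg_ideal R A \<Longrightarrow> w \<in> carrier R \<Longrightarrow> w \<notin> M \<Longrightarrow> (\<And>z. z \<in> ideal_pow J N \<Longrightarrow> w \<otimes> z \<in> A) \<Longrightarrow>
    \<exists>u n B. u \<in> carrier R \<and> u \<notin> M \<and> ideal B R \<and> \<not> B \<subseteq> M \<and> (PIdl u) \<cdot> A = ideal_pow J n \<cdot> B"
proof (induction N arbitrary: A w)
  note JD = uniformizerD[OF J]
  note MD = max_regD[OF JD(1)]
  have unit: "\<exists>u n B. u \<in> carrier R \<and> u \<notin> M \<and> ideal B R \<and> \<not> B \<subseteq> M \<and> (PIdl u) \<cdot> A = ideal_pow J n \<cdot> B"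
    if A: "ideal A R" "\<not> A \<subseteq> M" for A
  proof -
    have "(PIdl \<one>) \<cdot> A = ideal_pow J 0 \<cdot> A" by (simp add: cgenideal_eq_genideal genideal_one)
    then show ?thesis using A primeideal_one_notin[OF MD(3)] by blast
  qed
  {
    case 0
    then have "w \<otimes> \<one> \<in> A" by (metis one_closed product_of_ideals_Nil replicate_0)
    then have "w \<in> A" using 0 by simp
    then show ?case using unit[OF fg_ideal_ideal[OF 0(1)]] 0 by blast
  next
    case (Suc N)
    have Ai: "ideal A R" using Suc.prems fg_ideal_ideal by blast
    have Jk: "ideal (ideal_pow J n) R" for n using JD(5) by (rule ideal_ideal_pow)
    show ?case
    proof (cases "A \<subseteq> M")
      case False
      then show ?thesis using unit[OF Ai] by blast
    next
      case True
      then have "\<forall>x\<in>A. \<exists>u\<in>carrier R - M. u \<otimes> x \<in> J" using uniformizer_denominator[OF J] by blast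
      then obtain u where u: "u \<in> carrier R" "u \<notin> M" "\<forall>x\<in>A. u \<otimes> x \<in> J"
        using fg_ideal_uniform_denominator[OF Suc.prems(1) submonoid_complement[OF MD(3)] JD(5)] by blast
      have ui: "ideal (PIdl u) R" and wi: "ideal (PIdl w) R"
        using u(1) Suc.prems(2) cgenideal_ideal by auto
      have uA: "ideal ((PIdl u) \<cdot> A) R" using ui Ai by (rule ideal_prod_is_ideal)
      have "(PIdl u) \<cdot> A \<subseteq> J" using PIdl_prod_subset_iff[OF Ai JD(5) u(1)] u(3) by blast
      then obtain A' where A': "ideal A' R" "(PIdl u) \<cdot> A = J \<cdot> A'"
        using invertible_ideal_dvd[OF JD(2) uA] by blast
      have "fg_ideal R (J \<cdot> A')"
        unfolding A'(2)[symmetric] using u(1) Suc.prems(1) fg_ideal_prod fg_ideal_PIdl by blast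
      then have fgA': "fg_ideal R A'" using fg_ideal_invertible_factor[OF JD(2) A'(1)] by blast
      have "(PIdl w) \<cdot> ideal_pow J (Suc N) \<subseteq> A"
        using PIdl_prod_subset_iff[OF Jk Ai Suc.prems(2)] Suc.prems(4) by blast
      then have "(PIdl u) \<cdot> ((PIdl w) \<cdot> ideal_pow J (Suc N)) \<subseteq> J \<cdot> A'"
        unfolding A'(2)[symmetric] by (intro ideal_prod_mono) auto
      moreover have "(PIdl u) \<cdot> ((PIdl w) \<cdot> ideal_pow J (Suc N)) = J \<cdot> (((PIdl u) \<cdot> (PIdl w)) \<cdot> ideal_pow J N)"
        using ui wi JD(5) Jk[of N] by (simp add: ideal_prod_ac ideal_prod_is_ideal)
      ultimately have "((PIdl u) \<cdot> (PIdl w)) \<cdot> ideal_pow J N \<subseteq> A'"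
        using invertible_ideal_cancel[OF JD(2) _ A'(1)] ui wi Jk ideal_prod_is_ideal by metis
      then have "(PIdl (u \<otimes> w)) \<cdot> ideal_pow J N \<subseteq> A'" using PIdl_prod[OF u(1) Suc.prems(2)] by simp
      then have *: "(u \<otimes> w) \<otimes> z \<in> A'" if "z \<in> ideal_pow J N" for z
        using PIdl_prod_subset_iff[OF Jk A'(1)] u(1) Suc.prems(2) that by blast
      have "u \<otimes> w \<notin> M" "u \<otimes> w \<in> carrier R"
        using primeideal_mult_notin[OF MD(3)] u Suc.prems by auto
      then obtain v n B where v: "v \<in> carrier R" "v \<notin> M" "ideal B R" "\<not> B \<subseteq> M"
        "(PIdl v) \<cdot> A' = ideal_pow J n \<cdot> B"
        using Suc.IH[OF fgA' _ _ *] by blast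
      have vi: "ideal (PIdl v) R" using v(1) cgenideal_ideal by blast
      have "(PIdl (v \<otimes> u)) \<cdot> A = (PIdl v) \<cdot> ((PIdl u) \<cdot> A)"
        using PIdl_prod[OF v(1) u(1)] ideal_prod_assoc[OF vi ui Ai] by simp
      also have "\<dots> = J \<cdot> ((PIdl v) \<cdot> A')" unfolding A'(2) using vi JD(5) A'(1) by (rule ideal_prod_lcomm)
      also have "\<dots> = ideal_pow J (Suc n) \<cdot> B"
        unfolding v(5) using ideal_prod_assoc[OF JD(5) Jk v(3)] by simp
      finally have "(PIdl (v \<otimes> u)) \<cdot> A = ideal_pow J (Suc n) \<cdot> B" .
      moreover have "v \<otimes> u \<in> carrier R" "v \<otimes> u \<notin> M"
        using primeideal_mult_notin[OF MD(3) v(1) u(1)] u v by auto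
      ultimately show ?thesis using v by blast
    qed
  }
qed

text \<open>Some power of \<open>J\<close> lies in \<open>A\<close> up to one multiplier, since
  \<open>J\<close> is finitely generated and \<open>A\<close> regular; it bounds the number of
  divisions.\<close>

lemma local_factorization:
  assumes J: "uniformizer M J" and A: "fg_ideal R A" "regular_ideal R A"
  obtains u n B where "u \<in> carrier R" "u \<notin> M" "ideal B R" "\<not> B \<subseteq> M"
    "(PIdl u) \<cdot> A = ideal_pow J n \<cdot> B"
proof -
  note JD = uniformizerD[OF J]
  note MD = max_regD[OF JD(1)]
  have "\<forall>x\<in>J. \<exists>u\<in>carrier R - M. \<exists>n::nat. u \<otimes> x [^] n \<in> A"
    using power_denominator[OF JD(1) A(2)] JD(4) by blast
  then obtain w N where "w \<in> carrier R - M" "\<forall>x\<in>ideal_pow J N. w \<otimes> x \<in> A"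
    using fg_ideal_uniform_power[OF JD(6) submonoid_complement[OF MD(3)] regular_ideal_ideal[OF A(2)]]
    by blast
  then show ?thesis using local_factorization_aux[OF J A(1), of w N] that by blast
qed

text \<open>The candidate inverse is \<open>K = (sR : A)\<close>, and \<open>T\<close> collects the
  multipliers carrying \<open>s\<close> into \<open>A \<cdot> K\<close>. At \<open>M\<close> let
  \<open>D\<close> be the quotient of \<open>u s\<close> by the power of \<open>J\<close> in the
  factorization of \<open>u A\<close>. Then \<open>A \<cdot> D = s B\<close> shows
  \<open>D \<subseteq> K\<close>, so \<open>B\<close>, which is not inside \<open>M\<close>, is
  contained in \<open>T\<close>.\<close>

lemma fg_regular_invertible:
  assumes A: "fg_ideal R A" "regular_ideal R A"
  shows "invertible_ideal R A"
proof -
  have Ai: "ideal A R" using A fg_ideal_ideal by blast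
  obtain s where s: "s \<in> A" "s \<in> nonzerodivisors R" "s \<in> carrier R" "PIdl s \<subseteq> A"
    using A(2) by (rule regular_ideal_obtains_nonzerodivisor)
  have si: "ideal (PIdl s) R" using s(3) by (rule cgenideal_ideal)
  define K where "K = {r \<in> carrier R. \<forall>x\<in>A. r \<otimes> x \<in> PIdl s}"
  have K: "ideal K R" unfolding K_def using si ideal_subset_carrier[OF Ai] by (rule ideal_colon)
  have AK: "ideal (A \<cdot> K) R" using Ai K by (rule ideal_prod_is_ideal)
  have "a \<otimes> k \<in> PIdl s" if "a \<in> A" "k \<in> K" for a k
    using that m_comm[of a k] ideal_carrier[OF Ai] by (simp add: K_def)
  then have sub: "A \<cdot> K \<subseteq> PIdl s" using ideal_prod_subset_iff[OF si] by blast
  define T where "T = {r \<in> carrier R. \<forall>x\<in>{s}. r \<otimes> x \<in> A \<cdot> K}"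
  have T: "ideal T R" unfolding T_def using AK s(3) by (intro ideal_colon) auto
  have "s \<in> K"
    using s(3) ideal_carrier[OF Ai] m_comm by (auto simp: K_def mem_PIdl_iff)
  then have "s \<in> T" using ideal_prod.prod[OF s(1), of s K R] s(3) by (simp add: T_def)
  then have Treg: "regular_ideal R T" using T s(2) by (auto simp: regular_ideal_def)
  have "T = carrier R"
  proof (rule ccontr)
    assume "T \<noteq> carrier R"
    then obtain M where M: "M \<in> max_reg R" "T \<subseteq> M" using exists_max_reg[OF Treg] by blast
    obtain J where J: "uniformizer M J" using exists_uniformizer[OF M(1)] by blast
    obtain u n B where u: "u \<in> carrier R" "u \<notin> M" "ideal B R" "\<not> B \<subseteq> M"
      "(PIdl u) \<cdot> A = ideal_pow J n \<cdot> B" using J A by (rule local_factorization)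
    have ui: "ideal (PIdl u) R" using u(1) by (rule cgenideal_ideal)
    have Jn: "ideal (ideal_pow J n) R" "invertible_ideal R (ideal_pow J n)"
      using uniformizerD[OF J] ideal_ideal_pow invertible_ideal_pow by auto
    have us: "ideal ((PIdl u) \<cdot> (PIdl s)) R" using ui si by (rule ideal_prod_is_ideal)
    have "(PIdl u) \<cdot> (PIdl s) \<subseteq> ideal_pow J n"
      using ideal_prod_mono[OF subset_refl s(4), of "PIdl u"] u(5) ideal_prod_subset_left[OF Jn(1) u(3)]
      by blast
    then obtain D where D: "ideal D R" "(PIdl u) \<cdot> (PIdl s) = ideal_pow J n \<cdot> D"
      using invertible_ideal_dvd[OF Jn(2) us] by blast
    have "ideal_pow J n \<cdot> (A \<cdot> D) = A \<cdot> ((PIdl u) \<cdot> (PIdl s))"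
      unfolding D(2) using Jn(1) Ai D(1) by (rule ideal_prod_lcomm)
    also have "\<dots> = (PIdl s) \<cdot> ((PIdl u) \<cdot> A)"
      using Ai ui si by (simp add: ideal_prod_ac ideal_prod_is_ideal)
    also have "\<dots> = ideal_pow J n \<cdot> ((PIdl s) \<cdot> B)"
      unfolding u(5) using si Jn(1) u(3) by (rule ideal_prod_lcomm)
    finally have AD: "A \<cdot> D = (PIdl s) \<cdot> B"
      using invertible_ideal_cancel_eq[OF Jn(2)] Ai D(1) si u(3) ideal_prod_is_ideal by blast
    have "D \<subseteq> K"
    proof
      fix d assume d: "d \<in> D"
      have dc: "d \<in> carrier R" using d by (rule ideal_carrier[OF D(1)])
      have "x \<otimes> d \<in> PIdl s" if "x \<in> A" for x
        using ideal_prod.prod[OF that d, of R] ideal_prod_subset_left[OF si u(3)] unfolding AD by blast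
      then show "d \<in> K" using dc ideal_carrier[OF Ai] m_comm[of d] by (simp add: K_def)
    qed
    then have "(PIdl s) \<cdot> B \<subseteq> A \<cdot> K" unfolding AD[symmetric] by (intro ideal_prod_mono) auto
    then have "\<forall>x\<in>B. s \<otimes> x \<in> A \<cdot> K" using PIdl_prod_subset_iff[OF u(3) AK s(3)] by blast
    then have "B \<subseteq> T" using ideal_carrier[OF u(3)] s(3) m_comm[of s] by (auto simp: T_def)
    then show False using M(2) u(4) by blast
  qed
  then have "\<one> \<in> T" by simp
  then have "s \<in> A \<cdot> K" using s(3) by (simp add: T_def)
  then have "A \<cdot> K = PIdl s" using sub PIdl_subset_iff[OF AK s(3)] by blast
  then show ?thesis using Ai K s(2) invertible_ideal_iff by blast
qed

text \<open>At \<open>M\<close> the finitely generated \<open>J\<close> and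
  \<open>radical R A\<close> agree up to the multipliers \<open>b\<close> and \<open>u\<close>, so
  \<open>b \<otimes> u\<close> carries the radical into the finitely generated ideal generated by
  \<open>A\<close> and \<open>b J\<close>. \<open>T\<close> collects multipliers of this
  kind.\<close>

lemma fg_radical:
  assumes A: "fg_ideal R A" "regular_ideal R A"
  shows "fg_ideal R (radical R A)"
proof -
  have Ai: "ideal A R" using A fg_ideal_ideal by blast
  have rad: "ideal (radical R A) R" "A \<subseteq> radical R A" "radical_ideal R (radical R A)"
    using Ai by (simp_all add: ideal_radical subset_radical radical_ideal_radical)
  define T where "T = {t \<in> carrier R. \<exists>F. fg_ideal R F \<and> A \<subseteq> F \<and> F \<subseteq> radical R A \<and> (\<forall>x\<in>radical R A. t \<otimes> x \<in> F)}"
  have AT: "A \<subseteq> T"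
  proof
    fix a assume a: "a \<in> A"
    have ac: "a \<in> carrier R" using a by (rule ideal_carrier[OF Ai])
    have "\<forall>x\<in>radical R A. a \<otimes> x \<in> A"
      using ideal.I_r_closed[OF Ai a] ideal_carrier[OF rad(1)] by blast
    then show "a \<in> T" using ac A(1) rad(2) unfolding T_def by blast
  qed
  have T: "ideal T R"
  proof (rule ideal_criterion)
    show "\<zero> \<in> T" using AT ideal_zero_closed[OF Ai] by blast
    fix t t' assume "t \<in> T" "t' \<in> T"
    then obtain F F' where F: "t \<in> carrier R" "t' \<in> carrier R" "fg_ideal R F" "A \<subseteq> F" "F \<subseteq> radical R A"
      "\<forall>x\<in>radical R A. t \<otimes> x \<in> F" "fg_ideal R F'" "A \<subseteq> F'" "F' \<subseteq> radical R A"
      "\<forall>x\<in>radical R A. t' \<otimes> x \<in> F'" unfolding T_def by blast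
    have i: "ideal F R" "ideal F' R" using F fg_ideal_ideal by auto
    have "(t \<oplus> t') \<otimes> x \<in> F <+> F'" if "x \<in> radical R A" for x
    proof -
      have "(t \<oplus> t') \<otimes> x = t \<otimes> x \<oplus> t' \<otimes> x" using F(1,2) ideal_carrier[OF rad(1) that] by (simp add: l_distr)
      then show ?thesis using F(6,10) that by (auto simp: mem_set_add_iff)
    qed
    moreover have "fg_ideal R (F <+> F')" "A \<subseteq> F <+> F'" "F <+> F' \<subseteq> radical R A"
      using F i subset_set_add_left[OF i] rad(1) by (auto simp: set_add_subset_iff fg_ideal_set_add)
    ultimately show "t \<oplus> t' \<in> T" using F(1,2) unfolding T_def by blast
  next
    fix r t assume r: "r \<in> carrier R" and "t \<in> T"
    then obtain F where F: "t \<in> carrier R" "fg_ideal R F" "A \<subseteq> F" "F \<subseteq> radical R A"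
      "\<forall>x\<in>radical R A. t \<otimes> x \<in> F" unfolding T_def by blast
    have "(r \<otimes> t) \<otimes> x \<in> F" if "x \<in> radical R A" for x
      using ideal_mult_closed[OF fg_ideal_ideal[OF F(2)] bspec[OF F(5) that] r]
        r F(1) ideal_carrier[OF rad(1) that] by (simp add: m_assoc)
    then show "r \<otimes> t \<in> T" using r F unfolding T_def by blast
  qed (auto simp: T_def)
  have "T = carrier R"
  proof (rule ccontr)
    assume "T \<noteq> carrier R"
    then obtain M where M: "M \<in> max_reg R" "T \<subseteq> M"
      using exists_max_reg[OF regular_ideal_mono[OF A(2) T AT]] by blast
    note MD = max_regD[OF M(1)]
    obtain J where J: "uniformizer M J" using exists_uniformizer[OF M(1)] by blast
    note JD = uniformizerD[OF J]
    obtain u n B where u: "u \<in> carrier R" "u \<notin> M" "ideal B R" "\<not> B \<subseteq> M"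
      "(PIdl u) \<cdot> A = ideal_pow J n \<cdot> B" using J A by (rule local_factorization)
    have ui: "ideal (PIdl u) R" using u(1) by (rule cgenideal_ideal)
    have Jn: "ideal (ideal_pow J n) R" using JD(5) by (rule ideal_ideal_pow)
    have uA: "(PIdl u) \<cdot> A \<subseteq> A" using ui Ai by (rule ideal_prod_subset_right)
    \<comment> \<open>With \<open>n = 0\<close> the cofactor \<open>B\<close> would equal
      \<open>u A\<close> and lie in \<open>A \<subseteq> T \<subseteq> M\<close>. Positivity makes
      the power of \<open>J\<close> lie in \<open>J\<close>, as \<open>urad\<close>
      requires.\<close>
    have n: "n \<ge> 1"
    proof (rule ccontr)
      assume "\<not> n \<ge> 1"
      then have "n = 0" by simp
      then have "(PIdl u) \<cdot> A = B" using u(3,5) by (simp add: ideal_prod_carrier)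
      then show False using uA AT M(2) u(4) by blast
    qed
    obtain b where b: "b \<in> B" "b \<notin> M" using u(4) by blast
    have bc: "b \<in> carrier R" using b(1) by (rule ideal_carrier[OF u(3)])
    have bJ: "b \<otimes> x \<in> radical R A" if x: "x \<in> J" for x
    proof -
      have xc: "x \<in> carrier R" using x by (rule ideal_carrier[OF JD(5)])
      have "x [^] n \<otimes> b \<in> ideal_pow J n \<cdot> B"
        using power_mem_ideal_pow[OF JD(5) x] b(1) by (rule ideal_prod.prod)
      then have "b \<otimes> x [^] n \<in> radical R A"
        using u(5) uA rad(2) m_comm[OF bc nat_pow_closed[OF xc]] by auto
      then show ?thesis by (rule radical_ideal_mult_power[OF rad(3) bc xc])
    qed
    have urad: "u \<otimes> x \<in> J" if x: "x \<in> radical R A" for x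
    proof -
      obtain m :: nat where m: "x \<in> carrier R" "x [^] m \<in> A" using x by (auto simp: radical_def)
      have "u \<otimes> x [^] m \<in> (PIdl u) \<cdot> A" using cgenideal_self[OF u(1)] m(2) by (rule ideal_prod.prod)
      then have "u \<otimes> x [^] m \<in> J"
        using u(5) ideal_prod_subset_left[OF Jn u(3)] ideal_pow_subset[OF JD(5) n] by auto
      then show ?thesis by (rule radical_ideal_mult_power[OF JD(3) u(1) m(1)])
    qed
    have bi: "ideal (PIdl b) R" using bc by (rule cgenideal_ideal)
    have bJi: "ideal ((PIdl b) \<cdot> J) R" using bi JD(5) by (rule ideal_prod_is_ideal)
    define F where "F = A <+> (PIdl b) \<cdot> J"
    have "fg_ideal R F" unfolding F_def
      using A(1) bc JD(6) fg_ideal_set_add fg_ideal_prod fg_ideal_PIdl by blast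
    moreover have "A \<subseteq> F" unfolding F_def using Ai bJi by (rule subset_set_add_left)
    moreover have "F \<subseteq> radical R A"
      unfolding F_def set_add_subset_iff[OF Ai bJi rad(1)] PIdl_prod_subset_iff[OF JD(5) rad(1) bc]
      using rad(2) bJ by blast
    moreover have "(b \<otimes> u) \<otimes> x \<in> F" if x: "x \<in> radical R A" for x
    proof -
      have "b \<otimes> (u \<otimes> x) \<in> (PIdl b) \<cdot> J" using cgenideal_self[OF bc] urad[OF x] by (rule ideal_prod.prod)
      then have "b \<otimes> (u \<otimes> x) \<in> F" unfolding F_def using subset_set_add_right[OF Ai bJi] by blast
      then show ?thesis using bc u(1) ideal_carrier[OF rad(1) x] by (simp add: m_assoc)
    qed
    ultimately have "b \<otimes> u \<in> T" using bc u(1) unfolding T_def by blast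
    then show False using M(2) primeideal_mult_notin[OF MD(3) bc u(1) b(2) u(2)] by blast
  qed
  then have "\<one> \<in> T" by simp
  then obtain F where F: "fg_ideal R F" "F \<subseteq> radical R A" "\<forall>x\<in>radical R A. \<one> \<otimes> x \<in> F"
    unfolding T_def by blast
  then have "radical R A = F" using ideal_carrier[OF rad(1)] by auto
  then show ?thesis using F(1) by simp
qed

lemma invertible_radical:
  assumes "fg_ideal R A" "regular_ideal R A"
  shows "invertible_ideal R (radical R A)"
proof -
  have Ai: "ideal A R" using assms fg_ideal_ideal by blast
  show ?thesis
    using fg_regular_invertible[OF fg_radical[OF assms]]
      regular_ideal_mono[OF assms(2) ideal_radical[OF Ai] subset_radical[OF Ai]] by blast
qed

subsection \<open>Properties of the order\<close>

text \<open>Factoring the principal ideal of a nonzerodivisor of \<open>I\<close> puts power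
  \<open>n\<close> of \<open>J\<close> into \<open>I\<close> up to a multiplier outside
  \<open>M\<close>, so \<open>I\<close> cannot lie in power \<open>n + 1\<close> of
  \<open>M\<close>.\<close>

lemma exists_not_subset_pow:
  assumes I: "regular_ideal R I" and M: "M \<in> max_reg R"
  shows "\<exists>n. \<not> I \<subseteq> ideal_pow M (Suc n)"
proof -
  note MD = max_regD[OF M]
  obtain s where s: "PIdl s \<subseteq> I" "regular_ideal R (PIdl s)" "fg_ideal R (PIdl s)"
    using I by (rule regular_ideal_obtains_nonzerodivisor)
  have si: "ideal (PIdl s) R" using s(2) regular_ideal_ideal by blast
  obtain J where J: "uniformizer M J" using exists_uniformizer[OF M] by blast
  obtain u n B where u: "u \<in> carrier R" "u \<notin> M" "ideal B R" "\<not> B \<subseteq> M"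
    "(PIdl u) \<cdot> (PIdl s) = ideal_pow J n \<cdot> B" using J s(3,2) by (rule local_factorization)
  obtain b where b: "b \<in> B" "b \<notin> M" using u(4) by blast
  have bc: "b \<in> carrier R" using b(1) by (rule ideal_carrier[OF u(3)])
  have Jn: "ideal (ideal_pow J n) R" using uniformizerD(5)[OF J] by (rule ideal_ideal_pow)
  have bJ: "b \<otimes> x \<in> I" if x: "x \<in> ideal_pow J n" for x
  proof -
    have "x \<otimes> b \<in> ideal_pow J n \<cdot> B" using x b(1) by (rule ideal_prod.prod)
    then show ?thesis
      using u(5) s(1) ideal_prod_subset_right[OF cgenideal_ideal[OF u(1)] si]
        m_comm[OF bc ideal_carrier[OF Jn x]] by auto
  qed
  have "\<not> I \<subseteq> ideal_pow M (Suc n)"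
  proof
    assume "I \<subseteq> ideal_pow M (Suc n)"
    then have "Suc n \<le> n" using uniformizer_power_bound[OF J bc b(2), of n "Suc n"] bJ by blast
    then show False by simp
  qed
  then show ?thesis by blast
qed

lemma subset_pow_iff:
  assumes I: "regular_ideal R I" and M: "M \<in> max_reg R"
  shows "I \<subseteq> ideal_pow M k \<longleftrightarrow> k \<le> ideal_order I M"
proof
  assume sub: "I \<subseteq> ideal_pow M k"
  show "k \<le> ideal_order I M"
  proof (rule ccontr)
    assume "\<not> k \<le> ideal_order I M"
    then have "I \<subseteq> ideal_pow M (Suc (ideal_order I M))"
      using sub ideal_pow_antimono[OF max_regD(4)[OF M], of "Suc (ideal_order I M)" k] by auto
    then show False
      using LeastI_ex[OF exists_not_subset_pow[OF I M]] unfolding ideal_order_def by blast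
  qed
next
  assume "k \<le> ideal_order I M"
  show "I \<subseteq> ideal_pow M k"
  proof (cases k)
    case 0
    then show ?thesis using ideal_subset_carrier[OF regular_ideal_ideal[OF I]] by simp
  next
    case (Suc j)
    then have "j < ideal_order I M" using \<open>k \<le> _\<close> by simp
    then show ?thesis using not_less_Least Suc unfolding ideal_order_def by blast
  qed
qed

lemma ideal_order_pos_iff:
  assumes "regular_ideal R I" "M \<in> max_reg R"
  shows "1 \<le> ideal_order I M \<longleftrightarrow> I \<subseteq> M"
  using subset_pow_iff[OF assms, of 1] ideal_pow_1[OF max_regD(4)[OF assms(2)]] by simp

lemma ideal_order_antimono:
  assumes "regular_ideal R I" "regular_ideal R I'" "M \<in> max_reg R" "I \<subseteq> I'"
  shows "ideal_order I' M \<le> ideal_order I M"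
  using subset_pow_iff[OF assms(1,3), of "ideal_order I' M"]
    subset_pow_iff[OF assms(2,3), of "ideal_order I' M"] assms(4) by blast

text \<open>Some \<open>y \<in> I\<close> lies outside the next power of \<open>M\<close>. For a
  finitely generated regular \<open>A \<subseteq> I\<close> containing \<open>y\<close>, the
  exponent \<open>m\<close> of the local factorization cannot exceed the order, because
  \<open>y\<close> lies in power \<open>m\<close> of \<open>M\<close>. Thus \<open>I\<close> is
  locally a power of \<open>J\<close>.\<close>

lemma ideal_order_denominator:
  assumes I: "regular_ideal R I" and J: "uniformizer M J"
  obtains b where "b \<in> carrier R" "b \<notin> M" "\<And>x. x \<in> ideal_pow J (ideal_order I M) \<Longrightarrow> b \<otimes> x \<in> I"
proof -
  note JD = uniformizerD[OF J]
  note MD = max_regD[OF JD(1)]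
  let ?n = "ideal_order I M"
  have "\<not> I \<subseteq> ideal_pow M (Suc ?n)" using subset_pow_iff[OF I JD(1), of "Suc ?n"] by simp
  then obtain y where y: "y \<in> I" "y \<notin> ideal_pow M (Suc ?n)" by blast
  have yc: "y \<in> carrier R" using y(1) by (rule ideal_carrier[OF regular_ideal_ideal[OF I]])
  obtain A where A: "regular_ideal R A" "fg_ideal R A" "y \<in> A" "A \<subseteq> I"
    using I y(1) by (rule regular_ideal_obtains_fg)
  have Ai: "ideal A R" using A fg_ideal_ideal by blast
  obtain u m B where u: "u \<in> carrier R" "u \<notin> M" "ideal B R" "\<not> B \<subseteq> M"
    "(PIdl u) \<cdot> A = ideal_pow J m \<cdot> B" using J A(2,1) by (rule local_factorization)
  have Jm: "ideal (ideal_pow J k) R" for k using JD(5) by (rule ideal_ideal_pow)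
  have "u \<otimes> y \<in> (PIdl u) \<cdot> A" using cgenideal_self[OF u(1)] A(3) by (rule ideal_prod.prod)
  then have "u \<otimes> y \<in> ideal_pow M m"
    using u(5) ideal_prod_subset_left[OF Jm u(3)] ideal_pow_mono[OF JD(4)] by blast
  then have ym: "y \<in> ideal_pow M m" by (rule ideal_pow_maximal_primary[OF MD(1) u(1,2) yc])
  have "m \<le> ?n"
  proof (rule ccontr)
    assume "\<not> m \<le> ?n"
    then show False using ym y(2) ideal_pow_antimono[OF MD(4), of "Suc ?n" m] by auto
  qed
  obtain b where b: "b \<in> B" "b \<notin> M" using u(4) by blast
  have bc: "b \<in> carrier R" using b(1) by (rule ideal_carrier[OF u(3)])
  have "b \<otimes> x \<in> I" if x: "x \<in> ideal_pow J ?n" for x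
  proof -
    have "x \<in> ideal_pow J m" using x ideal_pow_antimono[OF JD(5) \<open>m \<le> ?n\<close>] by blast
    then have "x \<otimes> b \<in> ideal_pow J m \<cdot> B" using b(1) by (rule ideal_prod.prod)
    then show ?thesis
      using u(5) A(4) ideal_prod_subset_right[OF cgenideal_ideal[OF u(1)] Ai]
        m_comm[OF bc ideal_carrier[OF Jm x]] by auto
  qed
  then show ?thesis using that bc b(2) by blast
qed

text \<open>For \<open>x \<in> I\<close> the conductor \<open>T\<close> of \<open>x\<close> into
  \<open>I'\<close> contains \<open>I'\<close>, hence is regular. At each \<open>M\<close> the
  element \<open>x\<close> is carried first into the power of \<open>J\<close> given by the order of
  \<open>I'\<close>, then into \<open>I'\<close>.\<close>

lemma subset_if_ideal_order_le:
  assumes I: "regular_ideal R I" and I': "regular_ideal R I'"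
    and le: "\<And>M. M \<in> max_reg R \<Longrightarrow> ideal_order I' M \<le> ideal_order I M"
  shows "I \<subseteq> I'"
proof
  fix x assume x: "x \<in> I"
  have i: "ideal I R" "ideal I' R" using I I' regular_ideal_ideal by auto
  have xc: "x \<in> carrier R" using x by (rule ideal_carrier[OF i(1)])
  define T where "T = {r \<in> carrier R. \<forall>y\<in>{x}. r \<otimes> y \<in> I'}"
  have T: "ideal T R" unfolding T_def using i(2) xc by (intro ideal_colon) auto
  have "I' \<subseteq> T"
    using ideal.I_r_closed[OF i(2) _ xc] ideal_subset_carrier[OF i(2)] by (auto simp: T_def)
  then have Treg: "regular_ideal R T" using regular_ideal_mono[OF I' T] by blast
  have "T = carrier R"
  proof (rule ccontr)
    assume "T \<noteq> carrier R"
    then obtain M where M: "M \<in> max_reg R" "T \<subseteq> M" using exists_max_reg[OF Treg] by blast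
    obtain J where J: "uniformizer M J" using exists_uniformizer[OF M(1)] by blast
    let ?n = "ideal_order I' M"
    have Jn: "ideal (ideal_pow J ?n) R" using uniformizerD(5)[OF J] by (rule ideal_ideal_pow)
    obtain b where b: "b \<in> carrier R" "b \<notin> M" "\<And>x. x \<in> ideal_pow J ?n \<Longrightarrow> b \<otimes> x \<in> I'"
      using I' J by (rule ideal_order_denominator) blast
    have "I \<subseteq> ideal_pow M ?n" using subset_pow_iff[OF I M(1)] le[OF M(1)] by blast
    then obtain u where u: "u \<in> carrier R - M" "u \<otimes> x \<in> ideal_pow J ?n"
      using uniformizer_power_denominator[OF J] x by blast
    have "(b \<otimes> u) \<otimes> x \<in> I'" using b(3)[OF u(2)] b(1) u(1) xc by (simp add: m_assoc)
    then have "b \<otimes> u \<in> T" using b(1) u(1) by (simp add: T_def)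
    then show False
      using M(2) primeideal_mult_notin[OF max_regD(3)[OF M(1)] b(1) _ b(2)] u(1) by blast
  qed
  then have "\<one> \<in> T" by simp
  then show "x \<in> I'" using xc by (simp add: T_def)
qed

lemma eq_if_ideal_order_eq:
  assumes "regular_ideal R I" "regular_ideal R I'"
    and "\<And>M. M \<in> max_reg R \<Longrightarrow> ideal_order I M = ideal_order I' M"
  shows "I = I'"
  using subset_if_ideal_order_le[OF assms(1,2)] subset_if_ideal_order_le[OF assms(2,1)] assms(3) by auto

text \<open>Containments in powers of \<open>M\<close> multiply, which is the lower bound; the
  denominators \<open>b\<close> and \<open>c\<close> multiply, which gives the upper bound through
  \<open>uniformizer_power_bound\<close>.\<close>

lemma ideal_order_prod:
  assumes I: "regular_ideal R I" and I': "regular_ideal R I'" and M: "M \<in> max_reg R"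
  shows "ideal_order (I \<cdot> I') M = ideal_order I M + ideal_order I' M"
proof (rule antisym)
  let ?a = "ideal_order I M" and ?b = "ideal_order I' M"
  note MD = max_regD[OF M]
  have i: "ideal I R" "ideal I' R" using I I' regular_ideal_ideal by auto
  have II': "regular_ideal R (I \<cdot> I')" using I I' by (rule regular_ideal_prod)
  have II'i: "ideal (I \<cdot> I') R" using i by (rule ideal_prod_is_ideal)
  have "I \<subseteq> ideal_pow M ?a" "I' \<subseteq> ideal_pow M ?b"
    using subset_pow_iff[OF I M] subset_pow_iff[OF I' M] by auto
  then have "I \<cdot> I' \<subseteq> ideal_pow M (?a + ?b)"
    unfolding ideal_pow_add[OF MD(4)] by (rule ideal_prod_mono)
  then show "?a + ?b \<le> ideal_order (I \<cdot> I') M" using subset_pow_iff[OF II' M] by blast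
  obtain J where J: "uniformizer M J" using exists_uniformizer[OF M] by blast
  have Jn: "ideal (ideal_pow J k) R" for k using uniformizerD(5)[OF J] by (rule ideal_ideal_pow)
  obtain b where b: "b \<in> carrier R" "b \<notin> M" "\<And>x. x \<in> ideal_pow J ?a \<Longrightarrow> b \<otimes> x \<in> I"
    using I J by (rule ideal_order_denominator) blast
  obtain c where c: "c \<in> carrier R" "c \<notin> M" "\<And>x. x \<in> ideal_pow J ?b \<Longrightarrow> c \<otimes> x \<in> I'"
    using I' J by (rule ideal_order_denominator) blast
  have bc: "ideal (PIdl b) R" "ideal (PIdl c) R" using b(1) c(1) cgenideal_ideal by auto
  have "(PIdl b) \<cdot> ideal_pow J ?a \<subseteq> I" "(PIdl c) \<cdot> ideal_pow J ?b \<subseteq> I'"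
    using PIdl_prod_subset_iff[OF Jn i(1) b(1)] PIdl_prod_subset_iff[OF Jn i(2) c(1)] b(3) c(3) by auto
  then have "((PIdl b) \<cdot> ideal_pow J ?a) \<cdot> ((PIdl c) \<cdot> ideal_pow J ?b) \<subseteq> I \<cdot> I'"
    by (rule ideal_prod_mono)
  also have "((PIdl b) \<cdot> ideal_pow J ?a) \<cdot> ((PIdl c) \<cdot> ideal_pow J ?b) =
      ((PIdl b) \<cdot> (PIdl c)) \<cdot> (ideal_pow J ?a \<cdot> ideal_pow J ?b)"
    using bc Jn[of ?a] Jn[of ?b] by (simp add: ideal_prod_ac ideal_prod_is_ideal)
  finally have "(PIdl (b \<otimes> c)) \<cdot> ideal_pow J (?a + ?b) \<subseteq> I \<cdot> I'"
    using PIdl_prod[OF b(1) c(1)] ideal_pow_add[OF uniformizerD(5)[OF J]] by simp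
  then have "(b \<otimes> c) \<otimes> x \<in> I \<cdot> I'" if "x \<in> ideal_pow J (?a + ?b)" for x
    using PIdl_prod_subset_iff[OF Jn II'i] b(1) c(1) that by blast
  moreover have "I \<cdot> I' \<subseteq> ideal_pow M (ideal_order (I \<cdot> I') M)" using subset_pow_iff[OF II' M] by blast
  moreover have "b \<otimes> c \<in> carrier R" "b \<otimes> c \<notin> M"
    using primeideal_mult_notin[OF MD(3)] b c by auto
  ultimately show "ideal_order (I \<cdot> I') M \<le> ?a + ?b"
    using uniformizer_power_bound[OF J] by blast
qed

lemma ideal_order_carrier:
  assumes "M \<in> max_reg R"
  shows "ideal_order (carrier R) M = 0"
  using ideal_order_pos_iff[OF regular_ideal_carrier assms] primeideal_one_notin[OF max_regD(3)[OF assms]]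
  by auto

lemma ideal_order_product_of_ideals:
  assumes M: "M \<in> max_reg R" and Js: "\<And>J. J \<in> set Js \<Longrightarrow> regular_ideal R J"
  shows "ideal_order (product_of_ideals R Js) M = (\<Sum>J\<leftarrow>Js. ideal_order J M)"
  using Js
  by (induction Js)
     (auto simp: ideal_order_carrier[OF M] regular_product_of_ideals ideal_order_prod[OF _ _ M])

text \<open>Locally \<open>I\<close> contains the power of \<open>J\<close> given by its order,
  hence \<open>J\<close> itself by radicality. As \<open>I\<close> lies in that same power of
  \<open>M\<close>, the order is at most 1.\<close>

lemma ideal_order_radical_ideal:
  assumes I: "regular_ideal R I" "radical_ideal R I" and M: "M \<in> max_reg R"
  shows "ideal_order I M = (if I \<subseteq> M then 1 else 0)"
proof -
  have "ideal_order I M \<le> 1"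
  proof (cases "ideal_order I M")
    case (Suc n)
    obtain J where J: "uniformizer M J" using exists_uniformizer[OF M] by blast
    have Ji: "ideal J R" using J by (rule uniformizerD)
    obtain b where b: "b \<in> carrier R" "b \<notin> M" "\<And>x. x \<in> ideal_pow J (ideal_order I M) \<Longrightarrow> b \<otimes> x \<in> I"
      using I(1) J by (rule ideal_order_denominator) blast
    have "b \<otimes> x \<in> ideal_pow M (ideal_order I M)" if "x \<in> ideal_pow J 1" for x
    proof -
      have x: "x \<in> J" using that ideal_pow_1[OF Ji] by simp
      then have "b \<otimes> x [^] ideal_order I M \<in> I" using b(3) power_mem_ideal_pow[OF Ji] by blast
      then have "b \<otimes> x \<in> I"
        by (rule radical_ideal_mult_power[OF I(2) b(1) ideal_carrier[OF Ji x]])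
      then show ?thesis using subset_pow_iff[OF I(1) M] by blast
    qed
    then show ?thesis using uniformizer_power_bound[OF J b(1,2)] by blast
  qed simp
  then show ?thesis using ideal_order_pos_iff[OF I(1) M] by auto
qed

subsection \<open>Factorization into radical ideals\<close>

lemma radical_level_ideal: "radical_ideal R (level_ideal I k)"
  unfolding level_ideal_def using max_regD(3) by (intro radical_ideal_Inter_primes) blast

lemma level_ideal_mono: "k \<le> l \<Longrightarrow> level_ideal I k \<subseteq> level_ideal I l"
  by (auto simp: level_ideal_def)

lemma regular_level_ideal:
  assumes I: "regular_ideal R I" and k: "k \<ge> 1"
  shows "regular_ideal R (level_ideal I k)"
proof (rule regular_ideal_mono[OF I radical_ideal_ideal[OF radical_level_ideal]])
  have "I \<subseteq> M" if "M \<in> max_reg R" "k \<le> ideal_order I M" for M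
    using ideal_order_pos_iff[OF I that(1)] that(2) k by simp
  then show "I \<subseteq> level_ideal I k"
    using ideal_subset_carrier[OF regular_ideal_ideal[OF I]] by (auto simp: level_ideal_def)
qed

text \<open>If \<open>k\<close> exceeds the order at \<open>M\<close>, an element of the level ideal
  outside \<open>M\<close> is needed. A finitely generated \<open>A \<subseteq> I\<close> of order
  below \<open>k\<close> at \<open>M\<close> has an invertible radical \<open>J\<close>, a
  uniformizer at all regular maximal ideals over \<open>A\<close> at once. The multiplier
  \<open>b\<close> that carries the right power of \<open>J\<close> into \<open>A\<close> at
  \<open>M\<close> lies in every \<open>M'\<close> of the level, since \<open>b \<notin> M'\<close>
  would bound \<open>k\<close> by the order of \<open>A\<close> at \<open>M\<close>.\<close>

lemma level_ideal_subset_iff: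
  assumes I: "regular_ideal R I" and k: "k \<ge> 1" and M: "M \<in> max_reg R"
  shows "level_ideal I k \<subseteq> M \<longleftrightarrow> k \<le> ideal_order I M"
proof
  show "k \<le> ideal_order I M \<Longrightarrow> level_ideal I k \<subseteq> M" using M by (auto simp: level_ideal_def)
  assume sub: "level_ideal I k \<subseteq> M"
  show "k \<le> ideal_order I M"
  proof (rule ccontr)
    assume "\<not> k \<le> ideal_order I M"
    then have "\<not> I \<subseteq> ideal_pow M k" using subset_pow_iff[OF I M] by blast
    then obtain y where y: "y \<in> I" "y \<notin> ideal_pow M k" by blast
    obtain A where A: "regular_ideal R A" "fg_ideal R A" "y \<in> A" "A \<subseteq> I"
      using I y(1) by (rule regular_ideal_obtains_fg)
    have Ai: "ideal A R" using A fg_ideal_ideal by blast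
    have A_order: "ideal_order A M < k" using subset_pow_iff[OF A(1) M, of k] A(3) y(2) by auto
    have A_level: "A \<subseteq> ideal_pow M' k" if "M' \<in> max_reg R" "k \<le> ideal_order I M'" for M'
      using subset_pow_iff[OF I that(1)] that(2) A(4) by blast
    have A_max: "A \<subseteq> M'" if "M' \<in> max_reg R" "k \<le> ideal_order I M'" for M'
      using A_level[OF that] ideal_pow_subset[OF max_regD(4)[OF that(1)] k] by blast
    then have "A \<subseteq> level_ideal I k" using ideal_subset_carrier[OF Ai] by (auto simp: level_ideal_def)
    then have "A \<subseteq> M" using sub by blast
    define J where "J = radical R A"
    have J: "uniformizer M' J" if "M' \<in> max_reg R" "A \<subseteq> M'" for M'
      unfolding uniformizer_def J_def
      using invertible_radical[OF A(2,1)] radical_ideal_radical[OF Ai]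
        radical_subset_prime[OF max_regD(3)[OF that(1)] that(2)] that(1) by blast
    obtain b where b: "b \<in> carrier R" "b \<notin> M" "\<And>x. x \<in> ideal_pow J (ideal_order A M) \<Longrightarrow> b \<otimes> x \<in> A"
      using A(1) J[OF M \<open>A \<subseteq> M\<close>] by (rule ideal_order_denominator) blast
    have "b \<in> M'" if M': "M' \<in> max_reg R" "k \<le> ideal_order I M'" for M'
    proof (rule ccontr)
      assume "b \<notin> M'"
      then have "k \<le> ideal_order A M"
        using uniformizer_power_bound[OF J[OF M'(1) A_max[OF M']] b(1)] b(3) A_level[OF M'] by blast
      then show False using A_order by simp
    qed
    then have "b \<in> level_ideal I k" using b(1) by (auto simp: level_ideal_def)
    then show False using sub b(2) by blast
  qed
qed

text \<open>The radical \<open>J\<close> of \<open>sR\<close> is finitely generated, so its power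
  \<open>N\<close> lies in \<open>sR\<close> for some \<open>N\<close>. As \<open>J\<close> is a
  uniformizer at every regular maximal ideal over \<open>I\<close>, this one \<open>N\<close> bounds
  all orders.\<close>

lemma ideal_order_bounded:
  assumes I: "regular_ideal R I"
  shows "\<exists>N. \<forall>M\<in>max_reg R. ideal_order I M \<le> N"
proof -
  obtain s where s: "PIdl s \<subseteq> I" "regular_ideal R (PIdl s)" "fg_ideal R (PIdl s)"
    using I by (rule regular_ideal_obtains_nonzerodivisor)
  have si: "ideal (PIdl s) R" using s(2) regular_ideal_ideal by blast
  define J where "J = radical R (PIdl s)"
  have J: "invertible_ideal R J" unfolding J_def using s(3,2) by (rule invertible_radical)
  \<comment> \<open>With the trivial submonoid, \<open>fg_ideal_uniform_power\<close> becomes a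
    statement without multipliers.\<close>
  have "submonoid {\<one>} R" by (intro submonoid.intro) auto
  moreover have "\<forall>x\<in>J. \<exists>u\<in>{\<one>}. \<exists>n::nat. u \<otimes> x [^] n \<in> PIdl s"
    unfolding J_def radical_def by auto
  ultimately obtain N where N: "\<forall>x\<in>ideal_pow J N. \<one> \<otimes> x \<in> PIdl s"
    using fg_ideal_uniform_power[OF invertible_ideal_fg[OF J] _ si] by blast
  have "ideal_order I M \<le> N" if M: "M \<in> max_reg R" for M
  proof (cases "I \<subseteq> M")
    case True
    then have "J \<subseteq> M" unfolding J_def using s(1) by (intro radical_subset_prime max_regD(3)[OF M]) auto
    then have "uniformizer M J"
      unfolding uniformizer_def using M J radical_ideal_radical[OF si] by (simp add: J_def)
    moreover have "I \<subseteq> ideal_pow M (ideal_order I M)" using subset_pow_iff[OF I M] by blast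
    ultimately show ?thesis
      using uniformizer_power_bound[OF _ one_closed primeideal_one_notin[OF max_regD(3)[OF M]]] N s(1)
      by blast
  next
    case False
    then show ?thesis using ideal_order_pos_iff[OF I M] by simp
  qed
  then show ?thesis by blast
qed

text \<open>Both sides have the same orders: level \<open>k\<close> is radical and contributes 1
  exactly when \<open>k \<le> ideal_order I M\<close>. The range starts at 1 because level 0 would
  involve all of \<open>max_reg R\<close>.\<close>

lemma eq_product_of_level_ideals:
  assumes I: "regular_ideal R I" and N: "\<And>M. M \<in> max_reg R \<Longrightarrow> ideal_order I M \<le> N"
  shows "I = product_of_ideals R (map (level_ideal I) [1..<Suc N])"
proof (rule eq_if_ideal_order_eq[OF I])
  let ?Js = "map (level_ideal I) [1..<Suc N]"
  have reg: "regular_ideal R J" if "J \<in> set ?Js" for J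
    using that regular_level_ideal[OF I] by auto
  then show "regular_ideal R (product_of_ideals R ?Js)" by (rule regular_product_of_ideals)
  fix M assume M: "M \<in> max_reg R"
  have "ideal_order (level_ideal I k) M = (if k \<le> ideal_order I M then 1 else 0)" if "k \<ge> 1" for k
    using ideal_order_radical_ideal[OF regular_level_ideal[OF I that] radical_level_ideal M]
      level_ideal_subset_iff[OF I that M] by simp
  then have "(\<Sum>J\<leftarrow>?Js. ideal_order J M) = (\<Sum>k\<leftarrow>[1..<Suc N]. if k \<le> ideal_order I M then 1 else 0)"
    unfolding map_map by (intro arg_cong[where f = sum_list] map_cong) auto
  then show "ideal_order I M = ideal_order (product_of_ideals R ?Js) M"
    using ideal_order_product_of_ideals[OF M reg] N[OF M] by (simp only: sum_list_threshold min_absorb1)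
qed

lemma product_of_ideals_filter:
  "(\<And>J. J \<in> set Js \<Longrightarrow> ideal J R) \<Longrightarrow>
     product_of_ideals R (filter (\<lambda>J. J \<noteq> carrier R) Js) = product_of_ideals R Js"
  by (induction Js) (auto simp: ideal_prod_carrier ideal_product_of_ideals)

lemma exists_radical_chain:
  assumes I: "regular_ideal R I"
  shows "\<exists>Js. (\<forall>J\<in>set Js. radical_ideal R J \<and> J \<noteq> carrier R) \<and> sorted_wrt (\<subseteq>) Js \<and>
    I = product_of_ideals R Js"
proof -
  obtain N where N: "\<And>M. M \<in> max_reg R \<Longrightarrow> ideal_order I M \<le> N" using ideal_order_bounded[OF I] by blast
  define Js where "Js = map (level_ideal I) [1..<Suc N]"
  have rad: "radical_ideal R J" if "J \<in> set Js" for J using that radical_level_ideal by (auto simp: Js_def)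
  have "sorted_wrt (\<lambda>k l. level_ideal I k \<subseteq> level_ideal I l) [1..<Suc N]"
    using sorted_wrt_upt by (rule sorted_wrt_mono_rel[rotated]) (simp add: level_ideal_mono)
  then have "sorted_wrt (\<subseteq>) (filter (\<lambda>J. J \<noteq> carrier R) Js)"
    unfolding Js_def by (intro sorted_wrt_filter) (simp add: sorted_wrt_map)
  moreover have "I = product_of_ideals R (filter (\<lambda>J. J \<noteq> carrier R) Js)"
    using eq_product_of_level_ideals[OF I N] product_of_ideals_filter[of Js] rad radical_ideal_ideal
    unfolding Js_def by metis
  ultimately show ?thesis using rad by (intro exI[of _ "filter (\<lambda>J. J \<noteq> carrier R) Js"]) auto
qed

text \<open>Orders add under products and determine a regular ideal, so cancellation reduces to
  natural numbers.\<close>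

lemma regular_ideal_cancel:
  assumes "regular_ideal R I" "regular_ideal R A" "regular_ideal R B" "I \<cdot> A = I \<cdot> B"
  shows "A = B"
proof (rule eq_if_ideal_order_eq[OF assms(2,3)])
  fix M assume M: "M \<in> max_reg R"
  show "ideal_order A M = ideal_order B M"
    using ideal_order_prod[OF assms(1,2) M] ideal_order_prod[OF assms(1,3) M] assms(4) by simp
qed

text \<open>Every factor of the first chain contains \<open>J\<close>, so a power of
  \<open>J\<close> lies in the product and hence in the radical ideal \<open>K\<close>. Used in both
  directions, this recovers the first factor of a chain from the product.\<close>

lemma radical_chain_head_subset:
  assumes J: "radical_ideal R J" and Js: "\<And>L. L \<in> set Js \<Longrightarrow> radical_ideal R L" "\<And>L. L \<in> set Js \<Longrightarrow> J \<subseteq> L"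
    and K: "radical_ideal R K" and Ks: "\<And>L. L \<in> set Ks \<Longrightarrow> radical_ideal R L"
    and eq: "product_of_ideals R (J # Js) = product_of_ideals R (K # Ks)"
  shows "J \<subseteq> K"
proof
  fix x assume x: "x \<in> J"
  have Ji: "ideal J R" and Ki: "ideal K R" using J K radical_ideal_ideal by auto
  have "ideal_pow J (length Js) \<subseteq> product_of_ideals R Js"
    using Js(2)
  proof (induction Js)
    case (Cons L Js)
    then have "J \<cdot> ideal_pow J (length Js) \<subseteq> L \<cdot> product_of_ideals R Js"
      by (intro ideal_prod_mono) simp_all
    then show ?case by simp
  qed simp
  then have "ideal_pow J (Suc (length Js)) \<subseteq> product_of_ideals R (K # Ks)"
    unfolding eq[symmetric] unfolding replicate_Suc product_of_ideals_Cons
    by (intro ideal_prod_mono) simp_all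
  also have "\<dots> \<subseteq> K"
    using product_of_ideals_subset[of "K # Ks" K] K Ks radical_ideal_ideal by auto
  finally have "x [^] Suc (length Js) \<in> K" using power_mem_ideal_pow[OF Ji x] by blast
  then show "x \<in> K"
    using radical_idealD[OF K ideal_carrier[OF Ji x], of "Suc (length Js)"] by simp
qed

lemma radical_chain_unique:
  assumes "\<And>J. J \<in> set Js \<Longrightarrow> radical_ideal R J \<and> J \<noteq> carrier R" "sorted_wrt (\<subseteq>) Js"
    and "\<And>J. J \<in> set Ks \<Longrightarrow> radical_ideal R J \<and> J \<noteq> carrier R" "sorted_wrt (\<subseteq>) Ks"
    and "product_of_ideals R Js = product_of_ideals R Ks" "regular_ideal R (product_of_ideals R Js)"
  shows "Js = Ks"
  using assms
proof (induction Js arbitrary: Ks)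
  case Nil
  show ?case
  proof (cases Ks)
    case (Cons K Ks')
    have "ideal J R" if "J \<in> set Ks" for J using Nil(3)[OF that] radical_ideal_ideal by blast
    then have "carrier R \<subseteq> K" using Nil(5) product_of_ideals_subset[of Ks K] Cons by simp
    then show ?thesis using Nil(3)[of K] Cons ideal_subset_carrier radical_ideal_ideal by auto
  qed simp
next
  case (Cons J Js)
  have radJ: "radical_ideal R J" "\<And>L. L \<in> set Js \<Longrightarrow> radical_ideal R L" using Cons.prems(1) by auto
  have Ji: "ideal J R" "ideal (product_of_ideals R Js) R"
    using radJ radical_ideal_ideal by (auto intro!: ideal_product_of_ideals)
  show ?case
  proof (cases Ks)
    case Nil
    then have "carrier R \<subseteq> J" using Cons.prems(5) ideal_prod_subset_left[OF Ji] by simp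
    then show ?thesis using Cons.prems(1)[of J] ideal_subset_carrier[OF Ji(1)] by auto
  next
    case (Cons K Ks')
    have radK: "radical_ideal R K" "\<And>L. L \<in> set Ks' \<Longrightarrow> radical_ideal R L"
      using Cons.prems(3) \<open>Ks = K # Ks'\<close> by auto
    have Ki: "ideal K R" "ideal (product_of_ideals R Ks') R"
      using radK radical_ideal_ideal by (auto intro!: ideal_product_of_ideals)
    have eq: "product_of_ideals R (J # Js) = product_of_ideals R (K # Ks')"
      using Cons.prems(5) \<open>Ks = K # Ks'\<close> by simp
    have "J \<subseteq> K"
      using radJ radK eq Cons.prems(2) by (intro radical_chain_head_subset[of J Js K Ks']) auto
    moreover have "K \<subseteq> J"
      using radJ radK eq[symmetric] Cons.prems(4) \<open>Ks = K # Ks'\<close>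
      by (intro radical_chain_head_subset[of K Ks' J Js]) auto
    ultimately have JK: "J = K" by blast
    have reg: "regular_ideal R (J \<cdot> product_of_ideals R Js)" "regular_ideal R (K \<cdot> product_of_ideals R Ks')"
      using Cons.prems(6) eq by auto
    have "product_of_ideals R Js = product_of_ideals R Ks'"
    proof (rule regular_ideal_cancel)
      show "regular_ideal R K" using regular_ideal_factor(1)[OF reg(2) Ki] .
      show "K \<cdot> product_of_ideals R Js = K \<cdot> product_of_ideals R Ks'" using eq JK by simp
    qed (use regular_ideal_factor[OF reg(1) Ji] regular_ideal_factor[OF reg(2) Ki] in simp_all)
    then have "Js = Ks'"
      using Cons.prems \<open>Ks = K # Ks'\<close> regular_ideal_factor[OF reg(1) Ji] by (intro Cons.IH) auto
    then show ?thesis using JK \<open>Ks = K # Ks'\<close> by simp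
  qed
qed

end

section \<open>The inverse topology\<close>

context cring
begin

abbreviation max_space where "max_space \<equiv> inverse_topology_max_reg R"

lemma exists_fg_regular_subset:
  assumes "M \<in> max_reg R" "x \<in> M"
  shows "\<exists>I. regular_ideal R I \<and> fg_ideal R I \<and> x \<in> I \<and> I \<subseteq> M"
  using regular_ideal_obtains_fg[OF max_regD(2)[OF assms(1)] assms(2)] by metis

lemma topspace_max_space: "topspace max_space = max_reg R"
proof -
  have *: "\<exists>I. regular_ideal R I \<and> fg_ideal R I \<and> I \<subseteq> M" if "M \<in> max_reg R" for M
    using exists_fg_regular_subset[OF that ideal_zero_closed[OF max_regD(4)[OF that]]] by blast
  have "max_reg R \<subseteq> \<Union>{{M \<in> max_reg R. I \<subseteq> M} |I. regular_ideal R I \<and> fg_ideal R I}"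
  proof
    fix M assume M: "M \<in> max_reg R"
    then obtain I where "regular_ideal R I" "fg_ideal R I" "I \<subseteq> M" using * by meson
    then have "M \<in> {M \<in> max_reg R. I \<subseteq> M}"
      "{M \<in> max_reg R. I \<subseteq> M} \<in> {{M \<in> max_reg R. I \<subseteq> M} |I. regular_ideal R I \<and> fg_ideal R I}"
      using M by auto
    then show "M \<in> \<Union>{{M \<in> max_reg R. I \<subseteq> M} |I. regular_ideal R I \<and> fg_ideal R I}" by (rule UnionI[rotated])
  qed
  then show ?thesis
    unfolding inverse_topology_max_reg_def topology_generated_by_topspace by (intro antisym) auto
qed

lemma openin_max_space_basic:
  assumes "regular_ideal R I" "fg_ideal R I"
  shows "openin max_space {M \<in> max_reg R. I \<subseteq> M}"
  unfolding inverse_topology_max_reg_def using assms by (intro topology_generated_by_Basis) blast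

lemma openin_max_space_nbhd:
  assumes "openin max_space U" "M \<in> U"
  shows "\<exists>I. regular_ideal R I \<and> fg_ideal R I \<and> I \<subseteq> M \<and> {M' \<in> max_reg R. I \<subseteq> M'} \<subseteq> U"
proof -
  have "generate_topology_on {{M \<in> max_reg R. I \<subseteq> M} |I. regular_ideal R I \<and> fg_ideal R I} U"
    using assms(1) unfolding inverse_topology_max_reg_def by (rule openin_topology_generated_by)
  then show ?thesis
    using assms(2)
  proof induction
    case (Int a b)
    obtain I where I: "regular_ideal R I" "fg_ideal R I" "I \<subseteq> M" "{M' \<in> max_reg R. I \<subseteq> M'} \<subseteq> a"
      using Int by blast
    obtain J where J: "regular_ideal R J" "fg_ideal R J" "J \<subseteq> M" "{M' \<in> max_reg R. J \<subseteq> M'} \<subseteq> b"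
      using Int by blast
    have i: "ideal I R" "ideal J R" using I J regular_ideal_ideal by auto
    note sub = subset_set_add_left[OF i] subset_set_add_right[OF i]
    \<comment> \<open>\<open>I <+> J \<subseteq> M\<close> requires \<open>M\<close> to be an ideal;
      this is known because \<open>M\<close> lies in the open set \<open>a\<close>, hence in the
      space.\<close>
    have "generate_topology_on {{M \<in> max_reg R. I \<subseteq> M} |I. regular_ideal R I \<and> fg_ideal R I} a"
      using Int by blast
    then have "a \<subseteq> topspace max_space"
      unfolding inverse_topology_max_reg_def
      by (intro openin_subset) (simp add: openin_topology_generated_by_iff)
    then have "M \<in> max_reg R" using Int.prems topspace_max_space by blast
    then have "I <+> J \<subseteq> M" using I J i max_regD(4) by (simp add: set_add_subset_iff)
    moreover have "regular_ideal R (I <+> J)" using regular_ideal_mono[OF I(1) add_ideals[OF i] sub(1)] .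
    moreover have "fg_ideal R (I <+> J)" using I J fg_ideal_set_add by blast
    moreover have "{M' \<in> max_reg R. I <+> J \<subseteq> M'} \<subseteq> a \<inter> b" using sub I J by blast
    ultimately show ?case by blast
  next
    case (UN K)
    then obtain k where "k \<in> K" "M \<in> k" by blast
    then show ?case using UN.IH[of k] by blast
  next
    case (Basis s)
    then show ?case by blast
  qed simp
qed

lemma max_reg_not_subset:
  assumes "M \<in> max_reg R" "M' \<in> max_reg R" "M \<noteq> M'"
  shows "\<not> M' \<subseteq> M"
proof
  assume "M' \<subseteq> M"
  then have "M = M' \<or> M = carrier R"
    using maximalideal.I_maximal[OF max_regD(1)[OF assms(2)] max_regD(4)[OF assms(1)]]
      ideal_subset_carrier[OF max_regD(4)[OF assms(1)]] by blast
  then show False using assms(3) primeideal.I_notcarr[OF max_regD(3)[OF assms(1)]] by blast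
qed

text \<open>Distinct maximal ideals are comaximal: \<open>m \<oplus> r \<otimes> u = \<one>\<close>
  with \<open>m \<in> M\<close> and \<open>u \<in> M'\<close>. Finitely generated regular ideals
  around \<open>m\<close> and \<open>u\<close> then have no maximal ideal over both.\<close>

lemma Hausdorff_max_space: "Hausdorff_space max_space"
  unfolding Hausdorff_space_def topspace_max_space
proof (intro allI impI, elim conjE)
  fix M M' assume M: "M \<in> max_reg R" "M' \<in> max_reg R" "M \<noteq> M'"
  obtain u where u: "u \<in> M'" "u \<notin> M" using max_reg_not_subset[OF M] by blast
  have uc: "u \<in> carrier R" using u(1) by (rule ideal_carrier[OF max_regD(4)[OF M(2)]])
  obtain r m where rm: "r \<in> carrier R" "m \<in> M" "m \<oplus> r \<otimes> u = \<one>"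
    using maximalideal_obtains_inverse[OF max_regD(1)[OF M(1)] uc u(2)] by blast
  obtain I where I: "regular_ideal R I" "fg_ideal R I" "m \<in> I" "I \<subseteq> M"
    using exists_fg_regular_subset[OF M(1) rm(2)] by blast
  obtain I' where I': "regular_ideal R I'" "fg_ideal R I'" "u \<in> I'" "I' \<subseteq> M'"
    using exists_fg_regular_subset[OF M(2) u(1)] by blast
  have "\<not> (I \<subseteq> N \<and> I' \<subseteq> N)" if "N \<in> max_reg R" for N
  proof
    note ND = max_regD[OF that]
    assume "I \<subseteq> N \<and> I' \<subseteq> N"
    then have "m \<oplus> r \<otimes> u \<in> N"
      using I(3) I'(3) rm(1) ideal_mult_closed[OF ND(4)] by (intro ideal_add_closed[OF ND(4)]) auto
    then show False using rm(3) primeideal_one_notin[OF ND(3)] by simp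
  qed
  then show "\<exists>U V. openin max_space U \<and> openin max_space V \<and> M \<in> U \<and> M' \<in> V \<and> disjnt U V"
    using openin_max_space_basic[OF I(1,2)] openin_max_space_basic[OF I'(1,2)] I(4) I'(4) M
    by (intro exI[of _ "{N \<in> max_reg R. I \<subseteq> N}"] exI[of _ "{N \<in> max_reg R. I' \<subseteq> N}"])
       (auto simp: disjnt_iff)
qed

text \<open>A finite subcover is replaced by the product of its ideals, which lies in every point of
  \<open>V\<close>. \<open>P\<close> is trivial when only regularity is wanted, and expresses
  avoidance of a point outside \<open>V\<close> when separation is wanted.\<close>

lemma compactin_max_space_product:
  assumes V: "compactin max_space V"
    and P: "\<And>M. M \<in> V \<Longrightarrow> \<exists>I. regular_ideal R I \<and> fg_ideal R I \<and> I \<subseteq> M \<and> P I"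
  shows "\<exists>Is. (\<forall>I\<in>set Is. regular_ideal R I \<and> P I) \<and> (\<forall>M\<in>V. product_of_ideals R Is \<subseteq> M)"
proof -
  let ?\<I> = "{I. regular_ideal R I \<and> fg_ideal R I \<and> P I}"
  let ?U = "\<lambda>I. {M \<in> max_reg R. I \<subseteq> M}"
  have V_sub: "V \<subseteq> max_reg R" using compactin_subset_topspace[OF V] topspace_max_space by simp
  have "V \<subseteq> \<Union>(?U ` ?\<I>)"
  proof
    fix M assume M: "M \<in> V"
    obtain I where "I \<in> ?\<I>" "I \<subseteq> M" using P[OF M] by blast
    then show "M \<in> \<Union>(?U ` ?\<I>)" using M V_sub by (intro UN_I) auto
  qed
  moreover have "openin max_space U" if "U \<in> ?U ` ?\<I>" for U
    using that openin_max_space_basic by auto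
  ultimately have "\<exists>\<F>. finite \<F> \<and> \<F> \<subseteq> ?U ` ?\<I> \<and> V \<subseteq> \<Union>\<F>"
    by (intro compactinD[OF V])
  then obtain \<F> where F: "finite \<F>" "\<F> \<subseteq> ?U ` ?\<I>" "V \<subseteq> \<Union>\<F>" by (elim exE conjE)
  obtain C where C: "C \<subseteq> ?\<I>" "finite C" "\<F> = ?U ` C"
    using finite_subset_image[OF F(1,2)] by (elim exE conjE)
  obtain Is where Is: "set Is = C" using finite_list[OF C(2)] by blast
  have "product_of_ideals R Is \<subseteq> M" if M: "M \<in> V" for M
  proof -
    obtain I where "I \<in> C" "I \<subseteq> M" using F(3) C(3) M by auto
    then show ?thesis
      using product_of_ideals_subset[of Is I] Is C(1) regular_ideal_ideal by blast
  qed
  then show ?thesis using Is C(1) by blast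
qed

lemma primeideal_product_of_ideals:
  assumes P: "primeideal P R" and "\<And>J. J \<in> set Js \<Longrightarrow> ideal J R" "product_of_ideals R Js \<subseteq> P"
  shows "\<exists>J\<in>set Js. J \<subseteq> P"
  using assms(2,3)
proof (induction Js)
  case Nil
  then show ?case using primeideal_one_notin[OF P] by auto
next
  case (Cons J Js)
  have "J \<subseteq> P \<or> product_of_ideals R Js \<subseteq> P"
    using Cons.prems ideal_product_of_ideals[of Js] by (intro primeideal_prod[OF P]) auto
  then show ?case using Cons by auto
qed

text \<open>Compactness puts a finite product of regular ideals inside the intersection. For
  \<open>M \<notin> V\<close> its factors can be chosen not to lie in \<open>M\<close>, and then the
  prime \<open>M\<close> does not contain the product.\<close>

lemma Inter_compactin_max_space:
  assumes V: "compactin max_space V"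
  shows "regular_ideal R (carrier R \<inter> \<Inter>V)" "radical_ideal R (carrier R \<inter> \<Inter>V)"
    "M \<in> max_reg R \<Longrightarrow> carrier R \<inter> \<Inter>V \<subseteq> M \<longleftrightarrow> M \<in> V"
proof -
  let ?J = "carrier R \<inter> \<Inter>V"
  have V_sub: "V \<subseteq> max_reg R" using compactin_subset_topspace[OF V] topspace_max_space by simp
  then show rad: "radical_ideal R ?J" using max_regD(3) by (intro radical_ideal_Inter_primes) blast
  have fg: "\<exists>I. regular_ideal R I \<and> fg_ideal R I \<and> I \<subseteq> M' \<and> True" if "M' \<in> V" for M'
    using that V_sub exists_fg_regular_subset[of M' \<zero>] ideal_zero_closed[OF max_regD(4)] by blast
  obtain Is where Is: "\<And>I. I \<in> set Is \<Longrightarrow> regular_ideal R I" "\<forall>M\<in>V. product_of_ideals R Is \<subseteq> M"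
    using compactin_max_space_product[OF V fg] by blast
  have reg: "regular_ideal R (product_of_ideals R Is)" using Is(1) by (rule regular_product_of_ideals)
  have "product_of_ideals R Is \<subseteq> ?J" using Is(2) ideal_subset_carrier[OF regular_ideal_ideal[OF reg]] by blast
  then show "regular_ideal R ?J" using regular_ideal_mono[OF reg radical_ideal_ideal[OF rad]] by blast
  assume M: "M \<in> max_reg R"
  show "?J \<subseteq> M \<longleftrightarrow> M \<in> V"
  proof
    assume sub: "?J \<subseteq> M"
    show "M \<in> V"
    proof (rule ccontr)
      assume "M \<notin> V"
      have sep: "\<exists>I. regular_ideal R I \<and> fg_ideal R I \<and> I \<subseteq> M' \<and> \<not> I \<subseteq> M" if M': "M' \<in> V" for M'
      proof -
        have "M' \<in> max_reg R" "M \<noteq> M'" using M' V_sub \<open>M \<notin> V\<close> by auto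
        moreover from this obtain u where "u \<in> M'" "u \<notin> M" using max_reg_not_subset[OF M] by blast
        ultimately show ?thesis using exists_fg_regular_subset[of M' u] by blast
      qed
      obtain Is where Is: "\<And>I. I \<in> set Is \<Longrightarrow> regular_ideal R I \<and> \<not> I \<subseteq> M" "\<forall>M\<in>V. product_of_ideals R Is \<subseteq> M"
        using compactin_max_space_product[OF V sep] by blast
      have Isi: "ideal I R" if "I \<in> set Is" for I using Is(1)[OF that] regular_ideal_ideal by blast
      then have "ideal (product_of_ideals R Is) R" by (rule ideal_product_of_ideals)
      then have "product_of_ideals R Is \<subseteq> M" using sub Is(2) ideal_subset_carrier by blast
      then show False using primeideal_product_of_ideals[OF max_regD(3)[OF M] Isi] Is(1) by blast
    qed
  qed blast
qed

end

text \<open>An unbounded \<open>f\<close> would have a decreasing sequence of nonempty compact,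
  hence closed, superlevel sets, and \<open>f\<close> would exceed every number at a common
  point.\<close>

lemma compact_usc_bounded:
  assumes X: "Hausdorff_space X" and f: "f \<in> compact_usc X"
  shows "\<exists>N. \<forall>x\<in>topspace X. f x \<le> N"
proof (rule ccontr)
  assume "\<not> ?thesis"
  then have large: "\<exists>x\<in>topspace X. N < f x" for N by (meson not_le)
  \<comment> \<open>\<open>Suc n\<close> keeps the level positive, where compactness is available,
    and makes \<open>x \<in> C (f x)\<close> absurd.\<close>
  define C where "C n = {x \<in> topspace X. f x \<ge> Suc n}" for n
  have comp: "compactin X (C n)" for n using f by (simp add: compact_usc_def C_def)
  have "closedin (subtopology X (C 0)) (C n)" for n
  proof -
    have "C n \<inter> C 0 = C n" by (auto simp: C_def)
    then show ?thesis
      using compactin_imp_closedin[OF X comp[of n]] unfolding closedin_subtopology by metis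
  qed
  moreover have "C n \<noteq> {}" for n using large[of n] by (auto simp: C_def)
  moreover have "decseq C" by (auto simp: decseq_def C_def)
  moreover have "compact_space (subtopology X (C 0))" using comp by (simp add: compactin_subspace)
  ultimately have "(\<Inter>n. C n) \<noteq> {}" by (intro compact_space_imp_nest)
  then obtain x where "x \<in> C (f x)" by blast
  then show False by (simp add: C_def)
qed

section \<open>Compact superlevel sets of orders and the lattice isomorphism\<close>

context sp_cring
begin

text \<open>Compactness becomes an ideal question: \<open>T\<close> collects the \<open>t\<close>
  for which the points not containing \<open>t\<close> are covered by finitely many members of the
  cover. A sum lies outside \<open>M\<close> only if a summand does, so \<open>T\<close> is an
  ideal, and \<open>\<one> \<in> T\<close> is the wanted finite cover.\<close>

lemma compactin_max_space_above:
  assumes J: "regular_ideal R J"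
  shows "compactin max_space {M \<in> max_reg R. J \<subseteq> M}" (is "compactin _ ?V")
  unfolding compactin_def topspace_max_space
proof (intro conjI allI impI)
  show "?V \<subseteq> max_reg R" by blast
  fix \<U> assume \<U>: "(\<forall>U\<in>\<U>. openin max_space U) \<and> ?V \<subseteq> \<Union>\<U>"
  define T where "T = {t \<in> carrier R. \<exists>\<F>. finite \<F> \<and> \<F> \<subseteq> \<U> \<and> (\<forall>M\<in>?V. t \<notin> M \<longrightarrow> M \<in> \<Union>\<F>)}"
  have Ji: "ideal J R" using J by (rule regular_ideal_ideal)
  have JT: "J \<subseteq> T" using ideal_subset_carrier[OF Ji] by (auto simp: T_def intro!: exI[of _ "{}"])
  have T: "ideal T R"
  proof (rule ideal_criterion)
    show "\<zero> \<in> T" using JT ideal_zero_closed[OF Ji] by blast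
    fix t t' assume "t \<in> T" "t' \<in> T"
    then obtain \<F> \<G> where *: "t \<in> carrier R" "t' \<in> carrier R" "finite \<F>" "\<F> \<subseteq> \<U>" "finite \<G>" "\<G> \<subseteq> \<U>"
      "\<forall>M\<in>?V. t \<notin> M \<longrightarrow> M \<in> \<Union>\<F>" "\<forall>M\<in>?V. t' \<notin> M \<longrightarrow> M \<in> \<Union>\<G>" unfolding T_def by blast
    have "M \<in> \<Union>(\<F> \<union> \<G>)" if "M \<in> ?V" "t \<oplus> t' \<notin> M" for M
    proof -
      have "ideal M R" using that(1) max_regD(4)[of M] by simp
      then have "t \<notin> M \<or> t' \<notin> M" using that(2) ideal_add_closed[of M R t t'] by blast
      then show ?thesis using * that(1) by blast
    qed
    then have "\<forall>M\<in>?V. t \<oplus> t' \<notin> M \<longrightarrow> M \<in> \<Union>(\<F> \<union> \<G>)" by (intro ballI impI)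
    moreover have "finite (\<F> \<union> \<G>)" "\<F> \<union> \<G> \<subseteq> \<U>" using *(3-6) by simp_all
    ultimately show "t \<oplus> t' \<in> T"
      using *(1,2) unfolding T_def by (intro CollectI conjI exI[of _ "\<F> \<union> \<G>"]) simp_all
  next
    fix r t assume r: "r \<in> carrier R" and "t \<in> T"
    then obtain \<F> where *: "t \<in> carrier R" "finite \<F>" "\<F> \<subseteq> \<U>" "\<forall>M\<in>?V. t \<notin> M \<longrightarrow> M \<in> \<Union>\<F>"
      unfolding T_def by blast
    have "M \<in> \<Union>\<F>" if "M \<in> ?V" "r \<otimes> t \<notin> M" for M
    proof -
      have "ideal M R" using that(1) max_regD(4)[of M] by simp
      then have "t \<notin> M" using that(2) ideal_mult_closed[of M R t r] r by blast
      then show ?thesis using that(1) *(4) by blast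
    qed
    then show "r \<otimes> t \<in> T" using * r unfolding T_def by blast
  qed (auto simp: T_def)
  have "T = carrier R"
  proof (rule ccontr)
    assume "T \<noteq> carrier R"
    then obtain M where M: "M \<in> max_reg R" "T \<subseteq> M"
      using exists_max_reg[OF regular_ideal_mono[OF J T JT]] by blast
    then have "M \<in> ?V" using JT by blast
    then obtain U where U: "U \<in> \<U>" "M \<in> U" using \<U> by blast
    then obtain I where I: "regular_ideal R I" "fg_ideal R I" "I \<subseteq> M" "{M' \<in> max_reg R. I \<subseteq> M'} \<subseteq> U"
      using openin_max_space_nbhd[of U M] \<U> by blast
    obtain s where s: "PIdl s \<subseteq> J" "regular_ideal R (PIdl s)" "fg_ideal R (PIdl s)"
      using J by (rule regular_ideal_obtains_nonzerodivisor)
    have si: "ideal (PIdl s) R" using s(2) by (rule regular_ideal_ideal)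
    \<comment> \<open>\<open>J0\<close> lies in every point over \<open>J\<close> and is a
      uniformizer at \<open>M\<close>. If \<open>u\<close> carries \<open>I\<close> into
      \<open>J0\<close>, each such point without \<open>u\<close> contains \<open>I\<close> and so
      belongs to \<open>U\<close>.\<close>
    define J0 where "J0 = radical R (PIdl s)"
    have J0_sub: "J0 \<subseteq> M'" if "M' \<in> ?V" for M'
      unfolding J0_def using that s(1) max_regD(3) by (intro radical_subset_prime) auto
    have J0: "uniformizer M J0"
      unfolding uniformizer_def using J0_sub[OF \<open>M \<in> ?V\<close>] M(1) invertible_radical[OF s(3,2)]
        radical_ideal_radical[OF si] by (simp add: J0_def)
    have "\<forall>x\<in>I. \<exists>u\<in>carrier R - M. u \<otimes> x \<in> J0" using uniformizer_denominator[OF J0] I(3) by blast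
    then obtain u where u: "u \<in> carrier R - M" "\<forall>x\<in>I. u \<otimes> x \<in> J0"
      using fg_ideal_uniform_denominator[OF I(2) submonoid_complement[OF max_regD(3)[OF M(1)]]
          uniformizerD(5)[OF J0]] by blast
    have "M' \<in> U" if M': "M' \<in> ?V" "u \<notin> M'" for M'
    proof -
      have "x \<in> M'" if x: "x \<in> I" for x
      proof -
        have "x \<in> carrier R" using x by (rule ideal_carrier[OF fg_ideal_ideal[OF I(2)]])
        moreover have "u \<otimes> x \<in> M'" using u(2) x J0_sub[OF M'(1)] by blast
        ultimately show ?thesis
          using primeideal_mult_notin[OF max_regD(3), of M' u x] M' u(1) by blast
      qed
      then show ?thesis using I(4) M'(1) by blast
    qed
    then have "u \<in> T" using u(1) U(1) unfolding T_def by (auto intro!: exI[of _ "{U}"])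
    then show False using u(1) M(2) by blast
  qed
  then have "\<one> \<in> T" by simp
  then obtain \<F> where F: "finite \<F>" "\<F> \<subseteq> \<U>" "\<forall>M\<in>?V. \<one> \<notin> M \<longrightarrow> M \<in> \<Union>\<F>" unfolding T_def by blast
  have "?V \<subseteq> \<Union>\<F>"
  proof
    fix M assume M: "M \<in> ?V"
    then have "\<one> \<notin> M" using primeideal_one_notin[OF max_regD(3)] by simp
    then show "M \<in> \<Union>\<F>" using F(3) M by (elim ballE) auto
  qed
  then show "\<exists>\<F>. finite \<F> \<and> \<F> \<subseteq> \<U> \<and> ?V \<subseteq> \<Union>\<F>" using F(1,2) by (intro exI conjI)
qed

lemma ideal_order_compact_usc:
  assumes I: "regular_ideal R I"
  shows "(\<lambda>M\<in>max_reg R. ideal_order I M) \<in> compact_usc max_space"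
proof -
  have "compactin max_space {M \<in> max_reg R. k \<le> ideal_order I M}" if k: "k \<ge> 1" for k
    using compactin_max_space_above[OF regular_level_ideal[OF I k]] level_ideal_subset_iff[OF I k]
    by (simp cong: conj_cong)
  moreover have "{M \<in> max_reg R. k \<le> (\<lambda>M\<in>max_reg R. ideal_order I M) M} =
      {M \<in> max_reg R. k \<le> ideal_order I M}" for k by auto
  ultimately show ?thesis by (simp add: compact_usc_def topspace_max_space)
qed

text \<open>The positive superlevel sets of \<open>f\<close> are compact, so their intersections are
  regular radical ideals contained in exactly the points of the set; counting levels, their product
  has order \<open>f\<close>.\<close>

lemma exists_ideal_with_order:
  assumes f: "f \<in> compact_usc max_space"
  shows "\<exists>I. regular_ideal R I \<and> (\<lambda>M\<in>max_reg R. ideal_order I M) = f"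
proof -
  obtain N where N: "\<forall>M\<in>max_reg R. f M \<le> N"
    using compact_usc_bounded[OF Hausdorff_max_space f] by (auto simp: topspace_max_space)
  define V where "V k = {M \<in> max_reg R. k \<le> f M}" for k
  define J where "J k = carrier R \<inter> \<Inter>(V k)" for k
  have V: "compactin max_space (V k)" if "k \<ge> 1" for k
    using f that by (simp add: compact_usc_def topspace_max_space V_def)
  note J = Inter_compactin_max_space[OF V, folded J_def]
  let ?Js = "map J [1..<Suc N]"
  have reg: "regular_ideal R K" if "K \<in> set ?Js" for K using that J(1) by auto
  have "ideal_order (product_of_ideals R ?Js) M = f M" if M: "M \<in> max_reg R" for M
  proof -
    have "ideal_order (J k) M = (if k \<le> f M then 1 else 0)" if "k \<ge> 1" for k
      using ideal_order_radical_ideal[OF J(1,2)[OF that] M] J(3)[OF that M] M by (simp add: V_def)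
    then have "(\<Sum>K\<leftarrow>?Js. ideal_order K M) = (\<Sum>k\<leftarrow>[1..<Suc N]. if k \<le> f M then 1 else 0)"
      unfolding map_map by (intro arg_cong[where f = sum_list] map_cong) auto
    then show ?thesis
      using ideal_order_product_of_ideals[OF M reg] N M by (simp only: sum_list_threshold) simp
  qed
  moreover have "f \<in> extensional (max_reg R)" using f by (simp add: compact_usc_def topspace_max_space)
  ultimately have "(\<lambda>M\<in>max_reg R. ideal_order (product_of_ideals R ?Js) M) = f"
    by (intro extensionalityI) auto
  then show ?thesis using regular_product_of_ideals[of ?Js, OF reg] by blast
qed

lemma regular_ideal_lattice_iso:
  assumes nz: "\<one> \<noteq> \<zero>"
  shows "mult_lattice_iso (regular_ideal_lattice R) (compact_usc_lattice max_space) \<noteq> {}"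
proof -
  let ?L = "regular_ideal_lattice R" and ?K = "compact_usc_lattice max_space"
  define ord where "ord I = (\<lambda>M\<in>max_reg R. ideal_order I M)" for I
  \<comment> \<open>The zero ideal is the one member of the lattice that is not regular, by
    \<open>\<one> \<noteq> \<zero>\<close>, and goes to the adjoined bottom.\<close>
  define h where "h I = (if regular_ideal R I then Some (ord I) else None)" for I
  have zero: "\<not> regular_ideal R {\<zero>}" using nz by (rule zero_ideal_not_regular)
  have ord_usc: "ord I \<in> compact_usc max_space" if "regular_ideal R I" for I
    unfolding ord_def using that by (rule ideal_order_compact_usc)
  have mult: "h (I \<cdot> J) = h I \<otimes>\<^bsub>?K\<^esub> h J" if IJ: "I \<in> carrier ?L" "J \<in> carrier ?L" for I J
  proof -
    consider "regular_ideal R I" "regular_ideal R J" | "I = {\<zero>}" "ideal J R" | "J = {\<zero>}" "ideal I R"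
      using IJ zeroideal regular_ideal_ideal by (auto simp: regular_ideal_lattice_def)
    then show ?thesis
    proof cases
      case 1
      then have "ord (I \<cdot> J) = (\<lambda>M\<in>max_reg R. ord I M + ord J M)"
        unfolding ord_def by (intro restrict_ext) (simp add: ideal_order_prod)
      then show ?thesis
        using 1 regular_ideal_prod by (simp add: h_def compact_usc_lattice_def topspace_max_space)
    next
      case 2
      then have "I \<cdot> J = {\<zero>}" using ideal_prod_zero ideal_prod_commute zeroideal by metis
      then show ?thesis using 2 zero by (simp add: h_def compact_usc_lattice_def)
    next
      case 3
      then have "I \<cdot> J = {\<zero>}" using ideal_prod_zero by blast
      then show ?thesis using 3 zero by (simp add: h_def compact_usc_lattice_def split: option.split)
    qed
  qed
  have le: "I \<subseteq> J \<longleftrightarrow> leq ?K (h I) (h J)" if IJ: "I \<in> carrier ?L" "J \<in> carrier ?L" for I J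
  proof -
    consider "regular_ideal R I" "regular_ideal R J" | "I = {\<zero>}" "ideal J R"
      | "J = {\<zero>}" "regular_ideal R I"
      using IJ zeroideal regular_ideal_ideal by (auto simp: regular_ideal_lattice_def)
    then show ?thesis
    proof cases
      case 1
      then have "I \<subseteq> J \<longleftrightarrow> (\<forall>M\<in>max_reg R. ideal_order J M \<le> ideal_order I M)"
        using subset_if_ideal_order_le[OF 1] ideal_order_antimono[OF 1] by blast
      then show ?thesis
        using 1 by (simp add: h_def compact_usc_lattice_def topspace_max_space ord_def)
    next
      case 2
      then show ?thesis using zero ideal_zero_closed by (auto simp: h_def compact_usc_lattice_def)
    next
      case 3
      have "\<not> I \<subseteq> {\<zero>}" using 3(2) zero regular_ideal_mono zeroideal by blast
      then show ?thesis using 3 zero by (simp add: h_def compact_usc_lattice_def)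
    qed
  qed
  have "h ` carrier ?L = carrier ?K"
  proof
    show "h ` carrier ?L \<subseteq> carrier ?K"
      using ord_usc zero by (auto simp: regular_ideal_lattice_def compact_usc_lattice_def h_def)
    show "carrier ?K \<subseteq> h ` carrier ?L"
    proof
      fix v assume "v \<in> carrier ?K"
      then consider "v = None" | f where "v = Some f" "f \<in> compact_usc max_space"
        by (auto simp: compact_usc_lattice_def)
      then show "v \<in> h ` carrier ?L"
      proof cases
        case 1
        then have "v = h {\<zero>}" using zero by (simp add: h_def)
        then show ?thesis by (simp add: regular_ideal_lattice_def)
      next
        case 2
        then obtain I where I: "regular_ideal R I" "ord I = f"
          using exists_ideal_with_order unfolding ord_def by blast
        then have "v = h I" using 2 by (simp add: h_def)
        then show ?thesis using I by (simp add: regular_ideal_lattice_def)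
      qed
    qed
  qed
  moreover have "inj_on h (carrier ?L)"
  proof (rule inj_onI)
    have refl: "leq ?K v v" for v by (simp add: compact_usc_lattice_def split: option.split)
    fix I J assume "I \<in> carrier ?L" "J \<in> carrier ?L" "h I = h J"
    then show "I = J" using le[of I J] le[of J I] refl by auto
  qed
  ultimately have "bij_betw h (carrier ?L) (carrier ?K)" by (simp add: bij_betw_def)
  moreover have "h \<in> hom ?L ?K"
    unfolding hom_def using mult \<open>h ` carrier ?L = carrier ?K\<close>
    by (auto simp: regular_ideal_lattice_def)
  ultimately have "h \<in> iso ?L ?K" by (simp add: iso_def)
  moreover have "ord (carrier R) = (\<lambda>M\<in>max_reg R. 0)"
    unfolding ord_def by (intro restrict_ext) (simp add: ideal_order_carrier)
  then have "h \<one>\<^bsub>?L\<^esub> = \<one>\<^bsub>?K\<^esub>"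
    using regular_ideal_carrier
    by (simp add: h_def regular_ideal_lattice_def compact_usc_lattice_def topspace_max_space)
  ultimately have "h \<in> mult_lattice_iso ?L ?K"
    using le by (simp add: mult_lattice_iso_def) (simp add: regular_ideal_lattice_def)
  then show ?thesis by blast
qed

end

section \<open>From the lattice isomorphism back to factorizations\<close>

context cring
begin

lemma radical_ideal_if_square:
  assumes I: "ideal I R" and sq: "\<And>y. y \<in> carrier R \<Longrightarrow> y \<otimes> y \<in> I \<Longrightarrow> y \<in> I"
  shows "radical_ideal R I"
proof (rule radical_idealI[OF I])
  fix x and n :: nat assume x: "x \<in> carrier R"
  show "n \<ge> 1 \<Longrightarrow> x [^] n \<in> I \<Longrightarrow> x \<in> I"
  proof (induction n rule: less_induct)
    case (less n)
    show ?case
    proof (cases "n = 1")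
      case True
      then show ?thesis using less x by simp
    next
      case False
      \<comment> \<open>Rounding up gives \<open>n \<le> m + m\<close>, so power
        \<open>m + m\<close> of \<open>x\<close> is a multiple of power \<open>n\<close>; still
        \<open>m < n\<close> because \<open>n \<noteq> 1\<close>.\<close>
      define m where "m = (n + 1) div 2"
      have m: "m < n" "m \<ge> 1" "n \<le> m + m" using less(2) False by (auto simp: m_def)
      have "x [^] (m + m - n) \<otimes> x [^] n \<in> I" using less(3) x by (intro ideal_mult_closed[OF I]) auto
      then have "x [^] m \<otimes> x [^] m \<in> I" using x m(3) by (simp add: nat_pow_mult)
      then show ?thesis using sq[of "x [^] m"] less(1)[OF m(1,2)] x by simp
    qed
  qed
qed

text \<open>The characteristic function of a compact set corresponds to a radical ideal, and every
  function in \<open>compact_usc\<close> is a finite sum of such functions.\<close>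

lemma sp_ring_if_lattice_iso:
  assumes nz: "\<one> \<noteq> \<zero>"
    and h: "h \<in> mult_lattice_iso (regular_ideal_lattice R) (compact_usc_lattice max_space)"
  shows "sp_ring R"
  unfolding sp_ring_def
proof (intro allI impI)
  let ?L = "regular_ideal_lattice R" and ?K = "compact_usc_lattice max_space"
  have hom: "h \<in> hom ?L ?K" and bij: "bij_betw h (carrier ?L) (carrier ?K)"
    and one: "h (carrier R) = Some (\<lambda>M\<in>max_reg R. 0)"
    using h by (auto simp: mult_lattice_iso_def iso_def regular_ideal_lattice_def compact_usc_lattice_def
        topspace_max_space)
  have "\<forall>I\<in>carrier ?L. \<forall>J\<in>carrier ?L. leq ?L I J \<longleftrightarrow> leq ?K (h I) (h J)"
    using h by (simp add: mult_lattice_iso_def)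
  moreover have "leq ?L = (\<subseteq>)" by (simp add: regular_ideal_lattice_def)
  ultimately have le: "I \<subseteq> J \<longleftrightarrow> leq ?K (h I) (h J)" if "I \<in> carrier ?L" "J \<in> carrier ?L" for I J
    using that by simp
  have L: "carrier ?L = {I. regular_ideal R I} \<union> {{\<zero>}}" by (simp add: regular_ideal_lattice_def)
  have K: "carrier ?K = insert None (Some ` compact_usc max_space)" by (simp add: compact_usc_lattice_def)
  have zero: "\<not> regular_ideal R {\<zero>}" using nz by (rule zero_ideal_not_regular)
  \<comment> \<open>Some \<open>A\<close> is sent to the least element, and
    \<open>{\<zero>} \<subseteq> A\<close> forces the image of the zero ideal below it.\<close>
  have h_zero: "h {\<zero>} = None"
  proof -
    have "None \<in> h ` carrier ?L" using bij K by (auto simp: bij_betw_def)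
    then obtain A where A: "A \<in> carrier ?L" "h A = None" by (metis imageE)
    have "{\<zero>} \<subseteq> A" using A(1) ideal_zero_closed regular_ideal_ideal by (auto simp: L)
    then have "leq ?K (h {\<zero>}) None" using le[of "{\<zero>}" A] A L by auto
    then show ?thesis by (auto simp: compact_usc_lattice_def split: option.splits)
  qed
  have inj: "I = J" if "regular_ideal R I" "regular_ideal R J" "h I = h J" for I J
    using that bij L by (auto simp: bij_betw_def inj_on_def)
  have to_fun: "\<exists>f\<in>compact_usc max_space. h I = Some f" if I: "regular_ideal R I" for I
  proof -
    have "h I \<in> carrier ?K" using bij I L by (auto simp: bij_betw_def)
    moreover have "h I \<noteq> None"
    proof
      assume "h I = None"
      then have "I = {\<zero>}" using bij h_zero I L by (auto simp: bij_betw_def inj_on_def)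
      then show False using I zero by simp
    qed
    ultimately show ?thesis using K by auto
  qed
  have from_fun: "\<exists>I. regular_ideal R I \<and> h I = Some f" if f: "f \<in> compact_usc max_space" for f
  proof -
    have "Some f \<in> h ` carrier ?L" using bij K f by (auto simp: bij_betw_def)
    then obtain I where "I \<in> carrier ?L" "h I = Some f" by (metis imageE)
    then show ?thesis using h_zero L by auto
  qed
  have mult: "h (I \<cdot> J) = Some (\<lambda>M\<in>max_reg R. f M + g M)"
    if "regular_ideal R I" "regular_ideal R J" "h I = Some f" "h J = Some g" for I J f g
  proof -
    have "h (I \<otimes>\<^bsub>?L\<^esub> J) = h I \<otimes>\<^bsub>?K\<^esub> h J" using hom that L by (auto simp: hom_def)
    then show ?thesis
      using that by (simp add: regular_ideal_lattice_def compact_usc_lattice_def topspace_max_space)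
  qed
  have le_fun: "I \<subseteq> J \<longleftrightarrow> (\<forall>M\<in>max_reg R. f M \<ge> g M)"
    if "regular_ideal R I" "regular_ideal R J" "h I = Some f" "h J = Some g" for I J f g
    using le[of I J] that L by (simp add: compact_usc_lattice_def topspace_max_space)
  \<comment> \<open>Radicality is read off from the order: \<open>A = I <+> PIdl y\<close> satisfies
    \<open>A \<cdot> A \<subseteq> I\<close>, so its function \<open>g\<close> satisfies
    \<open>g + g \<ge> f\<close>. Since \<open>f\<close> is at most 1, this gives
    \<open>g \<ge> f\<close>, that is \<open>A \<subseteq> I\<close>.\<close>
  have radical: "radical_ideal R I"
    if I: "regular_ideal R I" "h I = Some f" "\<forall>M\<in>max_reg R. f M \<le> 1" for I f
  proof (rule radical_ideal_if_square)
    show Ii: "ideal I R" using I(1) by (rule regular_ideal_ideal)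
    fix y assume y: "y \<in> carrier R" "y \<otimes> y \<in> I"
    have yi: "ideal (PIdl y) R" using y(1) by (rule cgenideal_ideal)
    have yy: "ideal ((PIdl y) \<cdot> (PIdl y)) R" using yi yi by (rule ideal_prod_is_ideal)
    define A where "A = I <+> PIdl y"
    have A: "ideal A R" "I \<subseteq> A" "PIdl y \<subseteq> A"
      unfolding A_def using add_ideals[OF Ii yi] subset_set_add_left[OF Ii yi] subset_set_add_right[OF Ii yi]
      by auto
    have Areg: "regular_ideal R A" using regular_ideal_mono[OF I(1) A(1,2)] .
    have "A \<cdot> A = A \<cdot> I <+> (I \<cdot> (PIdl y) <+> (PIdl y) \<cdot> (PIdl y))"
      using A(1) Ii yi ideal_prod_distr(1)[OF A(1) Ii yi] ideal_prod_distr(2)[OF yi Ii yi]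
      by (simp add: A_def)
    also have "\<dots> \<subseteq> I"
      using A(1) Ii yi yy y PIdl_prod[OF y(1) y(1)] ideal_prod_subset_right[OF A(1) Ii]
        ideal_prod_subset_left[OF Ii yi] PIdl_subset_iff[OF Ii, of "y \<otimes> y"]
      by (simp add: set_add_subset_iff ideal_prod_is_ideal add_ideals)
    finally have AA: "A \<cdot> A \<subseteq> I" .
    obtain g where g: "h A = Some g" using to_fun[OF Areg] by blast
    have "\<forall>M\<in>max_reg R. (\<lambda>M\<in>max_reg R. g M + g M) M \<ge> f M"
      using AA le_fun[OF regular_ideal_prod[OF Areg Areg] I(1) mult[OF Areg Areg g g] I(2)] by blast
    then have "\<forall>M\<in>max_reg R. g M \<ge> f M" using I(3) by fastforce
    then have "A \<subseteq> I" using le_fun[OF Areg I(1) g I(2)] by blast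
    then show "y \<in> I" using A(3) cgenideal_self[OF y(1)] by blast
  qed
  fix I assume I: "regular_ideal R I"
  obtain f where f: "f \<in> compact_usc max_space" "h I = Some f" using to_fun[OF I] by blast
  obtain N where N: "\<forall>M\<in>max_reg R. f M \<le> N"
    using compact_usc_bounded[OF Hausdorff_max_space f(1)] by (auto simp: topspace_max_space)
  define \<chi> where "\<chi> k = (\<lambda>M\<in>max_reg R. if k \<le> f M then 1 else (0::nat))" for k
  have "\<chi> k \<in> compact_usc max_space" if k: "k \<ge> 1" for k
  proof -
    \<comment> \<open>Among the positive levels of \<open>\<chi> k\<close> only level 1 can be
      nonempty, and it is the compact level \<open>k\<close> of \<open>f\<close>.\<close>
    have "{M \<in> max_reg R. l \<le> \<chi> k M} = (if l = 1 then {M \<in> max_reg R. k \<le> f M} else {})"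
      if "l \<ge> 1" for l using that by (auto simp: \<chi>_def)
    then show ?thesis
      using f(1) k by (auto simp: compact_usc_def topspace_max_space \<chi>_def)
  qed
  then have "\<forall>k. k \<ge> 1 \<longrightarrow> (\<exists>A. regular_ideal R A \<and> h A = Some (\<chi> k))" using from_fun by blast
  then obtain A where A: "\<And>k. k \<ge> 1 \<Longrightarrow> regular_ideal R (A k)" "\<And>k. k \<ge> 1 \<Longrightarrow> h (A k) = Some (\<chi> k)"
    by metis
  have A_rad: "radical_ideal R (A k)" if "k \<ge> 1" for k
    using radical[OF A[OF that]] by (simp add: \<chi>_def)
  have prod: "regular_ideal R (product_of_ideals R (map A ks)) \<and>
      h (product_of_ideals R (map A ks)) = Some (\<lambda>M\<in>max_reg R. \<Sum>k\<leftarrow>ks. \<chi> k M)"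
    if "\<forall>k\<in>set ks. k \<ge> 1" for ks
    using that
  proof (induction ks)
    case Nil
    then show ?case using one regular_ideal_carrier by (simp add: restrict_def)
  next
    case (Cons k ks)
    then have IH: "regular_ideal R (product_of_ideals R (map A ks))"
      "h (product_of_ideals R (map A ks)) = Some (\<lambda>M\<in>max_reg R. \<Sum>k\<leftarrow>ks. \<chi> k M)" and k: "k \<ge> 1"
      by auto
    have "(\<lambda>M\<in>max_reg R. \<chi> k M + (\<lambda>M\<in>max_reg R. \<Sum>k\<leftarrow>ks. \<chi> k M) M) = (\<lambda>M\<in>max_reg R. \<Sum>k\<leftarrow>k # ks. \<chi> k M)"
      by (intro restrict_ext) simp
    then show ?case
      using mult[OF A(1)[OF k] IH(1) A(2)[OF k] IH(2)] regular_ideal_prod[OF A(1)[OF k] IH(1)]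
      by (simp add: restrict_def)
  qed
  let ?Js = "map A [1..<Suc N]"
  have "(\<lambda>M\<in>max_reg R. \<Sum>k\<leftarrow>[1..<Suc N]. \<chi> k M) = f"
  proof (rule extensionalityI)
    show "f \<in> extensional (max_reg R)" using f(1) by (simp add: compact_usc_def topspace_max_space)
    fix M assume M: "M \<in> max_reg R"
    have "(\<Sum>k\<leftarrow>[1..<Suc N]. \<chi> k M) = (\<Sum>k\<leftarrow>[1..<Suc N]. if k \<le> f M then 1 else 0)"
      using M by (intro arg_cong[where f = sum_list] map_cong) (auto simp: \<chi>_def)
    then show "(\<lambda>M\<in>max_reg R. \<Sum>k\<leftarrow>[1..<Suc N]. \<chi> k M) M = f M"
      using M N by (simp only: sum_list_threshold restrict_apply' min_absorb1)
  qed simp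
  then have "I = product_of_ideals R ?Js"
    using prod[of "[1..<Suc N]"] inj[OF I] f(2) by auto
  moreover have "\<forall>J\<in>set ?Js. radical_ideal R J" using A_rad by auto
  ultimately show "product_of_radical_ideals R I" unfolding product_of_radical_ideals_def by blast
qed

end

theorem theorem7p4:
  fixes R :: "('a, 'm) ring_scheme" (structure)
  assumes "cring R"
    and "\<one> \<noteq> \<zero>"
    and "\<And>I. regular_ideal R I \<Longrightarrow>
           \<exists>\<F>. (\<forall>J \<in> \<F>. invertible_ideal R J) \<and> I = sum_of_ideals R \<F>"
  defines "cond1 \<equiv> sp_ring R"
    and "cond2 \<equiv> (\<forall>I. regular_ideal R I \<longrightarrow>
           (\<exists>!Js. (\<forall>J \<in> set Js. radical_ideal R J \<and> J \<noteq> carrier R) \<and>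
                  sorted_wrt (\<subseteq>) Js \<and> I = product_of_ideals R Js))"
    and "cond3 \<equiv> (\<forall>P. primeideal P R \<and> regular_ideal R P \<longrightarrow> maximalideal P R) \<and>
           (\<forall>I. invertible_ideal R I \<longrightarrow> product_of_radical_ideals R I)"
    and "cond4 \<equiv> (\<forall>P. primeideal P R \<and> regular_ideal R P \<longrightarrow> maximalideal P R \<and>
           (\<exists>J. invertible_ideal R J \<and> radical_ideal R J \<and> J \<subseteq> P))"
    and "cond5 \<equiv> (\<forall>I. regular_ideal R I \<and> fg_ideal R I \<longrightarrow> invertible_ideal R (radical R I))"
    and "cond6 \<equiv> mult_lattice_iso (regular_ideal_lattice R)
           (compact_usc_lattice (inverse_topology_max_reg R)) \<noteq> {}"
    and "cond7 \<equiv> pruefer_ring R \<and>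
           (\<forall>I. regular_ideal R I \<and> fg_ideal R I \<longrightarrow> fg_ideal R (radical R I))"
  shows "(cond1 \<longleftrightarrow> cond2) \<and> (cond1 \<longleftrightarrow> cond3) \<and> (cond1 \<longleftrightarrow> cond4) \<and>
         (cond1 \<longleftrightarrow> cond5) \<and> (cond1 \<longleftrightarrow> cond6) \<and> (cond1 \<longleftrightarrow> cond7)"
proof -
  interpret cring R by fact
  \<comment> \<open>The hypothesis on sums enters from (1) to (3) and from (5) to (4), where regular
    primes have to be shown maximal.\<close>
  note avoid = exists_invertible_not_subset[OF assms(3)]
  have "cond1 \<Longrightarrow> cond3"
    unfolding cond1_def cond3_def
    using sp_ring_regular_prime_maximal[OF avoid] invertible_ideal_regular
    by (auto simp: sp_ring_def)
  moreover have "cond3 \<Longrightarrow> cond4"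
    unfolding cond4_def
  proof (intro allI impI, elim conjE)
    fix P assume c3: cond3 and P: "primeideal P R" "regular_ideal R P"
    obtain s where s: "PIdl s \<subseteq> P" "invertible_ideal R (PIdl s)"
      using P(2) by (rule regular_ideal_obtains_nonzerodivisor)
    then show "maximalideal P R \<and> (\<exists>J. invertible_ideal R J \<and> radical_ideal R J \<and> J \<subseteq> P)"
      using c3 P exists_invertible_radical_factor[OF P(1) s(2)] unfolding cond3_def by blast
  qed
  moreover have "cond5 \<Longrightarrow> cond4"
    unfolding cond4_def
  proof (intro allI impI, elim conjE)
    fix P assume c5: cond5 and P: "primeideal P R" "regular_ideal R P"
    obtain s where s: "PIdl s \<subseteq> P" "regular_ideal R (PIdl s)" "fg_ideal R (PIdl s)"
      using P(2) by (rule regular_ideal_obtains_nonzerodivisor)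
    have "maximalideal P R"
      using maximalideal_if_radicals_invertible[OF avoid _ P] c5 unfolding cond5_def by blast
    moreover have "invertible_ideal R (radical R (PIdl s))" using c5 s unfolding cond5_def by blast
    moreover have "radical_ideal R (radical R (PIdl s))"
      using radical_ideal_radical[OF regular_ideal_ideal[OF s(2)]] .
    moreover have "radical R (PIdl s) \<subseteq> P" using radical_subset_prime[OF P(1) s(1)] .
    ultimately show "maximalideal P R \<and> (\<exists>J. invertible_ideal R J \<and> radical_ideal R J \<and> J \<subseteq> P)"
      by blast
  qed
  moreover have "cond7 \<Longrightarrow> cond5"
    unfolding cond5_def
  proof (intro allI impI, elim conjE)
    fix I assume c7: cond7 and I: "regular_ideal R I" "fg_ideal R I"
    have Ii: "ideal I R" using I(1) by (rule regular_ideal_ideal)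
    have "regular_ideal R (radical R I)"
      using regular_ideal_mono[OF I(1) ideal_radical[OF Ii] subset_radical[OF Ii]] .
    then show "invertible_ideal R (radical R I)"
      using c7 I unfolding cond7_def pruefer_ring_def by blast
  qed
  moreover have "cond4 \<Longrightarrow> cond7 \<and> cond2 \<and> cond6"
  proof -
    assume c4: cond4
    have "maximalideal P R" "\<exists>J. invertible_ideal R J \<and> radical_ideal R J \<and> J \<subseteq> P"
      if "primeideal P R" "regular_ideal R P" for P
      using c4 that unfolding cond4_def by simp_all
    then interpret sp_cring R by (intro sp_cring.intro sp_cring_axioms.intro is_cring)
    have cond7
      unfolding cond7_def pruefer_ring_def by (intro conjI allI impI) (simp_all add: fg_regular_invertible fg_radical)
    moreover have cond6 unfolding cond6_def using assms(2) by (rule regular_ideal_lattice_iso)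
    moreover have cond2
      unfolding cond2_def
    proof (intro allI impI)
      fix I assume I: "regular_ideal R I"
      show "\<exists>!Js. (\<forall>J \<in> set Js. radical_ideal R J \<and> J \<noteq> carrier R) \<and>
          sorted_wrt (\<subseteq>) Js \<and> I = product_of_ideals R Js"
      proof (rule ex_ex1I)
        show "\<exists>Js. (\<forall>J \<in> set Js. radical_ideal R J \<and> J \<noteq> carrier R) \<and>
            sorted_wrt (\<subseteq>) Js \<and> I = product_of_ideals R Js"
          using I by (rule exists_radical_chain)
      next
        fix Js Ks
        assume "(\<forall>J \<in> set Js. radical_ideal R J \<and> J \<noteq> carrier R) \<and>
            sorted_wrt (\<subseteq>) Js \<and> I = product_of_ideals R Js"
          "(\<forall>J \<in> set Ks. radical_ideal R J \<and> J \<noteq> carrier R) \<and>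
            sorted_wrt (\<subseteq>) Ks \<and> I = product_of_ideals R Ks"
        then show "Js = Ks" using I by (intro radical_chain_unique) auto
      qed
    qed
    ultimately show ?thesis by blast
  qed
  moreover have "cond2 \<Longrightarrow> cond1"
    unfolding cond1_def cond2_def sp_ring_def product_of_radical_ideals_def by (meson ex1_implies_ex)
  moreover have "cond6 \<Longrightarrow> cond1"
    unfolding cond6_def cond1_def using sp_ring_if_lattice_iso[OF assms(2)] by blast
  ultimately show ?thesis by blast
qed

end
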